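(* Let $n\geq 3$. (i) An operator $\Phi:\mathcal{K}^n\to\mathcal{K}^n$ is a Minkowski endomorphism that satisfies (VC) if and only if there are real numbers $a,b\geq 0$ with $a+b>0$ such that $$\Phi(K)=a(K-\mathrm{st}(K))+b(-K+\mathrm{st}(K))\quad\text{for all }K\in\mathcal{K}^n.$$ (ii) An operator $\Phi:\mathcal{K}^n\to\mathcal{K}^n_s$ is a Minkowski endomorphism that satisfies (VC) if and only if there is a $\lambda>0$ such that $\Phi(K)=\lambda\, DK$ for every $K\in\mathcal{K}^n$.
   Context: $\mathcal{K}^n$ is the set of (nonempty) compact convex subsets of $\mathbb{R}^n$, with Minkowski addition $K+L=\{x+y: x\in K, y\in L\}$ and the Hausdorff metric; $\mathcal{K}^n_s\subset\mathcal{K}^n$ is the set of those $K$ with $K=-K$ (symmetric with respect to the origin). $V_n$ is $n$-dimensional Lebesgue measure. An operator $\Phi:\mathcal{K}^n\to\mathcal{K}^n$ is a Minkowski endomorphism if it is continuous (Hausdorff metric), translation invariant ($\Phi(K+t)=\Phi(K)$ for all $t\in\mathbb{R}^n$), Minkowski additive ($\Phi(K+L)=\Phi(K)+\Phi(L)$ for all $K,L$), and $\mathrm{SO}(n)$-equivariant ($\Phi(gK)=g\Phi(K)$ for all $g\in\mathrm{SO}(n)$). $\Phi$ satisfies (VC) (a volume constraint) if there are constants $c_\Phi,C_\Phi>0$ such that $c_\Phi V_n(K)\leq V_n(\Phi(K))\leq C_\Phi V_n(K)$ for all $K\in\mathcal{K}^n$. $h(K,u)=\max\{\langle u,x\rangle: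 x\in K\}$ is the support function. The Steiner point is $\mathrm{st}(K)=\frac{1}{V_n(B^n)}\int_{\mathbb{S}^{n-1}}u\,h(K,u)\,du$, where $B^n$ is the closed Euclidean unit ball, $\mathbb{S}^{n-1}$ the unit sphere, and $du$ is spherical Lebesgue measure. The difference body is $DK=K+(-K)$, with $-K=\{-x: x\in K\}$. *)

theory Defs
  imports "HOL-Analysis.Analysis"
begin

text \<open>
  On sets, \<open>K + L\<close> is the library's Minkowski sum, but \<open>- K\<close> and \<open>K - L\<close> denote complement and
  set difference. Reflections, translates and dilates are therefore written as images.
\<close>

definition convex_bodies :: "'a::euclidean_space set set" where
  "convex_bodies = {K. K \<noteq> {} \<and> compact K \<and> convex K}"

definition symmetric_convex_bodies :: "'a::euclidean_space set set" where
  "symmetric_convex_bodies = {K \<in> convex_bodies. K = uminus ` K}"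

definition hausdorff_dist :: "'a::metric_space set \<Rightarrow> 'a set \<Rightarrow> real" where
  "hausdorff_dist K L = max (SUP x\<in>K. infdist x L) (SUP y\<in>L. infdist y K)"

definition hausdorff_continuous :: "('a::euclidean_space set \<Rightarrow> 'a set) \<Rightarrow> bool" where
  "hausdorff_continuous \<Phi> \<longleftrightarrow>
     (\<forall>K\<in>convex_bodies. \<forall>\<epsilon>>0. \<exists>\<delta>>0. \<forall>L\<in>convex_bodies.
        hausdorff_dist L K < \<delta> \<longrightarrow> hausdorff_dist (\<Phi> L) (\<Phi> K) < \<epsilon>)"

text \<open>The elements of \<open>SO(n)\<close> are the matrices satisfying \<^const>\<open>rotation_matrix\<close>.\<close>

definition minkowski_endomorphism :: "((real ^ 'n) set \<Rightarrow> (real ^ 'n) set) \<Rightarrow> bool" where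
  "minkowski_endomorphism \<Phi> \<longleftrightarrow>
     \<Phi> \<in> convex_bodies \<rightarrow> convex_bodies \<and>
     hausdorff_continuous \<Phi> \<and>
     (\<forall>K\<in>convex_bodies. \<forall>t. \<Phi> ((\<lambda>x. x + t) ` K) = \<Phi> K) \<and>
     (\<forall>K\<in>convex_bodies. \<forall>L\<in>convex_bodies. \<Phi> (K + L) = \<Phi> K + \<Phi> L) \<and>
     (\<forall>K\<in>convex_bodies. \<forall>g. rotation_matrix g \<longrightarrow> \<Phi> ((\<lambda>x. g *v x) ` K) = (\<lambda>x. g *v x) ` \<Phi> K)"

definition volume_constraint :: "('a::euclidean_space set \<Rightarrow> 'a set) \<Rightarrow> bool" where
  "volume_constraint \<Phi> \<longleftrightarrow>
     (\<exists>c>0. \<exists>C>0. \<forall>K\<in>convex_bodies.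
        c * measure lebesgue K \<le> measure lebesgue (\<Phi> K) \<and>
        measure lebesgue (\<Phi> K) \<le> C * measure lebesgue K)"

text \<open>The supremum is a maximum for nonempty compact \<open>K\<close>.\<close>

definition support_function :: "'a::euclidean_space set \<Rightarrow> 'a \<Rightarrow> real" where
  "support_function K u = (SUP x\<in>K. u \<bullet> x)"

text \<open>
  Spherical Lebesgue measure in polar coordinates: \<open>n\<close> times the push-forward of Lebesgue measure on
  the punctured unit ball under \<open>x \<mapsto> x / \<bar>x\<bar>\<close>. Thus a Borel set \<open>A\<close> in the sphere has measure
  \<open>n\<close> times the volume of the cone \<open>{r u. u \<in> A, 0 < r \<le> 1}\<close>, and the sphere itself has the usual
  surface area \<open>n V(B)\<close>.
\<close>

definition spherical_measure :: "'a::euclidean_space measure" where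
  "spherical_measure =
     scale_measure (of_nat DIM('a))
       (distr (restrict_space lborel (cball 0 1 - {0})) (restrict_space borel (sphere 0 1)) sgn)"

lemma emeasure_spherical_measure:
  fixes A :: "'a::euclidean_space set"
  assumes "A \<in> sets borel" "A \<subseteq> sphere 0 1"
  shows "emeasure spherical_measure A =
    of_nat DIM('a) * emeasure lborel {r *\<^sub>R u |r u. u \<in> A \<and> 0 < r \<and> r \<le> 1}"
proof -
  let ?B = "cball 0 1 - {0::'a}"
  have m: "sgn \<in> measurable (restrict_space lborel ?B) (restrict_space borel (sphere 0 1))"
  proof (rule measurable_restrict_space3)
    show "sgn \<in> measurable lborel (borel :: 'a measure)"
      unfolding sgn_div_norm by measurable
  qed (auto simp: norm_sgn)
  have A: "A \<in> sets (restrict_space borel (sphere 0 1))"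
    using assms by (auto simp: sets_restrict_space)
  have eq: "sgn -` A \<inter> ?B = {r *\<^sub>R u |r u. u \<in> A \<and> 0 < r \<and> r \<le> 1}"
  proof (intro equalityI subsetI)
    fix x assume "x \<in> sgn -` A \<inter> ?B"
    then have "x = norm x *\<^sub>R sgn x \<and> sgn x \<in> A \<and> 0 < norm x \<and> norm x \<le> 1"
      by (auto simp: sgn_div_norm)
    then show "x \<in> {r *\<^sub>R u |r u. u \<in> A \<and> 0 < r \<and> r \<le> 1}" by blast
  next
    fix x assume "x \<in> {r *\<^sub>R u |r u. u \<in> A \<and> 0 < r \<and> r \<le> 1}"
    then obtain r u where x: "x = r *\<^sub>R u" "u \<in> A" "0 < r" "r \<le> 1" by blast
    then have "norm u = 1" using assms(2) by auto
    then show "x \<in> sgn -` A \<inter> ?B"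
      using x by (auto simp: sgn_div_norm)
  qed
  have "emeasure (distr (restrict_space lborel ?B) (restrict_space borel (sphere 0 1)) sgn) A
      = emeasure (restrict_space lborel ?B) (sgn -` A \<inter> ?B)"
    by (subst emeasure_distr[OF m A]) (simp add: space_restrict_space)
  also have "\<dots> = emeasure lborel (sgn -` A \<inter> ?B)"
    by (rule emeasure_restrict_space) auto
  finally show ?thesis
    by (simp add: spherical_measure_def eq)
qed

definition steiner_point :: "'a::euclidean_space set \<Rightarrow> 'a" where
  "steiner_point K = (1 / measure lebesgue (cball (0::'a) 1)) *\<^sub>R
     (\<integral>u. support_function K u *\<^sub>R u \<partial>spherical_measure)"

definition difference_body :: "'a::euclidean_space set \<Rightarrow> 'a set" where
  "difference_body K = K + uminus ` K"

end

theory Submission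
  imports Defs
begin

text \<open>Let \<open>H K\<close> be the support function of \<open>\<Phi> K\<close>. The volume constraint says that \<open>\<Phi>\<close> preserves
  full-dimensionality, so \<open>\<Phi>\<close> adds no directions to a segment or a triangle. Hence a segment is mapped
  to a fixed multiple \<open>\<alpha>\<close> of its centred copy. A triangle \<open>T\<close> and its reflection add up to a hexagon,
  a sum of segments, and subadditivity of \<open>H T\<close> then leaves only the solutions
  \<open>a hs T u + (\<alpha> - a) hs T (- u)\<close> plus a linear function. Cutting triangles, shearing and rotating show
  that \<open>a\<close> does not depend on \<open>T\<close>.

  The bodies on which this formula holds up to a linear function are closed under sums, cancellation
  and limits. Averaging triangles over the sphere and extracting Taylor coefficients yields all
  zonal functions \<open>norm u (w \<bullet> u / norm u) ^ m\<close>, and from these, through exponentials and soft maxima of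
  linear functions, every support function is reached. The linear part of a zonal body is a multiple
  of its axis; a weighted average of rotated zonal bodies is a ball up to translation, which forces
  the linear part to be the one given by the Steiner point.

  Conversely, \<open>a (K - st K) + b (- K + st K)\<close> contains translates of \<open>a K\<close> and of \<open>- b K\<close> and is
  contained in a translate of \<open>a + b\<close> times the difference body, whose volume is at most \<open>4 ^ n\<close> times
  that of \<open>K\<close>.\<close>

section \<open>Support functions\<close>

text \<open>The obstacle is that not every convex body is a limit of sums of triangles. Only
  differences of support functions of good bodies reach everything, and such differences are not
  closed under pointwise limits. Hence the control of second derivatives along great circles: a
  function with bounded values and bounded second derivatives becomes a support function after a
  multiple of the norm is added, and as long as this multiple stays bounded along a sequence, the
  limit is again a difference of good support functions. The series whose coefficients are extracted
  come from stretching averaged bodies along an axis by a parameter \<open>s\<close>, which yields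
  binomial series in \<open>s\<close>. Segments produce only even functions; the odd degrees need a
  triangle whose cubic moment does not vanish. Two classes of bodies are used. The formula up to an
  unknown linear function passes from triangles to zonal bodies, the exact formula from zonal bodies
  to all bodies. In between, rotations reduce the unknown linear function to a single number for
  each degree.\<close>

abbreviation hs :: "'a::euclidean_space set \<Rightarrow> 'a \<Rightarrow> real" where
  "hs \<equiv> support_function"

lemma convex_bodiesD:
  assumes "K \<in> convex_bodies"
  shows "K \<noteq> {}" "compact K" "convex K" "closed K" "bounded K"
  using assms by (auto simp: convex_bodies_def compact_imp_closed compact_imp_bounded)

lemma bdd_above_inner:
  assumes "K \<in> convex_bodies"
  shows "bdd_above ((\<bullet>) u ` K)"
  by (intro bounded_imp_bdd_above compact_imp_bounded compact_continuous_image continuous_intros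
      convex_bodiesD assms)

lemma inner_le_hs:
  assumes "K \<in> convex_bodies" "x \<in> K"
  shows "u \<bullet> x \<le> hs K u"
  unfolding support_function_def by (rule cSUP_upper[OF assms(2) bdd_above_inner[OF assms(1)]])

lemma hs_attained:
  assumes "K \<in> convex_bodies"
  obtains x where "x \<in> K" "hs K u = u \<bullet> x"
proof -
  have "\<exists>x\<in>K. \<forall>y\<in>K. u \<bullet> y \<le> u \<bullet> x"
    by (rule continuous_attains_sup) (auto intro!: continuous_intros convex_bodiesD assms)
  then obtain x where "x \<in> K" "\<forall>y\<in>K. u \<bullet> y \<le> u \<bullet> x" by blast
  moreover from this have "hs K u \<le> u \<bullet> x"
    unfolding support_function_def by (intro cSUP_least) auto
  ultimately show ?thesis using that inner_le_hs[OF assms, of x u] by force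
qed

lemma hs_leI:
  assumes "K \<in> convex_bodies" "\<And>x. x \<in> K \<Longrightarrow> u \<bullet> x \<le> c"
  shows "hs K u \<le> c"
  by (metis assms hs_attained)

lemma hs_eqI:
  assumes "K \<in> convex_bodies" "x \<in> K" "u \<bullet> x = c" "\<And>y. y \<in> K \<Longrightarrow> u \<bullet> y \<le> c"
  shows "hs K u = c"
  using hs_leI[OF assms(1,4)] inner_le_hs[OF assms(1,2), of u] assms(3) by simp

lemma set_plus_convex_bodies [intro]:
  assumes "K \<in> convex_bodies" "L \<in> convex_bodies"
  shows "K + L \<in> convex_bodies"
proof -
  have "K + L = {x + y |x y. x \<in> K \<and> y \<in> L}"
    by (auto simp: set_plus_def)
  then have "compact (K + L)"
    using compact_sums[of K L] convex_bodiesD[OF assms(1)] convex_bodiesD[OF assms(2)] by simp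
  moreover have "convex (K + L)" using assms by (simp add: convex_bodies_def convex_set_plus)
  ultimately show ?thesis
    using assms by (auto simp: convex_bodies_def set_plus_def)
qed

lemma linear_image_convex_bodies:
  assumes "K \<in> convex_bodies" "linear f"
  shows "f ` K \<in> convex_bodies"
  using assms unfolding convex_bodies_def
  by (auto intro: compact_continuous_image linear_continuous_on convex_linear_image
      simp: linear_conv_bounded_linear)

lemma translation_convex_bodies [intro]:
  assumes "K \<in> convex_bodies"
  shows "(\<lambda>x. x + t) ` K \<in> convex_bodies"
proof -
  have "(\<lambda>x. x + t) ` K = (+) t ` K" by (simp add: add.commute)
  then show ?thesis
    using assms by (auto simp: convex_bodies_def compact_translation convex_translation
        simp del: image_image)
qed

lemma scaleR_convex_bodies [intro]:
  assumes "K \<in> convex_bodies"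
  shows "(*\<^sub>R) c ` K \<in> convex_bodies"
  using linear_image_convex_bodies[OF assms linear_scaleR] .

lemma uminus_convex_bodies [intro]:
  assumes "K \<in> convex_bodies"
  shows "uminus ` K \<in> convex_bodies"
  using linear_image_convex_bodies[OF assms linear_uminus] .

lemma matrix_convex_bodies [intro]:
  fixes A :: "real^'n^'m"
  assumes "K \<in> convex_bodies"
  shows "(*v) A ` K \<in> convex_bodies"
  using linear_image_convex_bodies[OF assms matrix_vector_mul_linear] .

lemma singleton_convex_bodies [intro, simp]: "{p} \<in> convex_bodies"
  by (simp add: convex_bodies_def)

lemma cball_convex_bodies [intro, simp]: "0 \<le> r \<Longrightarrow> cball x r \<in> convex_bodies"
  by (simp add: convex_bodies_def)

lemma convex_hull_convex_bodies [intro]: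
  "finite X \<Longrightarrow> X \<noteq> {} \<Longrightarrow> convex hull X \<in> convex_bodies"
  by (simp add: convex_bodies_def finite_imp_compact_convex_hull)

lemma hs_plus:
  assumes "K \<in> convex_bodies" "L \<in> convex_bodies"
  shows "hs (K + L) u = hs K u + hs L u"
proof -
  obtain x y where "x \<in> K" "hs K u = u \<bullet> x" "y \<in> L" "hs L u = u \<bullet> y"
    using hs_attained[OF assms(1)] hs_attained[OF assms(2)] by metis
  then show ?thesis
    using assms
    by (intro hs_eqI[of _ "x + y"] set_plus_convex_bodies)
      (use inner_le_hs[OF assms(1), of _ u] inner_le_hs[OF assms(2), of _ u] in
        \<open>auto simp: set_plus_def inner_add_right intro!: add_mono\<close>)
qed

lemma hs_linear_image:
  assumes "K \<in> convex_bodies" "linear f" "\<And>x. u \<bullet> f x = v \<bullet> x"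
  shows "hs (f ` K) u = hs K v"
proof -
  obtain x where "x \<in> K" "hs K v = v \<bullet> x"
    using hs_attained[OF assms(1)] by metis
  then show ?thesis
    using assms by (intro hs_eqI[of _ "f x"])
      (auto intro!: linear_image_convex_bodies dest: inner_le_hs[where u = v])
qed

lemma hs_scaleR:
  assumes "K \<in> convex_bodies" "0 \<le> c"
  shows "hs ((*\<^sub>R) c ` K) u = c * hs K u"
proof -
  obtain x where "x \<in> K" "hs K u = u \<bullet> x"
    using hs_attained[OF assms(1)] by metis
  then show ?thesis
    using assms by (intro hs_eqI[of _ "c *\<^sub>R x"]) (auto intro!: mult_left_mono dest: inner_le_hs[where u = u])
qed

lemma hs_uminus:
  assumes "K \<in> convex_bodies"
  shows "hs (uminus ` K) u = hs K (- u)"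
  by (rule hs_linear_image[OF assms]) (auto intro: linear_uminus)

lemma hs_matrix:
  fixes A :: "real^'n^'m"
  assumes "K \<in> convex_bodies"
  shows "hs ((*v) A ` K) u = hs K (transpose A *v u)"
  by (rule hs_linear_image[OF assms]) (auto simp: dot_lmul_matrix)

lemma hs_singleton [simp]: "hs {p} u = u \<bullet> p"
  by (simp add: support_function_def)

lemma hs_translation:
  assumes "K \<in> convex_bodies"
  shows "hs ((\<lambda>x. x + t) ` K) u = hs K u + u \<bullet> t"
proof -
  have "(\<lambda>x. x + t) ` K = K + {t}" by (auto simp: set_plus_def)
  then show ?thesis by (simp add: hs_plus assms)
qed

lemma inner_sgn_self: "x \<bullet> sgn x = norm (x :: 'a::real_inner)"
  by (cases "x = 0") (simp_all add: sgn_div_norm dot_square_norm power2_eq_square)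

lemma hs_cball [simp]: "hs (cball 0 1) u = norm u"
proof (rule hs_eqI[of _ "sgn u"])
  show "u \<bullet> y \<le> norm u" if "y \<in> cball 0 1" for y
    using norm_cauchy_schwarz[of u y] that mult_left_mono[of "norm y" 1 "norm u"] by simp
qed (auto simp: inner_sgn_self norm_sgn)

lemma hs_convex_hull:
  assumes "finite X" "X \<noteq> {}"
  shows "hs (convex hull X) u = (MAX x\<in>X. u \<bullet> x)"
proof -
  have "Max ((\<bullet>) u ` X) \<in> (\<bullet>) u ` X" using assms by (intro Max_in) auto
  then obtain x where x: "x \<in> X" "u \<bullet> x = Max ((\<bullet>) u ` X)" by force
  have "convex hull X \<subseteq> {y. u \<bullet> y \<le> Max ((\<bullet>) u ` X)}"
    by (rule hull_minimal) (use assms in \<open>auto simp: convex_halfspace_le\<close>)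
  then show ?thesis
    using assms x by (intro hs_eqI[of _ x]) (auto simp: hull_inc)
qed

text \<open>A point of \<open>K\<close> outside \<open>L\<close> is strictly separated from
  \<open>L\<close>, and the normal of the separating hyperplane violates the inequality.\<close>

lemma hs_mono_subset:
  assumes "K \<in> convex_bodies" "L \<in> convex_bodies" "\<And>u. hs K u \<le> hs L u"
  shows "K \<subseteq> L"
proof
  fix x assume "x \<in> K"
  show "x \<in> L"
  proof (rule ccontr)
    assume "x \<notin> L"
    then obtain a b where "a \<bullet> x < b" "\<forall>y\<in>L. a \<bullet> y > b"
      using separating_hyperplane_closed_point[of L x] convex_bodiesD[OF assms(2)] by blast
    moreover obtain y where "y \<in> L" "hs L (- a) = (- a) \<bullet> y"
      using hs_attained[OF assms(2)] by metis
    ultimately show False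
      using inner_le_hs[OF assms(1) \<open>x \<in> K\<close>, of "- a"] assms(3)[of "- a"] by force
  qed
qed

lemma hs_inject:
  assumes "K \<in> convex_bodies" "L \<in> convex_bodies" "\<And>u. hs K u = hs L u"
  shows "K = L"
  using hs_mono_subset[OF assms(1,2)] hs_mono_subset[OF assms(2,1)] assms(3) by force

section \<open>Sublinear functions as support functions\<close>

definition sublinear :: "('a::real_vector \<Rightarrow> real) \<Rightarrow> bool" where
  "sublinear f \<longleftrightarrow> (\<forall>u v. f (u + v) \<le> f u + f v) \<and> (\<forall>c u. 0 \<le> c \<longrightarrow> f (c *\<^sub>R u) = c * f u)"

lemma sublinearD:
  assumes "sublinear f"
  shows "f (u + v) \<le> f u + f v" "0 \<le> c \<Longrightarrow> f (c *\<^sub>R u) = c * f u" "f 0 = 0"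
proof -
  show "f (u + v) \<le> f u + f v" "0 \<le> c \<Longrightarrow> f (c *\<^sub>R u) = c * f u"
    using assms by (auto simp: sublinear_def)
  have "f (0 *\<^sub>R 0) = 0 * f 0" using assms unfolding sublinear_def by blast
  then show "f 0 = 0" by simp
qed

lemma sublinear_hs:
  assumes "K \<in> convex_bodies"
  shows "sublinear (hs K)"
  unfolding sublinear_def
proof (intro conjI allI impI)
  fix u v show "hs K (u + v) \<le> hs K u + hs K v"
    using assms by (intro hs_leI) (auto simp: inner_add_left intro!: add_mono inner_le_hs)
next
  fix c :: real and u :: 'a assume "0 \<le> c"
  obtain x where "x \<in> K" "hs K u = u \<bullet> x"
    using hs_attained[OF assms(1)] by metis
  then show "hs K (c *\<^sub>R u) = c * hs K u"
    using assms \<open>0 \<le> c\<close> by (intro hs_eqI[of _ "x"]) (auto intro!: mult_left_mono dest: inner_le_hs[where u = u])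
qed

lemma sublinear_add: "sublinear f \<Longrightarrow> sublinear g \<Longrightarrow> sublinear (\<lambda>u. f u + g u)"
  unfolding sublinear_def by (auto simp: algebra_simps) (smt (verit))

lemma sublinear_cmult: "sublinear f \<Longrightarrow> 0 \<le> c \<Longrightarrow> sublinear (\<lambda>u. c * f u)"
  unfolding sublinear_def by (auto simp: algebra_simps) (metis distrib_left mult_left_mono)

lemma sublinear_sum:
  assumes "\<And>i. i \<in> I \<Longrightarrow> sublinear (f i)"
  shows "sublinear (\<lambda>u. \<Sum>i\<in>I. f i u)"
  using assms
proof (induction I rule: infinite_finite_induct)
  case (insert i I)
  then show ?case using sublinear_add[of "f i" "\<lambda>u. \<Sum>i\<in>I. f i u"] by simp
qed (auto simp: sublinear_def)

lemma sublinear_LIMSEQ: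
  assumes "\<And>j. sublinear (f j)" "\<And>u. (\<lambda>j. f j u) \<longlonglongrightarrow> g u"
  shows "sublinear g"
  unfolding sublinear_def
proof (intro conjI allI impI)
  fix u v show "g (u + v) \<le> g u + g v"
    using assms(2) sublinearD(1)[OF assms(1)]
    by (intro LIMSEQ_le[OF assms(2) tendsto_add[OF assms(2) assms(2)]]) auto
next
  fix c :: real and u assume "0 \<le> c"
  then have "(\<lambda>j. f j (c *\<^sub>R u)) \<longlonglongrightarrow> c * g u"
    using tendsto_mult_left[OF assms(2)] sublinearD(2)[OF assms(1)] by simp
  then show "g (c *\<^sub>R u) = c * g u"
    using LIMSEQ_unique assms(2) by blast
qed

text \<open>A body with support function \<open>f\<close> is cut out by the supporting hyperplanes of the epigraph of
  \<open>f\<close>.\<close>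

lemma sublinear_imp_hs:
  fixes f :: "'a::euclidean_space \<Rightarrow> real"
  assumes f: "sublinear f"
  obtains K where "K \<in> convex_bodies" "\<And>u. hs K u = f u"
proof -
  have cvx: "convex_on UNIV f"
    unfolding convex_on_def
  proof (intro conjI ballI allI impI)
    fix x y :: 'a and u v :: real assume "0 \<le> u" "0 \<le> v"
    then show "f (u *\<^sub>R x + v *\<^sub>R y) \<le> u * f x + v * f y"
      using sublinearD(1)[OF f, of "u *\<^sub>R x" "v *\<^sub>R y"] by (simp add: sublinearD(2)[OF f])
  qed simp
  have cont: "continuous_on UNIV f"
    by (rule convex_on_continuous[OF open_UNIV cvx])
  define K where "K = {x. \<forall>u. u \<bullet> x \<le> f u}"
  have ex: "\<exists>x\<in>K. u \<bullet> x = f u" for u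
  proof -
    define C where "C = epigraph UNIV f"
    have C: "convex C" using cvx by (simp add: C_def convex_epigraph)
    have mem: "(v, s) \<in> C \<longleftrightarrow> f v \<le> s" for v s by (simp add: C_def epigraph_def)
    have ne: "(u, f u) \<notin> interior C"
    proof
      assume "(u, f u) \<in> interior C"
      then obtain e where e: "e > 0" "cball (u, f u) e \<subseteq> C"
        by (metis mem_interior_cball)
      have "dist (u, f u) (u, f u - e) \<le> e" using e by (simp add: dist_Pair_Pair dist_real_def)
      then have "(u, f u - e) \<in> C" using e by auto
      then show False using e by (simp add: mem)
    qed
    have int: "interior C \<noteq> {}"
    proof -
      define U where "U = {p :: 'a \<times> real. f (fst p) < snd p}"
      have "continuous_on UNIV (\<lambda>p :: 'a \<times> real. snd p - f (fst p))"
        by (intro continuous_intros continuous_on_compose2[OF cont]) auto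
      then have "open U"
        using open_Collect_less[of "\<lambda>p :: 'a \<times> real. 0" "\<lambda>p. snd p - f (fst p)"]
        by (simp add: U_def)
      moreover have "U \<subseteq> C" by (auto simp: U_def mem)
      moreover have "(u, f u + 1) \<in> U" by (simp add: U_def)
      ultimately show ?thesis using interior_maximal by blast
    qed
    have "(u, f u) \<in> C" by (simp add: mem)
    moreover have "(u, f u) \<notin> rel_interior C"
      using ne int interior_rel_interior_gen[of C] rel_interior_nonempty_interior by blast
    ultimately obtain w where w: "w \<noteq> 0" "\<And>y. y \<in> C \<Longrightarrow> w \<bullet> (u, f u) \<le> w \<bullet> y"
      using supporting_hyperplane_rel_boundary[of C "(u, f u)"] C by metis
    obtain a b where ab: "w = (a, b)" by (cases w)
    have sup: "a \<bullet> u + b * f u \<le> a \<bullet> v + b * s" if "f v \<le> s" for v s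
      using w(2)[of "(v, s)"] that by (simp add: ab mem inner_Pair)
    have "b \<ge> 0" using sup[of u "f u + 1"] by (simp add: algebra_simps)
    \<comment> \<open>A vertical supporting hyperplane is impossible because \<open>f\<close> is
      finite everywhere.\<close>
    moreover have "b \<noteq> 0"
    proof
      assume "b = 0"
      then have "a \<bullet> u \<le> a \<bullet> (u - a)" using sup[of "u - a" "f (u - a)"] by simp
      then have "a = 0" by (metis add_le_same_cancel1 diff_add_cancel inner_diff_right inner_eq_zero_iff
            inner_ge_zero order_antisym)
      then show False using w(1) ab \<open>b = 0\<close> by (simp add: zero_prod_def)
    qed
    ultimately have b: "b > 0" by simp
    define x where "x = (- 1 / b) *\<^sub>R a"
    have x: "v \<bullet> x - f v \<le> u \<bullet> x - f u" for v
    proof -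
      have "a \<bullet> v = - b * (v \<bullet> x)" for v
        using b by (simp add: x_def inner_commute)
      then have "b * (v \<bullet> x - f v) \<le> b * (u \<bullet> x - f u)"
        using sup[of v "f v"] by (simp add: algebra_simps)
      then show ?thesis using b by simp
    qed
    \<comment> \<open>Homogeneity is used at \<open>0\<close> and at \<open>2 *\<^sub>R u\<close>:
      the gap at \<open>u\<close> is at least zero and at least twice itself.\<close>
    have "u \<bullet> x - f u = 0"
      using x[of 0] x[of "2 *\<^sub>R u"] sublinearD(2)[OF f, of 2 u] sublinearD(3)[OF f] by simp
    then show ?thesis using x by (intro bexI[of _ x]) (auto simp: K_def)
  qed
  have "closed K"
  proof -
    have "K = (\<Inter>u. {x. u \<bullet> x \<le> f u})" by (auto simp: K_def)
    then show ?thesis by (auto intro!: closed_INT closed_halfspace_le)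
  qed
  moreover have "bounded K"
  proof -
    have "norm x \<le> (\<Sum>b\<in>Basis. \<bar>f b\<bar> + \<bar>f (- b)\<bar>)" if "x \<in> K" for x
    proof -
      have "\<bar>x \<bullet> b\<bar> \<le> \<bar>f b\<bar> + \<bar>f (- b)\<bar>" for b
      proof -
        have "b \<bullet> x \<le> f b" "(- b) \<bullet> x \<le> f (- b)" using that by (auto simp only: K_def mem_Collect_eq)
        then show ?thesis by (simp add: inner_commute abs_if)
      qed
      then show ?thesis
        by (intro order_trans[OF norm_le_l1[of x]] sum_mono)
    qed
    then show ?thesis by (auto simp: bounded_iff)
  qed
  moreover have "convex K"
  proof -
    have "K = (\<Inter>u. {x. u \<bullet> x \<le> f u})" by (auto simp: K_def)
    then show ?thesis by (auto intro!: convex_INT convex_halfspace_le)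
  qed
  ultimately have "K \<in> convex_bodies"
    using ex[of 0] by (auto simp: convex_bodies_def compact_eq_bounded_closed)
  moreover have "hs K u = f u" for u
  proof -
    obtain x where "x \<in> K" "u \<bullet> x = f u" using ex by blast
    then show ?thesis
      using \<open>K \<in> convex_bodies\<close> by (intro hs_eqI[of _ x]) (auto simp: K_def)
  qed
  ultimately show ?thesis using that by blast
qed

lemma hs_lipschitz:
  assumes "K \<in> convex_bodies" "\<And>x. x \<in> K \<Longrightarrow> norm x \<le> R"
  shows "\<bar>hs K u - hs K v\<bar> \<le> R * norm (u - v)"
proof -
  have "hs K u - hs K v \<le> R * norm (u - v)" for u v
  proof -
    have "hs K u \<le> hs K v + hs K (u - v)"
      using sublinearD(1)[OF sublinear_hs[OF assms(1)], of v "u - v"] by simp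
    moreover have "hs K (u - v) \<le> R * norm (u - v)"
    proof (rule hs_leI[OF assms(1)])
      fix x assume "x \<in> K"
      then have "norm (u - v) * norm x \<le> norm (u - v) * R"
        using assms(2) by (intro mult_left_mono) auto
      then show "(u - v) \<bullet> x \<le> R * norm (u - v)"
        using norm_cauchy_schwarz[of "u - v" x] by (simp add: mult.commute)
    qed
    ultimately show ?thesis by simp
  qed
  from this[of u v] this[of v u] show ?thesis by (simp add: abs_if norm_minus_commute)
qed

lemma continuous_on_hs:
  assumes "K \<in> convex_bodies"
  shows "continuous_on S (hs K)"
proof -
  obtain R where R: "\<And>x. x \<in> K \<Longrightarrow> norm x \<le> R"
    using convex_bodiesD(5)[OF assms] by (auto simp: bounded_iff)
  then have "0 \<le> R" using convex_bodiesD(1)[OF assms] by (meson all_not_in_conv norm_ge_zero order_trans)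
  then have "R-lipschitz_on S (hs K)"
    using hs_lipschitz[OF assms R] by (intro lipschitz_onI) (auto simp: dist_real_def dist_norm)
  then show ?thesis by (rule lipschitz_on_continuous_on)
qed

text \<open>With \<open>hs_diff_le_hausdorff_dist\<close> this identifies the Hausdorff distance
  with the largest difference of the support functions on the unit sphere. If \<open>p\<close> is
  the point of \<open>L\<close> nearest to \<open>x\<close>, then \<open>x - p\<close> is an outer
  normal of \<open>L\<close> at \<open>p\<close>, so \<open>norm (x - p)\<close> is at most
  \<open>hs K u - hs L u\<close> in that direction.\<close>

lemma hausdorff_dist_le:
  assumes K: "K \<in> convex_bodies" and L: "L \<in> convex_bodies"
    and le: "\<And>u. norm u = 1 \<Longrightarrow> \<bar>hs K u - hs L u\<bar> \<le> e" and e: "0 \<le> e"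
  shows "hausdorff_dist K L \<le> e"
proof -
  have *: "infdist x L \<le> e" if K: "K \<in> convex_bodies" and L: "L \<in> convex_bodies"
    and le: "\<And>u. norm u = 1 \<Longrightarrow> \<bar>hs K u - hs L u\<bar> \<le> e" and x: "x \<in> K" for K L and x :: 'a
  proof (cases "x \<in> L")
    case True
    then show ?thesis using e by simp
  next
    case False
    define p where "p = closest_point L x"
    have p: "p \<in> L" using L by (simp add: p_def closest_point_in_set convex_bodiesD)
    define u where "u = sgn (x - p)"
    have "x \<noteq> p" using False p by auto
    then have u: "norm u = 1" by (simp add: u_def norm_sgn)
    have "hs L u = u \<bullet> p"
    proof (rule hs_eqI[OF L p])
      fix y assume "y \<in> L"
      then have "(x - p) \<bullet> (y - p) \<le> 0"
        unfolding p_def using L by (intro closest_point_dot) (auto simp: convex_bodiesD)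
      then show "u \<bullet> y \<le> u \<bullet> p"
        by (simp add: u_def sgn_div_norm inner_diff_right mult_left_mono divide_right_mono)
    qed simp
    moreover have "u \<bullet> x \<le> hs K u" by (rule inner_le_hs[OF K x])
    moreover have "u \<bullet> x - u \<bullet> p = norm (x - p)"
      unfolding inner_diff_right[symmetric] u_def
      by (metis inner_commute inner_sgn_self)
    ultimately have "norm (x - p) \<le> e" using le[OF u] by simp
    then show ?thesis
      using infdist_le[OF p, of x] by (simp add: dist_norm)
  qed
  show ?thesis
    unfolding hausdorff_dist_def
    using *[OF K L le] *[OF L K] le convex_bodiesD(1)[OF K] convex_bodiesD(1)[OF L]
    by (auto intro!: cSUP_least simp: abs_minus_commute)
qed

lemma hs_diff_le_hausdorff_dist:
  assumes K: "K \<in> convex_bodies" and L: "L \<in> convex_bodies"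
  shows "\<bar>hs K u - hs L u\<bar> \<le> hausdorff_dist K L * norm u"
proof -
  have *: "hs K u - hs L u \<le> (SUP x\<in>K. infdist x L) * norm u"
    if K: "K \<in> convex_bodies" and L: "L \<in> convex_bodies" for K L and u :: 'a
  proof -
    obtain x where x: "x \<in> K" "hs K u = u \<bullet> x" using hs_attained[OF K] by metis
    obtain p where p: "p \<in> L" "infdist x L = dist x p"
      using infdist_attains_inf[of L x] convex_bodiesD[OF L] by blast
    have "bdd_above ((\<lambda>x. infdist x L) ` K)"
      by (intro bounded_imp_bdd_above compact_imp_bounded compact_continuous_image
          continuous_intros convex_bodiesD K)
    then have "dist x p \<le> (SUP x\<in>K. infdist x L)"
      using cSUP_upper[OF x(1)] p(2) by metis
    then have "norm u * norm (x - p) \<le> norm u * (SUP x\<in>K. infdist x L)"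
      by (intro mult_left_mono) (auto simp: dist_norm)
    moreover have "u \<bullet> x - u \<bullet> p \<le> norm u * norm (x - p)"
      using norm_cauchy_schwarz[of u "x - p"] by (simp add: inner_diff_right)
    ultimately show ?thesis
      using inner_le_hs[OF L p(1), of u] x(2) by (simp add: mult.commute)
  qed
  have "(SUP x\<in>K. infdist x L) * norm u \<le> hausdorff_dist K L * norm u"
    "(SUP x\<in>L. infdist x K) * norm u \<le> hausdorff_dist K L * norm u"
    by (intro mult_right_mono; simp add: hausdorff_dist_def)+
  then show ?thesis using *[OF K L, of u] *[OF L K, of u] by linarith
qed

text \<open>Sublinear functions that are bounded on \<open>\<plusminus>Basis\<close> are equi-Lipschitz, so pointwise convergence
  is locally uniform.\<close>

lemma sublinear_uniform_LIMSEQ: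
  fixes f :: "nat \<Rightarrow> 'a::euclidean_space \<Rightarrow> real"
  assumes f: "\<And>j. sublinear (f j)" and lim: "\<And>u. (\<lambda>j. f j u) \<longlonglongrightarrow> g u" and e: "0 < e"
  shows "\<exists>N. \<forall>j\<ge>N. \<forall>u. norm u = 1 \<longrightarrow> \<bar>f j u - g u\<bar> < e"
proof -
  have g: "sublinear g" by (rule sublinear_LIMSEQ[OF f lim])
  have "\<exists>c. \<forall>j. \<bar>f j u\<bar> \<le> c" for u
    using convergent_imp_Bseq[of "\<lambda>j. f j u"] lim by (auto simp: convergent_def Bseq_def)
  then obtain c where c: "\<And>u j. \<bar>f j u\<bar> \<le> c u" by metis
  define L where "L = (\<Sum>b\<in>Basis. \<bar>c b\<bar> + \<bar>c (- b :: 'a)\<bar>) + 1"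
  have L: "L > 0" unfolding L_def by (intro add_nonneg_pos sum_nonneg) auto
  have bound: "f j z \<le> L * norm z" for j z
  proof -
    have "f j (\<Sum>b\<in>B. (z \<bullet> b) *\<^sub>R b) \<le> (\<Sum>b\<in>B. norm z * (\<bar>c b\<bar> + \<bar>c (- b)\<bar>))"
      if "finite B" "B \<subseteq> Basis" for B
      using that
    proof (induction B rule: finite_induct)
      case empty
      then show ?case using sublinearD(3)[OF f] by simp
    next
      case (insert b B)
      have "f j ((z \<bullet> b) *\<^sub>R b) \<le> norm z * (\<bar>c b\<bar> + \<bar>c (- b)\<bar>)"
      proof -
        have zb: "\<bar>z \<bullet> b\<bar> \<le> norm z" using insert by (simp add: Basis_le_norm)
        have "f j ((z \<bullet> b) *\<^sub>R b) \<le> \<bar>z \<bullet> b\<bar> * (\<bar>c b\<bar> + \<bar>c (- b)\<bar>)"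
        proof (cases "z \<bullet> b \<ge> 0")
          case True
          have "f j b \<le> \<bar>c b\<bar> + \<bar>c (- b)\<bar>" using c[of j b] by linarith
          then show ?thesis
            using True sublinearD(2)[OF f, of "z \<bullet> b" j b] by (simp add: mult_left_mono)
        next
          case False
          have "f j (- b) \<le> \<bar>c b\<bar> + \<bar>c (- b)\<bar>" using c[of j "- b"] by linarith
          then have "- (z \<bullet> b) * f j (- b) \<le> - (z \<bullet> b) * (\<bar>c b\<bar> + \<bar>c (- b)\<bar>)"
            using False by (intro mult_left_mono) auto
          then show ?thesis
            using False sublinearD(2)[OF f, of "- (z \<bullet> b)" j "- b"] by simp
        qed
        also have "\<dots> \<le> norm z * (\<bar>c b\<bar> + \<bar>c (- b)\<bar>)"
          by (rule mult_right_mono[OF zb]) simp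
        finally show ?thesis .
      qed
      moreover have "f j (\<Sum>b\<in>insert b B. (z \<bullet> b) *\<^sub>R b)
          \<le> f j ((z \<bullet> b) *\<^sub>R b) + f j (\<Sum>b\<in>B. (z \<bullet> b) *\<^sub>R b)"
        using insert sublinearD(1)[OF f] by simp
      ultimately show ?case using insert by simp
    qed
    from this[of Basis] have "f j z \<le> norm z * (\<Sum>b\<in>Basis. \<bar>c b\<bar> + \<bar>c (- b)\<bar>)"
      by (simp add: euclidean_representation sum_distrib_left)
    also have "\<dots> \<le> norm z * L" by (intro mult_left_mono) (auto simp: L_def)
    finally show ?thesis by (simp add: mult.commute)
  qed
  have bound_g: "g z \<le> L * norm z" for z
    by (rule LIMSEQ_le_const2[OF lim]) (use bound in blast)
  have lip: "\<bar>f j u - f j v\<bar> \<le> L * norm (u - v)" for j u v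
    using sublinearD(1)[OF f, of j v "u - v"] sublinearD(1)[OF f, of j u "v - u"]
      bound[of j "u - v"] bound[of j "v - u"] by (simp add: abs_if norm_minus_commute)
  have lip_g: "\<bar>g u - g v\<bar> \<le> L * norm (u - v)" for u v
    using sublinearD(1)[OF g, of v "u - v"] sublinearD(1)[OF g, of u "v - u"]
      bound_g[of "u - v"] bound_g[of "v - u"] by (simp add: abs_if norm_minus_commute)
  \<comment> \<open>A net of mesh \<open>d\<close> costs at most \<open>e / 3\<close> for each of
    the two Lipschitz functions and leaves \<open>e / 3\<close> for the convergence at the
    nodes.\<close>
  define d where "d = e / (3 * L)"
  have d: "d > 0" "L * d = e / 3" using L e by (auto simp: d_def)
  obtain X where X: "finite X" "sphere (0::'a) 1 \<subseteq> (\<Union>x\<in>X. ball x d)"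
    using compact_eq_totally_bounded[of "sphere (0::'a) 1"] d(1) by auto
  have "\<forall>x. \<exists>N. \<forall>j\<ge>N. \<bar>f j x - g x\<bar> < e / 3"
    using lim e unfolding LIMSEQ_iff by (metis divide_pos_pos real_norm_def zero_less_numeral)
  then obtain N where N: "\<And>x j. j \<ge> N x \<Longrightarrow> \<bar>f j x - g x\<bar> < e / 3" by metis
  show ?thesis
  proof (intro exI[of _ "Max (insert 0 (N ` X))"] allI impI)
    fix j and u :: 'a assume j: "Max (insert 0 (N ` X)) \<le> j" and "norm u = 1"
    then obtain x where x: "x \<in> X" "norm (u - x) < d"
      using X(2) by (auto simp: dist_norm norm_minus_commute)
    have "\<bar>f j x - g x\<bar> < e / 3" using j x(1) X(1) by (intro N) auto
    moreover have "L * norm (u - x) < e / 3"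
      using x(2) L d(2) by (metis mult_less_cancel_left_pos)
    ultimately show "\<bar>f j u - g u\<bar> < e"
      using lip[of j u x] lip_g[of u x] by linarith
  qed
qed

text \<open>Lets continuity be used through pointwise limits of support functions alone: by
  \<open>sublinear_uniform_LIMSEQ\<close> these limits are uniform on the sphere, that is, limits in
  the Hausdorff metric.\<close>

lemma hausdorff_continuous_hs_LIMSEQ:
  assumes \<Phi>: "hausdorff_continuous \<Phi>" "\<Phi> \<in> convex_bodies \<rightarrow> convex_bodies"
    and K: "\<And>j. K j \<in> convex_bodies" and M: "M \<in> convex_bodies"
    and lim: "\<And>u. (\<lambda>j. hs (K j) u) \<longlonglongrightarrow> hs M u"
  shows "(\<lambda>j. hs (\<Phi> (K j)) u) \<longlonglongrightarrow> hs (\<Phi> M) u"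
proof (cases "u = 0")
  case True
  have "hs L 0 = 0" if "L \<in> convex_bodies" for L :: "'b::euclidean_space set"
    using sublinearD(3)[OF sublinear_hs[OF that]] .
  then have "hs (\<Phi> (K j)) 0 = 0" "hs (\<Phi> M) 0 = 0" for j
    using \<Phi>(2) K M by (auto simp: Pi_iff)
  then show ?thesis using True by simp
next
  case False
  show ?thesis
    unfolding LIMSEQ_iff
  proof (intro allI impI)
    fix e :: real assume e: "e > 0"
    then obtain d where d: "d > 0" "\<And>L. L \<in> convex_bodies \<Longrightarrow> hausdorff_dist L M < d \<Longrightarrow>
        hausdorff_dist (\<Phi> L) (\<Phi> M) < e / norm u"
      using \<Phi>(1) M False unfolding hausdorff_continuous_def by (metis zero_less_divide_iff zero_less_norm_iff)
    obtain N where N: "\<And>j u. N \<le> j \<Longrightarrow> norm u = 1 \<Longrightarrow> \<bar>hs (K j) u - hs M u\<bar> < d / 2"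
      using sublinear_uniform_LIMSEQ[OF sublinear_hs[OF K] lim, of "d / 2"] d(1) by force
    show "\<exists>N. \<forall>j\<ge>N. norm (hs (\<Phi> (K j)) u - hs (\<Phi> M) u) < e"
    proof (intro exI[of _ N] allI impI)
      fix j assume j: "N \<le> j"
      have "hausdorff_dist (K j) M \<le> d / 2"
        using N[OF j] d(1) by (intro hausdorff_dist_le K M) (auto intro: less_imp_le)
      then have "hausdorff_dist (\<Phi> (K j)) (\<Phi> M) < e / norm u"
        using d K by simp
      then have "hausdorff_dist (\<Phi> (K j)) (\<Phi> M) * norm u < e"
        using False by (simp add: pos_less_divide_eq)
      moreover have "\<bar>hs (\<Phi> (K j)) u - hs (\<Phi> M) u\<bar> \<le> hausdorff_dist (\<Phi> (K j)) (\<Phi> M) * norm u"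
        using \<Phi>(2) K M by (intro hs_diff_le_hausdorff_dist) auto
      ultimately show "norm (hs (\<Phi> (K j)) u - hs (\<Phi> M) u) < e" by simp
    qed
  qed
qed

section \<open>Sublinearity of functions given on great circles\<close>

definition circ :: "'a::real_vector \<Rightarrow> 'a \<Rightarrow> real \<Rightarrow> 'a" where
  "circ a b t = cos t *\<^sub>R a + sin t *\<^sub>R b"

definition orthonormal :: "'a::real_inner \<Rightarrow> 'a \<Rightarrow> bool" where
  "orthonormal a b \<longleftrightarrow> norm a = 1 \<and> norm b = 1 \<and> a \<bullet> b = 0"

lemma orthonormal_minus: "orthonormal a b \<Longrightarrow> orthonormal a (- b)"
  by (simp add: orthonormal_def)

lemma orthonormal_minus_left: "orthonormal a b \<Longrightarrow> orthonormal (- a) b"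
  by (simp add: orthonormal_def)

lemma orthonormal_sym: "orthonormal a b \<Longrightarrow> orthonormal b a"
  by (simp add: orthonormal_def inner_commute)

lemma orthonormalD:
  assumes "orthonormal a b"
  shows "a \<bullet> a = 1" "b \<bullet> b = 1" "a \<bullet> b = 0" "b \<bullet> a = 0" "norm a = 1" "norm b = 1"
  using assms by (auto simp: orthonormal_def inner_commute dot_square_norm)

lemma norm_circ:
  assumes "orthonormal a b"
  shows "norm (circ a b t) = 1"
proof -
  have "circ a b t \<bullet> circ a b t = (cos t)\<^sup>2 + (sin t)\<^sup>2"
    using orthonormalD[OF assms]
    by (simp add: circ_def inner_add_left inner_add_right power2_eq_square)
  then show ?thesis by (simp add: norm_eq_sqrt_inner)
qed

lemma exists_orthonormal_decomp:
  fixes a u :: "'a::euclidean_space"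
  assumes "norm a = 1" "DIM('a) \<ge> 2"
  obtains b q where "orthonormal a b" "u = (a \<bullet> u) *\<^sub>R a + q *\<^sub>R b" "0 \<le> q"
proof (cases "u = (a \<bullet> u) *\<^sub>R a")
  case True
  have "a \<noteq> 0" using assms by auto
  then obtain z where z: "z \<noteq> 0" "a \<bullet> z = 0"
    using orthogonal_to_vector_exists[OF assms(2), of a] by (auto simp: orthogonal_def)
  have "orthonormal a (sgn z)"
    using assms z by (simp add: orthonormal_def norm_sgn sgn_div_norm)
  then show ?thesis using that[of "sgn z" 0] True by simp
next
  case False
  define z where "z = u - (a \<bullet> u) *\<^sub>R a"
  have "a \<bullet> a = 1" using assms by (simp add: dot_square_norm)
  then have "a \<bullet> z = 0" "z \<noteq> 0" using False by (auto simp: z_def inner_diff_right)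
  then have "orthonormal a (sgn z)"
    using assms by (simp add: orthonormal_def norm_sgn sgn_div_norm)
  moreover have "u = (a \<bullet> u) *\<^sub>R a + norm z *\<^sub>R sgn z"
    using \<open>z \<noteq> 0\<close> by (simp add: sgn_div_norm z_def)
  ultimately show ?thesis using that by (metis norm_ge_zero)
qed

text \<open>Sturm comparison. The function \<open>\<phi>\<close> joins
  \<open>g 0 * cos s + g1 0 * sin s\<close> at \<open>t = 0\<close> to \<open>g s\<close> at
  \<open>t = s\<close>, and its derivative is \<open>(g t + g2 t) * sin (s - t)\<close>.\<close>

lemma circ_comparison:
  fixes g :: "real \<Rightarrow> real"
  assumes d1: "\<And>t. (g has_real_derivative g1 t) (at t)"
    and d2: "\<And>t. (g1 has_real_derivative g2 t) (at t)"
    and ge: "\<And>t. g t + g2 t \<ge> 0" and s: "0 \<le> s" "s \<le> pi"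
  shows "g s \<ge> g 0 * cos s + g1 0 * sin s"
proof -
  define \<phi> where "\<phi> = (\<lambda>t. g1 t * sin (s - t) + g t * cos (s - t))"
  have D: "(\<phi> has_real_derivative (g t + g2 t) * sin (s - t)) (at t)" for t
    unfolding \<phi>_def by (auto intro!: derivative_eq_intros d1 d2 simp: algebra_simps)
  have "\<phi> 0 \<le> \<phi> s"
  proof (rule DERIV_nonneg_imp_nondecreasing[OF s(1)])
    fix t assume "0 \<le> t" "t \<le> s"
    then have "(g t + g2 t) * sin (s - t) \<ge> 0"
      using s ge by (intro mult_nonneg_nonneg sin_ge_zero) auto
    then show "\<exists>y. (\<phi> has_real_derivative y) (at t) \<and> 0 \<le> y"
      using D by blast
  qed
  then show ?thesis by (simp add: \<phi>_def algebra_simps)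
qed

text \<open>On the circle through \<open>u / \<bar>u\<bar>\<close> and \<open>v / \<bar>v\<bar>\<close> a solution of \<open>g'' + g \<ge> 0\<close> lies above the
  solution \<open>g 0 cos + g' 0 sin\<close> of \<open>g'' + g = 0\<close> that touches it in the direction of \<open>u + v\<close>.\<close>

lemma sublinear_circI:
  fixes F :: "'a::euclidean_space \<Rightarrow> real"
  assumes dim: "DIM('a) \<ge> 2"
    and ex: "\<And>a b. orthonormal a b \<Longrightarrow> \<exists>g1 g2. \<forall>t.
      ((\<lambda>t. F (circ a b t)) has_real_derivative g1 t) (at t) \<and>
      (g1 has_real_derivative g2 t) (at t) \<and> F (circ a b t) + g2 t \<ge> 0"
  shows "sublinear (\<lambda>u. norm u * F (sgn u))"
proof -
  define f where "f = (\<lambda>u. norm u * F (sgn u))"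
  have hom: "f (c *\<^sub>R u) = c * f u" if "0 \<le> c" for c u
    using that by (cases "c = 0") (auto simp: f_def sgn_scaleR)
  \<comment> \<open>The slope \<open>m\<close> is the derivative of \<open>F\<close> along the
    circle at \<open>a\<close>; the linear function tangent to \<open>f\<close> at \<open>a\<close>
    stays below \<open>f\<close> on the plane of \<open>a\<close> and \<open>b\<close>.\<close>
  have below: "\<exists>m. \<forall>p q. p * F a + q * m \<le> f (p *\<^sub>R a + q *\<^sub>R b)" if ab: "orthonormal a b" for a b
  proof -
    obtain g1 g2 where g: "\<And>t. ((\<lambda>t. F (circ a b t)) has_real_derivative g1 t) (at t)"
      "\<And>t. (g1 has_real_derivative g2 t) (at t)" "\<And>t. F (circ a b t) + g2 t \<ge> 0"
      using ex[OF ab] by blast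
    have ge: "F (circ a b s) \<ge> F a * cos s + g1 0 * sin s" if s: "-pi \<le> s" "s \<le> pi" for s
    proof (cases "0 \<le> s")
      case True
      then show ?thesis
        using circ_comparison[OF g True s(2)] by (simp add: circ_def)
    next
      case False
      have 1: "((\<lambda>t. F (circ a b (- t))) has_real_derivative - g1 (- t)) (at t)" for t
        using DERIV_chain2[where f = "\<lambda>t. F (circ a b t)" and g = uminus and x = t, OF g(1) DERIV_minus[OF DERIV_ident]]
        by simp
      have 2: "((\<lambda>t. - g1 (- t)) has_real_derivative g2 (- t)) (at t)" for t
        using DERIV_minus[OF DERIV_chain2[where f = g1 and g = uminus and x = t, OF g(2) DERIV_minus[OF DERIV_ident]]]
        by simp
      show ?thesis
        using circ_comparison[OF 1 2 g(3)[of "- t" for t], of "- s"] False s by (simp add: circ_def)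
    qed
    have "p * F a + q * g1 0 \<le> f (p *\<^sub>R a + q *\<^sub>R b)" for p q
    proof (cases "p = 0 \<and> q = 0")
      case False
      define r where "r = sqrt (p\<^sup>2 + q\<^sup>2)"
      have "p\<^sup>2 + q\<^sup>2 > 0" using False by (metis sum_power2_gt_zero_iff)
      then have r: "r > 0" "r\<^sup>2 = p\<^sup>2 + q\<^sup>2" by (auto simp: r_def)
      have "(p / r)\<^sup>2 + (q / r)\<^sup>2 = 1"
        unfolding power_divide add_divide_distrib[symmetric] r(2)[symmetric] using r(1) by simp
      then obtain y where "p / r = cos y" "q / r = sin y"
        by (rule sincos_total_2pi)
      then obtain s where s: "- pi < s" "s \<le> pi" "p / r = cos s" "q / r = sin s"
        using sincos_principal_value[of y] by metis
      have pq: "p = r * cos s" "q = r * sin s" using s(3,4) r(1) by (auto simp: field_simps)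
      have "p *\<^sub>R a + q *\<^sub>R b = r *\<^sub>R circ a b s"
        by (simp add: pq circ_def scaleR_add_right)
      then have "f (p *\<^sub>R a + q *\<^sub>R b) = r * F (circ a b s)"
        using r(1) norm_circ[OF ab, of s] hom[of r "circ a b s"] by (simp add: f_def sgn_div_norm)
      moreover have "r * (F a * cos s + g1 0 * sin s) \<le> r * F (circ a b s)"
        using ge[of s] s r by (intro mult_left_mono) auto
      ultimately show ?thesis by (simp add: pq algebra_simps)
    qed (simp add: f_def)
    then show ?thesis by blast
  qed
  have "f (u + v) \<le> f u + f v" for u v
  proof -
    have "\<exists>a. norm a = 1 \<and> u + v = norm (u + v) *\<^sub>R a"
    proof (cases "u + v = 0")
      case True
      then show ?thesis by (metis norm_Basis norm_zero scaleR_zero_left SOME_Basis)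
    next
      case False
      then show ?thesis by (intro exI[of _ "sgn (u + v)"]) (simp add: norm_sgn sgn_div_norm)
    qed
    then obtain a where a: "norm a = 1" "u + v = norm (u + v) *\<^sub>R a" by blast
    obtain b q where b: "orthonormal a b" "u = (a \<bullet> u) *\<^sub>R a + q *\<^sub>R b" "0 \<le> q"
      using exists_orthonormal_decomp[OF a(1) dim] by metis
    obtain m where m: "\<And>p q. p * F a + q * m \<le> f (p *\<^sub>R a + q *\<^sub>R b)"
      using below[OF b(1)] by blast
    define p where "p = a \<bullet> u"
    have u: "u = p *\<^sub>R a + q *\<^sub>R b" using b(2) by (simp add: p_def)
    \<comment> \<open>\<open>u\<close> and \<open>v\<close> have opposite coordinates along
      \<open>b\<close>, so the slope \<open>m\<close> cancels when the two lower bounds are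
      added.\<close>
    have v: "v = (norm (u + v) - p) *\<^sub>R a + (- q) *\<^sub>R b"
    proof -
      have "v = (u + v) - u" by simp
      also have "\<dots> = norm (u + v) *\<^sub>R a - (p *\<^sub>R a + q *\<^sub>R b)" using a(2) u by metis
      finally show ?thesis by (simp add: algebra_simps)
    qed
    have "f u \<ge> p * F a + q * m" using m[of p q] u by simp
    moreover have "f v \<ge> (norm (u + v) - p) * F a + (- q) * m" using m v by metis
    moreover have "f (u + v) = norm (u + v) * F a"
    proof -
      have "f (u + v) = norm (u + v) * f a" using a(2) hom by (metis norm_ge_zero)
      then show ?thesis using a(1) by (simp add: f_def sgn_div_norm)
    qed
    ultimately show ?thesis by (simp add: algebra_simps)
  qed
  then show ?thesis
    unfolding sublinear_def f_def[symmetric] using hom by (simp add: f_def)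
qed

text \<open>Bounds for a function and its first two derivatives along great circles, uniform over
  all circles. \<open>A + C\<close> is the price of convexity in \<open>circ_C2_sublinear\<close>,
  and \<open>B\<close> enters the second derivative of a power.\<close>

definition circ_C2 :: "('a::real_inner \<Rightarrow> real) \<Rightarrow> real \<Rightarrow> real \<Rightarrow> real \<Rightarrow> bool" where
  "circ_C2 F A B C \<longleftrightarrow> (\<forall>a b. orthonormal a b \<longrightarrow> (\<exists>g1 g2. \<forall>t.
      ((\<lambda>t. F (circ a b t)) has_real_derivative g1 t) (at t) \<and>
      (g1 has_real_derivative g2 t) (at t) \<and>
      \<bar>F (circ a b t)\<bar> \<le> A \<and> \<bar>g1 t\<bar> \<le> B \<and> \<bar>g2 t\<bar> \<le> C))"

lemma circ_C2I:
  assumes "\<And>a b t. orthonormal a b \<Longrightarrow> ((\<lambda>t. F (circ a b t)) has_real_derivative g1 a b t) (at t)"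
    "\<And>a b t. orthonormal a b \<Longrightarrow> (g1 a b has_real_derivative g2 a b t) (at t)"
    "\<And>a b t. orthonormal a b \<Longrightarrow> \<bar>F (circ a b t)\<bar> \<le> A"
    "\<And>a b t. orthonormal a b \<Longrightarrow> \<bar>g1 a b t\<bar> \<le> B"
    "\<And>a b t. orthonormal a b \<Longrightarrow> \<bar>g2 a b t\<bar> \<le> C"
  shows "circ_C2 F A B C"
  unfolding circ_C2_def
proof (intro allI impI)
  fix a b :: 'a assume "orthonormal a b"
  note * = assms[OF this]
  show "\<exists>g1 g2. \<forall>t. ((\<lambda>t. F (circ a b t)) has_real_derivative g1 t) (at t) \<and>
      (g1 has_real_derivative g2 t) (at t) \<and>
      \<bar>F (circ a b t)\<bar> \<le> A \<and> \<bar>g1 t\<bar> \<le> B \<and> \<bar>g2 t\<bar> \<le> C"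
    by (rule exI[of _ "g1 a b"], rule exI[of _ "g2 a b"]) (intro allI conjI *)
qed

definition circ_deriv :: "('a::real_inner \<Rightarrow> real) \<Rightarrow> 'a \<Rightarrow> 'a \<Rightarrow> real \<Rightarrow> real" where
  "circ_deriv F a b = deriv (\<lambda>t. F (circ a b t))"

lemma circ_C2D:
  assumes "circ_C2 F A B C" "orthonormal a b"
  shows "((\<lambda>t. F (circ a b t)) has_real_derivative circ_deriv F a b t) (at t)"
    "(circ_deriv F a b has_real_derivative deriv (circ_deriv F a b) t) (at t)"
    "\<bar>F (circ a b t)\<bar> \<le> A" "\<bar>circ_deriv F a b t\<bar> \<le> B" "\<bar>deriv (circ_deriv F a b) t\<bar> \<le> C"
proof -
  define P where "P g1 g2 \<longleftrightarrow> (\<forall>t. ((\<lambda>t. F (circ a b t)) has_real_derivative g1 t) (at t) \<and>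
      (g1 has_real_derivative g2 t) (at t) \<and>
      \<bar>F (circ a b t)\<bar> \<le> A \<and> \<bar>g1 t\<bar> \<le> B \<and> \<bar>g2 t\<bar> \<le> C)" for g1 g2
  have "\<exists>g1 g2. P g1 g2" using assms unfolding circ_C2_def P_def by simp
  then obtain g1 g2 where "P g1 g2" by blast
  note g = this[unfolded P_def, rule_format]
  have 1: "circ_deriv F a b = g1"
    unfolding circ_deriv_def by (intro ext DERIV_imp_deriv) (simp add: g)
  have 2: "deriv g1 = g2"
    by (intro ext DERIV_imp_deriv) (simp add: g)
  show "((\<lambda>t. F (circ a b t)) has_real_derivative circ_deriv F a b t) (at t)"
    "(circ_deriv F a b has_real_derivative deriv (circ_deriv F a b) t) (at t)"
    "\<bar>F (circ a b t)\<bar> \<le> A" "\<bar>circ_deriv F a b t\<bar> \<le> B" "\<bar>deriv (circ_deriv F a b) t\<bar> \<le> C"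
    unfolding 1 2 by (simp_all add: g)
qed

text \<open>Adding \<open>c\<close> to \<open>F\<close> raises \<open>g + g''\<close> by
  \<open>c\<close>, and this sum had modulus at most \<open>A + C\<close>: a ball of radius
  \<open>c\<close> makes up for any lack of convexity.\<close>

lemma circ_C2_sublinear:
  fixes F :: "'a::euclidean_space \<Rightarrow> real"
  assumes "circ_C2 F A B C" "DIM('a) \<ge> 2" "A + C \<le> c"
  shows "sublinear (\<lambda>u. norm u * F (sgn u) + c * norm u)"
proof -
  define g1 where "g1 = circ_deriv F"
  define g2 where "g2 a b = deriv (g1 a b)" for a b
  note g = circ_C2D[OF assms(1), folded g1_def, folded g2_def]
  have "sublinear (\<lambda>u. norm u * (F (sgn u) + c))"
  proof (rule sublinear_circI[where F = "\<lambda>u. F u + c", OF assms(2)])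
    fix a b :: 'a assume ab: "orthonormal a b"
    have d: "((\<lambda>t. F (circ a b t) + c) has_real_derivative g1 a b t) (at t)" for t
      using DERIV_add[OF g(1)[OF ab] DERIV_const] by simp
    show "\<exists>g1 g2. \<forall>t. ((\<lambda>t. F (circ a b t) + c) has_real_derivative g1 t) (at t) \<and>
      (g1 has_real_derivative g2 t) (at t) \<and> F (circ a b t) + c + g2 t \<ge> 0"
    proof (rule exI[of _ "g1 a b"], rule exI[of _ "g2 a b"], intro allI conjI)
      fix t
      show "((\<lambda>t. F (circ a b t) + c) has_real_derivative g1 a b t) (at t)" by (rule d)
      show "0 \<le> F (circ a b t) + c + g2 a b t"
        using g(3)[OF ab, of t] g(5)[OF ab, of t] assms(3) by linarith
    qed (intro g(2) ab)
  qed
  then show ?thesis by (simp add: algebra_simps)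
qed

lemma circ_C2_const: "circ_C2 (\<lambda>_. c) \<bar>c\<bar> 0 0"
  unfolding circ_C2_def by (intro allI impI exI[of _ "\<lambda>_. 0"]) simp

lemma circ_C2_cmult:
  assumes "circ_C2 F A B C"
  shows "circ_C2 (\<lambda>u. k * F u) (\<bar>k\<bar> * A) (\<bar>k\<bar> * B) (\<bar>k\<bar> * C)"
proof -
  define g1 where "g1 = circ_deriv F"
  define g2 where "g2 a b = deriv (g1 a b)" for a b
  note g = circ_C2D[OF assms(1), folded g1_def, folded g2_def]
  show ?thesis
  proof (rule circ_C2I[where ?g1.0 = "\<lambda>a b t. k * g1 a b t" and ?g2.0 = "\<lambda>a b t. k * g2 a b t"])
    fix a b :: 'a and t assume ab: "orthonormal a b"
    show "((\<lambda>t. k * F (circ a b t)) has_real_derivative k * g1 a b t) (at t)"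
      by (rule DERIV_cmult[OF g(1)[OF ab]])
    show "((\<lambda>t. k * g1 a b t) has_real_derivative k * g2 a b t) (at t)"
      by (rule DERIV_cmult[OF g(2)[OF ab]])
  qed (simp_all add: abs_mult g(3-5) mult_left_mono)
qed

lemma circ_C2_add:
  assumes "circ_C2 F A B C" "circ_C2 F' A' B' C'"
  shows "circ_C2 (\<lambda>u. F u + F' u) (A + A') (B + B') (C + C')"
proof -
  define g1 where "g1 = circ_deriv F"
  define g2 where "g2 a b = deriv (g1 a b)" for a b
  note g = circ_C2D[OF assms(1), folded g1_def, folded g2_def]
  define g1' where "g1' = circ_deriv F'"
  define g2' where "g2' a b = deriv (g1' a b)" for a b
  note g' = circ_C2D[OF assms(2), folded g1'_def, folded g2'_def]
  have tri: "\<bar>x\<bar> \<le> X \<Longrightarrow> \<bar>y\<bar> \<le> Y \<Longrightarrow> \<bar>x + y\<bar> \<le> X + Y" for x y X Y :: real by linarith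
  show ?thesis
  proof (rule circ_C2I[where ?g1.0 = "\<lambda>a b t. g1 a b t + g1' a b t"
          and ?g2.0 = "\<lambda>a b t. g2 a b t + g2' a b t"])
    fix a b :: 'a and t assume ab: "orthonormal a b"
    show "((\<lambda>t. F (circ a b t) + F' (circ a b t)) has_real_derivative g1 a b t + g1' a b t) (at t)"
      by (rule DERIV_add[OF g(1)[OF ab] g'(1)[OF ab]])
    show "((\<lambda>t. g1 a b t + g1' a b t) has_real_derivative g2 a b t + g2' a b t) (at t)"
      by (rule DERIV_add[OF g(2)[OF ab] g'(2)[OF ab]])
  qed (intro tri g g'; assumption)+
qed

lemma circ_C2_sum:
  assumes "\<And>i. i \<in> I \<Longrightarrow> circ_C2 (F i) (A i) (B i) (C i)"
  shows "circ_C2 (\<lambda>u. \<Sum>i\<in>I. F i u) (\<Sum>i\<in>I. A i) (\<Sum>i\<in>I. B i) (\<Sum>i\<in>I. C i)"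
  using assms
proof (induction I rule: infinite_finite_induct)
  case (insert i I)
  then show ?case using circ_C2_add[of "F i" "A i" "B i" "C i"] by simp
qed (use circ_C2_const[of 0] in auto)

text \<open>The velocity of \<open>circ a b\<close> is \<open>circ b (- a)\<close>, again a great
  circle, so \<open>norm w\<close> bounds both derivatives.\<close>

lemma inner_circ_deriv:
  "((\<lambda>t. w \<bullet> circ a b t) has_real_derivative w \<bullet> circ b (- a) t) (at t)"
  "((\<lambda>t. w \<bullet> circ b (- a) t) has_real_derivative - (w \<bullet> circ a b t)) (at t)"
  unfolding circ_def inner_add_right inner_scaleR_right
  by (auto intro!: derivative_eq_intros)

lemma inner_circ_le:
  assumes "orthonormal a b"
  shows "\<bar>w \<bullet> circ a b t\<bar> \<le> norm w" "\<bar>w \<bullet> circ b (- a) t\<bar> \<le> norm w"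
proof -
  have "orthonormal b (- a)" by (rule orthonormal_minus[OF orthonormal_sym[OF assms]])
  show "\<bar>w \<bullet> circ a b t\<bar> \<le> norm w" "\<bar>w \<bullet> circ b (- a) t\<bar> \<le> norm w"
    using Cauchy_Schwarz_ineq2[of w "circ a b t"] Cauchy_Schwarz_ineq2[of w "circ b (- a) t"]
    unfolding norm_circ[OF assms] norm_circ[OF \<open>orthonormal b (- a)\<close>] mult_1_right .
qed

lemma circ_C2_inner: "circ_C2 (\<lambda>u. w \<bullet> u) (norm w) (norm w) (norm w)"
proof (rule circ_C2I[where ?g1.0 = "\<lambda>a b t. w \<bullet> circ b (- a) t"
      and ?g2.0 = "\<lambda>a b t. - (w \<bullet> circ a b t)"])
  fix a b :: 'a and t
  show "((\<lambda>t. w \<bullet> circ a b t) has_real_derivative w \<bullet> circ b (- a) t) (at t)"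
    "((\<lambda>t. w \<bullet> circ b (- a) t) has_real_derivative - (w \<bullet> circ a b t)) (at t)"
    by (rule inner_circ_deriv)+
qed (simp_all add: inner_circ_le)

lemma circ_C2_exp:
  "circ_C2 (\<lambda>u. exp (w \<bullet> u)) (exp (norm w)) (exp (norm w) * norm w)
     (exp (norm w) * ((norm w)\<^sup>2 + norm w))"
proof (rule circ_C2I[where ?g1.0 = "\<lambda>a b t. exp (w \<bullet> circ a b t) * (w \<bullet> circ b (- a) t)"
      and ?g2.0 = "\<lambda>a b t. exp (w \<bullet> circ a b t) * ((w \<bullet> circ b (- a) t)\<^sup>2 - w \<bullet> circ a b t)"])
  fix a b :: 'a and t assume ab: "orthonormal a b"
  note d1 = inner_circ_deriv(1)[of w a b t] and d2 = inner_circ_deriv(2)[of w b a t]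
  show "((\<lambda>t. exp (w \<bullet> circ a b t)) has_real_derivative
      exp (w \<bullet> circ a b t) * (w \<bullet> circ b (- a) t)) (at t)"
    by (rule DERIV_fun_exp[OF d1])
  show "((\<lambda>t. exp (w \<bullet> circ a b t) * (w \<bullet> circ b (- a) t)) has_real_derivative
      exp (w \<bullet> circ a b t) * ((w \<bullet> circ b (- a) t)\<^sup>2 - w \<bullet> circ a b t)) (at t)"
    using DERIV_mult[OF DERIV_fun_exp[OF d1] d2] by (simp add: algebra_simps power2_eq_square)
  note le = inner_circ_le[OF ab, of w t]
  show e: "\<bar>exp (w \<bullet> circ a b t)\<bar> \<le> exp (norm w)" using le by auto
  then show "\<bar>exp (w \<bullet> circ a b t) * (w \<bullet> circ b (- a) t)\<bar> \<le> exp (norm w) * norm w"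
    unfolding abs_mult using le by (intro mult_mono) auto
  have "(w \<bullet> circ b (- a) t)\<^sup>2 \<le> (norm w)\<^sup>2" using le by (intro power2_le_iff_abs_le[THEN iffD2]) auto
  then have "\<bar>(w \<bullet> circ b (- a) t)\<^sup>2 - w \<bullet> circ a b t\<bar> \<le> (norm w)\<^sup>2 + norm w"
    using le(1) zero_le_power2[of "w \<bullet> circ b (- a) t"] by linarith
  then show "\<bar>exp (w \<bullet> circ a b t) * ((w \<bullet> circ b (- a) t)\<^sup>2 - w \<bullet> circ a b t)\<bar>
      \<le> exp (norm w) * ((norm w)\<^sup>2 + norm w)"
    unfolding abs_mult using e by (intro mult_mono) auto
qed

text \<open>The bound on the second derivative is \<open>j\<^sup>2 * A ^ j\<close> times a factor
  independent of \<open>j\<close>; a power series in \<open>F\<close> therefore stays in this class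
  as soon as its radius of convergence exceeds \<open>A\<close>.\<close>

lemma circ_C2_power:
  assumes F: "circ_C2 F A B C" and A: "A > 0"
  shows "circ_C2 (\<lambda>u. F u ^ j) (A ^ j) (real j * A ^ (j - 1) * B)
    ((real j)\<^sup>2 * A ^ j * ((B / A)\<^sup>2 + C / A))"
proof -
  define g1 where "g1 = circ_deriv F"
  define g2 where "g2 a b = deriv (g1 a b)" for a b
  note g = circ_C2D[OF assms(1), folded g1_def, folded g2_def]
  show ?thesis
  proof (rule circ_C2I[where ?g1.0 = "\<lambda>a b t. real j * F (circ a b t) ^ (j - 1) * g1 a b t"
      and ?g2.0 = "\<lambda>a b t. real j * (real (j - 1) * F (circ a b t) ^ (j - 1 - 1) * (g1 a b t)\<^sup>2
        + F (circ a b t) ^ (j - 1) * g2 a b t)"])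
    fix a b :: 'a and t assume ab: "orthonormal a b"
    note d = g(1)[OF ab, of t] g(2)[OF ab, of t]
    note le = g(3)[OF ab, of t] g(4)[OF ab, of t] g(5)[OF ab, of t]
    show "((\<lambda>t. F (circ a b t) ^ j) has_real_derivative
        real j * F (circ a b t) ^ (j - 1) * g1 a b t) (at t)"
      using DERIV_power[OF d(1), of j] by (simp add: mult_ac)
    show "((\<lambda>t. real j * F (circ a b t) ^ (j - 1) * g1 a b t) has_real_derivative
        real j * (real (j - 1) * F (circ a b t) ^ (j - 1 - 1) * (g1 a b t)\<^sup>2
        + F (circ a b t) ^ (j - 1) * g2 a b t)) (at t)"
      using DERIV_mult[OF DERIV_cmult[OF DERIV_power[OF d(1), of "j - 1"], of "real j"] d(2)]
      by (simp add: algebra_simps power2_eq_square)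
    have pw: "\<bar>F (circ a b t)\<bar> ^ k \<le> A ^ k" for k using le(1) by (intro power_mono) auto
    show "\<bar>F (circ a b t) ^ j\<bar> \<le> A ^ j" using pw by (simp add: power_abs)
    have B: "0 \<le> B" "0 \<le> C" using le by linarith+
    show "\<bar>real j * F (circ a b t) ^ (j - 1) * g1 a b t\<bar> \<le> real j * A ^ (j - 1) * B"
      unfolding abs_mult power_abs using pw[of "j - 1"] le(2) B A by (intro mult_mono) auto
    have sq: "(g1 a b t)\<^sup>2 \<le> B\<^sup>2"
      using power_mono[OF le(2) abs_ge_zero, of 2] by (simp only: power2_abs)
    have "\<bar>real (j - 1) * F (circ a b t) ^ (j - 1 - 1) * (g1 a b t)\<^sup>2
        + F (circ a b t) ^ (j - 1) * g2 a b t\<bar> \<le> real (j - 1) * A ^ (j - 1 - 1) * B\<^sup>2 + A ^ (j - 1) * C"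
    proof (rule order_trans[OF abs_triangle_ineq add_mono])
      show "\<bar>real (j - 1) * F (circ a b t) ^ (j - 1 - 1) * (g1 a b t)\<^sup>2\<bar> \<le> real (j - 1) * A ^ (j - 1 - 1) * B\<^sup>2"
        unfolding abs_mult power_abs using pw sq A by (intro mult_mono) auto
      show "\<bar>F (circ a b t) ^ (j - 1) * g2 a b t\<bar> \<le> A ^ (j - 1) * C"
        unfolding abs_mult power_abs by (rule mult_mono[OF pw le(3)]) (use A in auto)
    qed
    then have "\<bar>real j * (real (j - 1) * F (circ a b t) ^ (j - 1 - 1) * (g1 a b t)\<^sup>2
        + F (circ a b t) ^ (j - 1) * g2 a b t)\<bar>
        \<le> real j * (real (j - 1) * A ^ (j - 1 - 1) * B\<^sup>2 + A ^ (j - 1) * C)"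
      unfolding abs_mult[of "real j"] abs_of_nat by (rule mult_left_mono) simp
    also have "\<dots> \<le> (real j)\<^sup>2 * A ^ j * ((B / A)\<^sup>2 + C / A)"
    proof -
      \<comment> \<open>For \<open>j < 2\<close> the factor \<open>real (j - 1)\<close> is zero, so
        the truncated exponent \<open>j - 1 - 1\<close> is harmless.\<close>
      have 1: "real (j - 1) * A ^ (j - 1 - 1) * B\<^sup>2 \<le> real j * A ^ j * (B / A)\<^sup>2"
      proof (cases "j \<ge> 2")
        case True
        then obtain k where k: "j = Suc (Suc k)" by (metis add_2_eq_Suc le_Suc_ex)
        have "real j * A ^ j * (B / A)\<^sup>2 = real j * (A ^ k * B\<^sup>2)"
          using A by (simp add: power_divide k power2_eq_square)
        moreover have "real (j - 1) * (A ^ k * B\<^sup>2) \<le> real j * (A ^ k * B\<^sup>2)"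
          using A by (intro mult_right_mono) auto
        moreover have "real (j - 1) * A ^ (j - 1 - 1) * B\<^sup>2 = real (j - 1) * (A ^ k * B\<^sup>2)"
          by (simp add: k)
        ultimately show ?thesis by linarith
      next
        case False
        then have "j - 1 = 0" by simp
        then show ?thesis using A by simp
      qed
      have 2: "A ^ (j - 1) * C \<le> real j * A ^ j * (C / A)" if "j > 0"
      proof -
        have "1 * (A ^ (j - 1) * C) \<le> real j * (A ^ (j - 1) * C)"
          using that A B by (intro mult_right_mono) (simp_all add: Suc_leI)
        also have "\<dots> = real j * A ^ j * (C / A)"
          using A that by (cases j) (simp_all add: field_simps)
        finally show ?thesis by simp
      qed
      have "real j * (real (j - 1) * A ^ (j - 1 - 1) * B\<^sup>2 + A ^ (j - 1) * C)
          \<le> real j * (real j * A ^ j * (B / A)\<^sup>2 + real j * A ^ j * (C / A))"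
      proof (cases "j = 0")
        case False
        then show ?thesis by (intro mult_left_mono add_mono 1 2) simp_all
      qed simp
      also have "\<dots> = (real j)\<^sup>2 * A ^ j * ((B / A)\<^sup>2 + C / A)"
        by (simp only: power2_eq_square[of "real j"] distrib_left mult.assoc)
      finally show ?thesis .
    qed
    finally show "\<bar>real j * (real (j - 1) * F (circ a b t) ^ (j - 1 - 1) * (g1 a b t)\<^sup>2
        + F (circ a b t) ^ (j - 1) * g2 a b t)\<bar> \<le> (real j)\<^sup>2 * A ^ j * ((B / A)\<^sup>2 + C / A)" .
  qed
qed

section \<open>Classes of bodies closed under addition, cancellation and limits\<close>

lemma ex_hs_eq:
  fixes f :: "'a::euclidean_space \<Rightarrow> real"
  assumes "sublinear f"
  shows "\<exists>K. K \<in> convex_bodies \<and> hs K = f"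
proof (rule sublinear_imp_hs[OF assms])
  fix K assume K: "K \<in> convex_bodies" "\<And>u. hs K u = f u"
  from K(2) have "hs K = f" by (rule ext)
  with K(1) show ?thesis by blast
qed

lemma LIMSEQ_inverse_bound:
  fixes f :: "nat \<Rightarrow> real"
  assumes "\<And>j. \<bar>f j - l\<bar> \<le> C * inverse (real (Suc j))"
  shows "f \<longlonglongrightarrow> l"
proof -
  have "(\<lambda>j. C * inverse (real (Suc j))) \<longlonglongrightarrow> 0"
    using tendsto_mult_left[OF LIMSEQ_inverse_real_of_nat, of C] by simp
  moreover have "eventually (\<lambda>j. norm (f j - l) \<le> C * inverse (real (Suc j))) sequentially"
    using assms by (intro always_eventually) simp
  ultimately have "(\<lambda>j. f j - l) \<longlonglongrightarrow> 0" by (rule Lim_null_comparison[rotated])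
  then show ?thesis by (rule LIM_zero_cancel)
qed

text \<open>The closure properties common to the two classes \<open>good_lin\<close> and
  \<open>good_full\<close>. Cancellation is the decisive one: it leads from differences of support
  functions back to bodies.\<close>

locale good_bodies =
  fixes good :: "'a::euclidean_space set \<Rightarrow> bool"
  assumes dim: "DIM('a) \<ge> 2"
    and good_body: "good K \<Longrightarrow> K \<in> convex_bodies"
    and good_add: "good K \<Longrightarrow> good L \<Longrightarrow> good (K + L)"
    and good_cancel: "K \<in> convex_bodies \<Longrightarrow> good L \<Longrightarrow> good (K + L) \<Longrightarrow> good K"
    and good_LIMSEQ: "(\<And>j::nat. good (Ks j)) \<Longrightarrow> M \<in> convex_bodies \<Longrightarrow>
      (\<And>u. (\<lambda>j. hs (Ks j) u) \<longlonglongrightarrow> hs M u) \<Longrightarrow> good M"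
    and good_scale: "good K \<Longrightarrow> 0 \<le> c \<Longrightarrow> good ((*\<^sub>R) c ` K)"
    and good_cball: "good (cball 0 1)"
    and good_point: "good {p}"
begin

text \<open>The vector space spanned by the support functions of good bodies. By
  \<open>good_of_gf\<close>, a body whose support function lies in it is itself good.\<close>

definition gf :: "('a \<Rightarrow> real) \<Rightarrow> bool" where
  "gf f \<longleftrightarrow> (\<exists>K L. good K \<and> good L \<and> (\<forall>u. f u = hs K u - hs L u))"

lemma gfI: "good K \<Longrightarrow> good L \<Longrightarrow> (\<And>u. f u = hs K u - hs L u) \<Longrightarrow> gf f"
  unfolding gf_def by blast

lemma gf_hs: "good K \<Longrightarrow> gf (hs K)"
  by (rule gfI[of K "{0}"]) (auto intro: good_point)

lemma gf_add:
  assumes "gf f" "gf g"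
  shows "gf (\<lambda>u. f u + g u)"
proof -
  obtain K L where K: "good K" "good L" "\<And>u. f u = hs K u - hs L u"
    using assms(1) unfolding gf_def by blast
  obtain M N where M: "good M" "good N" "\<And>u. g u = hs M u - hs N u"
    using assms(2) unfolding gf_def by blast
  show ?thesis
    by (rule gfI[of "K + M" "L + N"]) (auto intro: good_add simp: K M hs_plus good_body)
qed

lemma gf_minus:
  assumes "gf f"
  shows "gf (\<lambda>u. - f u)"
proof -
  obtain K L where K: "good K" "good L" "\<And>u. f u = hs K u - hs L u"
    using assms(1) unfolding gf_def by blast
  show ?thesis by (rule gfI[of L K]) (auto simp: K)
qed

lemma gf_cmult_nonneg:
  assumes "gf f" "0 \<le> c"
  shows "gf (\<lambda>u. c * f u)"
proof -
  obtain K L where K: "good K" "good L" "\<And>u. f u = hs K u - hs L u"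
    using assms(1) unfolding gf_def by blast
  show ?thesis
    by (rule gfI[of "(*\<^sub>R) c ` K" "(*\<^sub>R) c ` L"])
      (auto intro: good_scale simp: K hs_scaleR good_body assms(2) algebra_simps)
qed

lemma gf_cmult:
  assumes "gf f"
  shows "gf (\<lambda>u. c * f u)"
  using gf_cmult_nonneg[OF assms, of c] gf_minus[OF gf_cmult_nonneg[OF assms, of "- c"]]
  by (cases "0 \<le> c") auto

lemma gf_diff: "gf f \<Longrightarrow> gf g \<Longrightarrow> gf (\<lambda>u. f u - g u)"
  using gf_add[of f "\<lambda>u. - g u"] gf_minus[of g] by simp

lemma gf_zero: "gf (\<lambda>_. 0)"
  by (rule gfI[of "{0}" "{0}"]) (auto intro: good_point)

lemma gf_sum:
  assumes "\<And>i. i \<in> I \<Longrightarrow> gf (f i)"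
  shows "gf (\<lambda>u. \<Sum>i\<in>I. f i u)"
  using assms
proof (induction I rule: infinite_finite_induct)
  case (insert i I)
  then show ?case using gf_add[of "f i" "\<lambda>u. \<Sum>i\<in>I. f i u"] by simp
qed (auto intro: gf_zero)

lemma gf_norm: "gf norm"
  using gf_hs[OF good_cball] by (simp add: gf_def)

lemma gf_inner: "gf (\<lambda>u. p \<bullet> u)"
  using gf_hs[OF good_point[of p]] by (simp add: gf_def inner_commute)

text \<open>Only a uniform bound \<open>c\<close> is needed: by cancellation the bodies with support functions
  \<open>f j + c norm\<close> are good, and they converge.\<close>

lemma gf_LIMSEQ:
  assumes f: "\<And>j. gf (f j)" and sub: "\<And>j. sublinear (\<lambda>u. f j u + c * norm u)"
    and lim: "\<And>u. (\<lambda>j. f j u) \<longlonglongrightarrow> g u"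
  shows "gf g"
proof -
  have c: "gf (\<lambda>u. c * norm u)" by (rule gf_cmult[OF gf_norm])
  have ex: "\<exists>M. good M \<and> (\<forall>u. hs M u = f j u + c * norm u)" for j
  proof -
    obtain M where M: "M \<in> convex_bodies" "hs M = (\<lambda>u. f j u + c * norm u)"
      using ex_hs_eq[OF sub] by blast
    have "gf (hs M)" unfolding M(2) by (rule gf_add[OF f c])
    then obtain K L where K: "good K" "good L" "\<And>u. hs M u = hs K u - hs L u"
      unfolding gf_def by blast
    have "hs (M + L) u = hs K u" for u
      using hs_plus[OF M(1) good_body[OF K(2)], of u] K(3)[of u] by simp
    then have "M + L = K"
      by (intro hs_inject set_plus_convex_bodies good_body[OF K(1)] good_body[OF K(2)] M(1))
    then have "good M" using good_cancel[OF M(1) K(2)] K(1) by simp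
    then show ?thesis using M(2) by auto
  qed
  define M where "M j = (SOME M. good M \<and> (\<forall>u. hs M u = f j u + c * norm u))" for j
  have M: "good (M j)" "hs (M j) u = f j u + c * norm u" for j u
    using someI_ex[OF ex, of j] unfolding M_def by blast+
  have lim': "(\<lambda>j. hs (M j) u) \<longlonglongrightarrow> g u + c * norm u" for u
    unfolding M by (intro tendsto_intros lim)
  have "sublinear (\<lambda>u. g u + c * norm u)"
    by (rule sublinear_LIMSEQ[OF sublinear_hs[OF good_body[OF M(1)]] lim'])
  then obtain N where N: "N \<in> convex_bodies" "hs N = (\<lambda>u. g u + c * norm u)"
    using ex_hs_eq by blast
  have "good N"
  proof (rule good_LIMSEQ[where Ks = M, OF M(1) N(1)])
    show "(\<lambda>j. hs (M j) u) \<longlonglongrightarrow> hs N u" for u unfolding N(2) by (rule lim')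
  qed
  from gf_diff[OF gf_hs[OF this] c] show ?thesis by (simp add: N(2))
qed

lemma good_of_gf:
  assumes "K \<in> convex_bodies" "gf (hs K)"
  shows "good K"
proof -
  obtain M L where M: "good M" "good L" "\<And>u. hs K u = hs M u - hs L u"
    using assms(2) unfolding gf_def by blast
  have "K + L = M"
    by (rule hs_inject) (auto simp: hs_plus assms M good_body)
  then show ?thesis using good_cancel[OF assms(1) M(2)] M(1) by simp
qed

text \<open>All partial sums become sublinear after adding one and the same multiple of the norm,
  the sum of \<open>\<bar>c j\<bar> * (A j + C j)\<close>; this is the uniform bound that
  \<open>gf_LIMSEQ\<close> asks for.\<close>

lemma gf_series:
  assumes F: "\<And>j. gf (\<lambda>u. norm u * F j (sgn u))" and C2: "\<And>j. circ_C2 (F j) (A j) (B j) (C j)"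
    and sm: "summable (\<lambda>j. \<bar>c j\<bar> * (A j + C j))"
    and lim: "\<And>u. norm u = 1 \<Longrightarrow> (\<lambda>j. c j * F j u) sums G u"
  shows "gf (\<lambda>u. norm u * G (sgn u))"
    and "sublinear (\<lambda>u. norm u * G (sgn u) + (\<Sum>j. \<bar>c j\<bar> * (A j + C j)) * norm u)"
proof -
  define k where "k = (\<Sum>j. \<bar>c j\<bar> * (A j + C j))"
  define f where "f m u = norm u * (\<Sum>j<m. c j * F j (sgn u))" for m u
  have AC: "0 \<le> A j + C j" for j
  proof -
    have ab: "\<exists>a b :: 'a. orthonormal a b"
      using exists_orthonormal_decomp[OF norm_Basis[OF SOME_Basis] dim] by metis
    then obtain a b :: 'a where "orthonormal a b" by blast
    from circ_C2D(3,5)[OF C2 this, of j 0] show ?thesis by linarith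
  qed
  have gff: "gf (f m)" for m
  proof -
    have "gf (\<lambda>u. \<Sum>j<m. c j * (norm u * F j (sgn u)))"
      by (intro gf_sum gf_cmult F)
    then show ?thesis unfolding f_def by (simp add: sum_distrib_left mult_ac)
  qed
  have sub: "sublinear (\<lambda>u. f m u + k * norm u)" for m
  proof -
    have "circ_C2 (\<lambda>u. \<Sum>j<m. c j * F j u) (\<Sum>j<m. \<bar>c j\<bar> * A j) (\<Sum>j<m. \<bar>c j\<bar> * B j) (\<Sum>j<m. \<bar>c j\<bar> * C j)"
      by (rule circ_C2_sum) (rule circ_C2_cmult[OF C2])
    moreover have "(\<Sum>j<m. \<bar>c j\<bar> * A j) + (\<Sum>j<m. \<bar>c j\<bar> * C j) \<le> k"
      unfolding k_def sum.distrib[symmetric] distrib_left[symmetric]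
      using AC by (intro sum_le_suminf sm) auto
    ultimately show ?thesis
      unfolding f_def by (rule circ_C2_sublinear[OF _ dim])
  qed
  have lim': "(\<lambda>m. f m u) \<longlonglongrightarrow> norm u * G (sgn u)" for u
  proof (cases "u = 0")
    case False
    then have "(\<lambda>m. \<Sum>j<m. c j * F j (sgn u)) \<longlonglongrightarrow> G (sgn u)"
      using lim[of "sgn u"] by (simp add: sums_def norm_sgn)
    then show ?thesis unfolding f_def by (intro tendsto_intros)
  qed (simp add: f_def)
  show "gf (\<lambda>u. norm u * G (sgn u))"
    by (rule gf_LIMSEQ[OF gff sub lim'])
  show "sublinear (\<lambda>u. norm u * G (sgn u) + (\<Sum>j. \<bar>c j\<bar> * (A j + C j)) * norm u)"
    unfolding k_def[symmetric] by (rule sublinear_LIMSEQ[OF sub]) (rule tendsto_add[OF lim' tendsto_const])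
qed

end

section \<open>Power series of zonal functions\<close>

lemma circ_C2_inner_power:
  assumes "norm w = 1"
  shows "circ_C2 (\<lambda>u. (w \<bullet> u) ^ m) 1 (real m) (2 * (real m)\<^sup>2)"
  using circ_C2_power[OF circ_C2_inner[of w], of m] assms by (simp add: mult.commute)

text \<open>Consecutive coefficients differ by the factor \<open>(\<beta> - i) / (i + 1)\<close>, of
  modulus at most one.\<close>

lemma abs_gchoose_le_1:
  fixes \<beta> :: real
  assumes "\<bar>\<beta>\<bar> \<le> 1"
  shows "\<bar>\<beta> gchoose i\<bar> \<le> 1"
proof (induction i)
  case (Suc i)
  have "\<beta> gchoose Suc i = (\<beta> gchoose i) * ((\<beta> - real i) / real (Suc i))"
    using gbinomial_mult_1[of \<beta> i] by (simp add: field_simps)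
  moreover have "\<bar>(\<beta> - real i) / real (Suc i)\<bar> \<le> 1"
    using assms unfolding abs_divide by (simp add: divide_le_eq abs_le_iff)
  ultimately show ?case using Suc by (simp only: abs_mult) (intro mult_le_one, simp_all)
qed simp

text \<open>Differentiating the geometric series twice gives the terms
  \<open>(i + 1) * (i + 2) * r ^ i\<close>, which up to a constant dominate every quadratic
  polynomial times \<open>r ^ i\<close>.\<close>

lemma summable_poly_geometric:
  fixes r :: real
  assumes "0 \<le> r" "r < 1"
  shows "summable (\<lambda>i. r ^ i * (1 + 2 * (real (p * (i + k) + q))\<^sup>2))"
proof -
  have 1: "summable (\<lambda>i. real (Suc i) * x ^ i)" if "norm x < 1" for x :: real
    using termdiff_converges[of x 1 "\<lambda>_. 1"] that by (simp add: diffs_def summable_geometric)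
  have "norm r < 1" using assms by simp
  from termdiff_converges[OF this, of "\<lambda>i. real (Suc i)"] 1
  have 2: "summable (\<lambda>i. real (Suc i) * real (Suc (Suc i)) * r ^ i)"
    by (simp add: diffs_def del: of_nat_Suc)
  define C where "C = 1 + 2 * (real (p * (1 + k) + q))\<^sup>2"
  show ?thesis
  proof (rule summable_comparison_test'[of "\<lambda>i. C * (real (Suc i) * real (Suc (Suc i)) * r ^ i)" 0])
    show "summable (\<lambda>i. C * (real (Suc i) * real (Suc (Suc i)) * r ^ i))"
      by (rule summable_mult[OF 2])
    fix i :: nat
    have "p * (i + k) + q \<le> (p * (1 + k) + q) * (i + 1)"
      by (simp add: algebra_simps)
    then have "real (p * (i + k) + q) \<le> real (p * (1 + k) + q) * real (i + 1)"
      by (metis of_nat_le_iff of_nat_mult)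
    then have "(real (p * (i + k) + q))\<^sup>2 \<le> (real (p * (1 + k) + q) * real (i + 1))\<^sup>2"
      by (intro power_mono) auto
    moreover have "(real (i + 1))\<^sup>2 \<le> real (Suc i) * real (Suc (Suc i))"
      unfolding power2_eq_square by (intro mult_mono) auto
    then have "(real (p * (1 + k) + q))\<^sup>2 * (real (i + 1))\<^sup>2 \<le>
        (real (p * (1 + k) + q))\<^sup>2 * (real (Suc i) * real (Suc (Suc i)))"
      by (intro mult_left_mono) auto
    moreover have "1 \<le> real (Suc i) * real (Suc (Suc i))"
      by (simp add: algebra_simps)
    ultimately have "1 + 2 * (real (p * (i + k) + q))\<^sup>2 \<le> C * (real (Suc i) * real (Suc (Suc i)))"
      unfolding C_def distrib_right mult.assoc power_mult_distrib by linarith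
    then have "(1 + 2 * (real (p * (i + k) + q))\<^sup>2) * r ^ i \<le> C * (real (Suc i) * real (Suc (Suc i))) * r ^ i"
      using assms by (intro mult_right_mono) auto
    then show "norm (r ^ i * (1 + 2 * (real (p * (i + k) + q))\<^sup>2)) \<le> C * (real (Suc i) * real (Suc (Suc i)) * r ^ i)"
      using assms by (simp add: mult_ac abs_mult)
  qed
qed

context good_bodies
begin

text \<open>Extraction of the coefficients of a power series in \<open>s\<close>: the remainder of order \<open>k\<close>, divided
  by \<open>s ^ k\<close>, has convexity defect bounded uniformly in \<open>s\<close>.\<close>

lemma gf_extract:
  assumes w: "norm w = 1" and \<beta>: "\<bar>\<beta>\<bar> \<le> 1" and nz: "\<And>i. \<beta> gchoose i \<noteq> 0"
    and gfs: "\<And>s. 0 < s \<Longrightarrow> s \<le> 1 / 2 \<Longrightarrow>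
      gf (\<lambda>u. norm u * ((w \<bullet> sgn u) ^ q * (1 + s * (w \<bullet> sgn u)\<^sup>2) powr \<beta>))"
  shows "gf (\<lambda>u. norm u * (w \<bullet> sgn u) ^ (2 * k + q))"
proof (induction k rule: less_induct)
  case (less k)
  define c where "c i = \<beta> gchoose i" for i
  \<comment> \<open>\<open>D\<close> bounds the convexity defect of the remainder for every
    \<open>s \<le> 1 / 2\<close> at once, since the binomial coefficients have modulus at most
    one.\<close>
  define D where "D = (\<Sum>i. (1 / 2) ^ i * (1 + 2 * (real (2 * (i + k) + q))\<^sup>2) :: real)"
  have smD: "summable (\<lambda>i. (1 / 2) ^ i * (1 + 2 * (real (2 * (i + k) + q))\<^sup>2) :: real)"
    by (rule summable_poly_geometric) auto
  define G where "G s u = (\<Sum>i. c (i + k) * s ^ i * (w \<bullet> u) ^ (2 * (i + k) + q))" for s u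
  have w_le: "\<bar>w \<bullet> u\<bar> \<le> 1" if "norm u = 1" for u
    using Cauchy_Schwarz_ineq2[of w u] w that by simp
  have tbound: "\<bar>c (i + k) * s ^ i * (w \<bullet> u) ^ (2 * (i + k) + q)\<bar> \<le> s ^ i"
    if "0 < s" "norm u = 1" for s u i
  proof -
    have "\<bar>c (i + k)\<bar> \<le> 1" "\<bar>w \<bullet> u\<bar> ^ (2 * (i + k) + q) \<le> 1"
      using abs_gchoose_le_1[OF \<beta>] w_le[OF that(2)] by (auto simp: c_def power_le_one)
    then have "\<bar>c (i + k)\<bar> * \<bar>s ^ i\<bar> * \<bar>w \<bullet> u\<bar> ^ (2 * (i + k) + q) \<le> 1 * \<bar>s ^ i\<bar> * 1"
      by (intro mult_mono) auto
    then show ?thesis using that by (simp add: abs_mult power_abs)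
  qed
  have sums_G: "(\<lambda>i. c (i + k) * s ^ i * (w \<bullet> u) ^ (2 * (i + k) + q)) sums G s u"
    if s: "0 < s" "s \<le> 1 / 2" "norm u = 1" for s u
  proof -
    have "summable (\<lambda>i. c (i + k) * s ^ i * (w \<bullet> u) ^ (2 * (i + k) + q))"
      by (rule summable_comparison_test'[of "\<lambda>i. s ^ i" 0]) (use tbound s in \<open>auto intro!: summable_geometric\<close>)
    then show ?thesis unfolding G_def by (rule summable_sums)
  qed
  have split: "s ^ k * G s u = (w \<bullet> u) ^ q * (1 + s * (w \<bullet> u)\<^sup>2) powr \<beta>
      - (\<Sum>i<k. c i * s ^ i * (w \<bullet> u) ^ (2 * i + q))"
    if s: "0 < s" "s \<le> 1 / 2" "norm u = 1" for s u
  proof -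
    have "(w \<bullet> u)\<^sup>2 \<le> 1" using w_le[OF s(3)] by (simp add: abs_square_le_1)
    then have "s * (w \<bullet> u)\<^sup>2 \<le> (1 / 2) * 1" using s by (intro mult_mono) auto
    then have "\<bar>s * (w \<bullet> u)\<^sup>2\<bar> < 1" using s by simp
    from sums_mult[OF gen_binomial_real[OF this, of \<beta>], of "(w \<bullet> u) ^ q"]
    have "(\<lambda>i. c i * s ^ i * (w \<bullet> u) ^ (2 * i + q)) sums ((w \<bullet> u) ^ q * (1 + s * (w \<bullet> u)\<^sup>2) powr \<beta>)"
      by (simp add: c_def power_mult_distrib power_mult[symmetric] power_add mult_ac)
    then have "(\<lambda>i. c (i + k) * s ^ (i + k) * (w \<bullet> u) ^ (2 * (i + k) + q)) sums
        ((w \<bullet> u) ^ q * (1 + s * (w \<bullet> u)\<^sup>2) powr \<beta> - (\<Sum>i<k. c i * s ^ i * (w \<bullet> u) ^ (2 * i + q)))"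
      by (subst sums_iff_shift) simp
    moreover have "(\<lambda>i. c (i + k) * s ^ (i + k) * (w \<bullet> u) ^ (2 * (i + k) + q)) sums (s ^ k * G s u)"
      using sums_mult[OF sums_G[OF s], of "s ^ k"] by (simp add: power_add mult_ac)
    ultimately show ?thesis by (rule sums_unique2[symmetric])
  qed
  \<comment> \<open>By induction the terms of order below \<open>k\<close> lie in the space, so they
    can be subtracted before dividing by \<open>s ^ k\<close>.\<close>
  have gfG: "gf (\<lambda>u. norm u * G s (sgn u))" if s: "0 < s" "s \<le> 1 / 2" for s
  proof -
    have "gf (\<lambda>u. (1 / s ^ k) * (norm u * ((w \<bullet> sgn u) ^ q * (1 + s * (w \<bullet> sgn u)\<^sup>2) powr \<beta>)
        - (\<Sum>i<k. (c i * s ^ i) * (norm u * (w \<bullet> sgn u) ^ (2 * i + q)))))"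
      by (intro gf_cmult gf_diff gf_sum gfs s less) auto
    moreover have "(1 / s ^ k) * (norm u * ((w \<bullet> sgn u) ^ q * (1 + s * (w \<bullet> sgn u)\<^sup>2) powr \<beta>)
        - (\<Sum>i<k. (c i * s ^ i) * (norm u * (w \<bullet> sgn u) ^ (2 * i + q)))) = norm u * G s (sgn u)" for u
    proof (cases "u = 0")
      case False
      have "(\<Sum>i<k. (c i * s ^ i) * (norm u * (w \<bullet> sgn u) ^ (2 * i + q)))
          = norm u * (\<Sum>i<k. c i * s ^ i * (w \<bullet> sgn u) ^ (2 * i + q))"
        by (simp add: sum_distrib_left mult_ac)
      then have "norm u * ((w \<bullet> sgn u) ^ q * (1 + s * (w \<bullet> sgn u)\<^sup>2) powr \<beta>)
        - (\<Sum>i<k. (c i * s ^ i) * (norm u * (w \<bullet> sgn u) ^ (2 * i + q))) = norm u * (s ^ k * G s (sgn u))"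
        using split[OF s, of "sgn u"] False by (simp add: norm_sgn right_diff_distrib)
      then show ?thesis using s by simp
    qed simp
    ultimately show ?thesis by simp
  qed
  have subG: "sublinear (\<lambda>u. norm u * G s (sgn u) + D * norm u)" if s: "0 < s" "s \<le> 1 / 2" for s
  proof -
    define f where "f m u = norm u * (\<Sum>i<m. (c (i + k) * s ^ i) * (w \<bullet> sgn u) ^ (2 * (i + k) + q))" for m u
    have "sublinear (\<lambda>u. f m u + D * norm u)" for m
    proof -
      have "circ_C2 (\<lambda>u. \<Sum>i<m. (c (i + k) * s ^ i) * (w \<bullet> u) ^ (2 * (i + k) + q))
          (\<Sum>i<m. \<bar>c (i + k) * s ^ i\<bar> * 1) (\<Sum>i<m. \<bar>c (i + k) * s ^ i\<bar> * real (2 * (i + k) + q))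
          (\<Sum>i<m. \<bar>c (i + k) * s ^ i\<bar> * (2 * (real (2 * (i + k) + q))\<^sup>2))"
        by (rule circ_C2_sum) (rule circ_C2_cmult[OF circ_C2_inner_power[OF w]])
      moreover have "(\<Sum>i<m. \<bar>c (i + k) * s ^ i\<bar> * 1)
          + (\<Sum>i<m. \<bar>c (i + k) * s ^ i\<bar> * (2 * (real (2 * (i + k) + q))\<^sup>2)) \<le> D"
      proof -
        have "\<bar>c (i + k) * s ^ i\<bar> \<le> (1 / 2) ^ i" for i
        proof -
          have "\<bar>c (i + k)\<bar> * s ^ i \<le> 1 * (1 / 2) ^ i"
            using abs_gchoose_le_1[OF \<beta>] s by (intro mult_mono power_mono) (auto simp: c_def)
          then show ?thesis using s by (simp add: abs_mult)
        qed
        then have "(\<Sum>i<m. \<bar>c (i + k) * s ^ i\<bar> * (1 + 2 * (real (2 * (i + k) + q))\<^sup>2))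
            \<le> (\<Sum>i<m. (1 / 2) ^ i * (1 + 2 * (real (2 * (i + k) + q))\<^sup>2))"
          by (intro sum_mono mult_right_mono) auto
        also have "\<dots> \<le> D" unfolding D_def by (intro sum_le_suminf smD) auto
        finally show ?thesis by (simp add: sum.distrib[symmetric] distrib_left)
      qed
      ultimately show ?thesis
        unfolding f_def by (rule circ_C2_sublinear[OF _ dim])
    qed
    moreover have "(\<lambda>m. f m u + D * norm u) \<longlonglongrightarrow> norm u * G s (sgn u) + D * norm u" for u
    proof (cases "u = 0")
      case False
      then have "(\<lambda>m. \<Sum>i<m. (c (i + k) * s ^ i) * (w \<bullet> sgn u) ^ (2 * (i + k) + q)) \<longlonglongrightarrow> G s (sgn u)"
        using sums_G[OF s, of "sgn u"] by (simp add: sums_def norm_sgn)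
      then show ?thesis unfolding f_def by (intro tendsto_intros)
    qed (simp add: f_def)
    ultimately show ?thesis by (rule sublinear_LIMSEQ)
  qed
  \<comment> \<open>\<open>s = 1 / (j + 2)\<close> stays in the admissible range, and beyond its
    leading term the series is at most \<open>s / (1 - s)\<close>.\<close>
  have limG: "(\<lambda>j. G (inverse (real (Suc (Suc j)))) u) \<longlonglongrightarrow> c k * (w \<bullet> u) ^ (2 * k + q)" if u: "norm u = 1" for u
  proof (rule LIMSEQ_inverse_bound)
    fix j
    define s where "s = inverse (real (Suc (Suc j)))"
    have s: "0 < s" "s \<le> 1 / 2" by (auto simp: s_def field_simps)
    have "(\<lambda>i. c (Suc i + k) * s ^ Suc i * (w \<bullet> u) ^ (2 * (Suc i + k) + q)) sums
        (G s u - c k * (w \<bullet> u) ^ (2 * k + q))"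
      using sums_G[OF s u] by (subst sums_Suc_iff) simp
    moreover have "(\<lambda>i. s ^ Suc i) sums (s * (1 / (1 - s)))"
      using sums_mult[OF geometric_sums[of s], of s] s by simp
    ultimately have "norm (G s u - c k * (w \<bullet> u) ^ (2 * k + q)) \<le> s * (1 / (1 - s))"
      by (rule norm_sums_le) (use tbound[OF s(1) u] in \<open>simp only: real_norm_def\<close>)
    also have "\<dots> \<le> s * 2" using s by (intro mult_left_mono) (auto simp: field_simps)
    also have "\<dots> \<le> 2 * inverse (real (Suc j))" by (simp add: s_def field_simps)
    finally show "\<bar>G (inverse (real (Suc (Suc j)))) u - c k * (w \<bullet> u) ^ (2 * k + q)\<bar>
        \<le> 2 * inverse (real (Suc j))" by (simp add: s_def)
  qed
  have small: "0 < inverse (real (Suc (Suc j)))" "inverse (real (Suc (Suc j))) \<le> 1 / 2" for j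
    by (auto simp: field_simps)
  have "gf (\<lambda>u. norm u * (c k * (w \<bullet> sgn u) ^ (2 * k + q)))"
  proof (rule gf_LIMSEQ[where f = "\<lambda>j u. norm u * G (inverse (real (Suc (Suc j)))) (sgn u)" and c = D])
    fix u
    show "(\<lambda>j. norm u * G (inverse (real (Suc (Suc j)))) (sgn u)) \<longlonglongrightarrow> norm u * (c k * (w \<bullet> sgn u) ^ (2 * k + q))"
      using limG[of "sgn u"] by (cases "u = 0") (auto intro!: tendsto_intros simp: norm_sgn)
  qed (rule gfG[OF small] subG[OF small])+
  from gf_cmult[OF this, of "1 / c k"] show ?case
    using nz[of k] by (simp add: c_def mult_ac)
qed

text \<open>The exponential series of zonal monomials; the quadratic growth of their bounds is
  absorbed into \<open>4 ^ j\<close>.\<close>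

lemma gf_exp:
  assumes pow: "\<And>w m. norm w = 1 \<Longrightarrow> gf (\<lambda>u. norm u * (w \<bullet> sgn u) ^ m)"
  shows "gf (\<lambda>u. norm u * exp (w \<bullet> sgn u))"
proof -
  obtain e :: 'a where e: "norm e = 1" "w = norm w *\<^sub>R e"
  proof (cases "w = 0")
    case True
    then show ?thesis using that[OF norm_Basis[OF SOME_Basis]] by simp
  next
    case False
    then show ?thesis using that[of "sgn w"] by (simp add: norm_sgn sgn_div_norm)
  qed
  define r where "r = norm w"
  have w: "w \<bullet> u = r * (e \<bullet> u)" for u using e(2) by (metis inner_scaleR_left r_def)
  show ?thesis
  proof (rule gf_series(1)[where F = "\<lambda>j u. (e \<bullet> u) ^ j" and A = "\<lambda>_. 1" and B = real
        and C = "\<lambda>j. 2 * (real j)\<^sup>2" and c = "\<lambda>j. r ^ j / fact j"])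
    show "summable (\<lambda>j. \<bar>r ^ j / fact j\<bar> * (1 + 2 * (real j)\<^sup>2))"
    proof (rule summable_comparison_test'[of "\<lambda>j. 3 * (inverse (fact j) * (4 * r) ^ j)" 0])
      show "summable (\<lambda>j. 3 * (inverse (fact j) * (4 * r) ^ j))"
        by (rule summable_mult[OF summable_exp])
      fix j :: nat
      have "real j \<le> 2 ^ j" using of_nat_less_two_power[of j] by (simp add: less_imp_le)
      then have "(real j)\<^sup>2 \<le> (2 ^ j)\<^sup>2" by (intro power_mono) auto
      then have "(real j)\<^sup>2 \<le> 4 ^ j" by (simp add: power2_eq_square flip: power_mult_distrib)
      moreover have "(1 :: real) \<le> 4 ^ j" by simp
      ultimately have "1 + 2 * (real j)\<^sup>2 \<le> 3 * 4 ^ j" by linarith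
      then have "r ^ j / fact j * (1 + 2 * (real j)\<^sup>2) \<le> r ^ j / fact j * (3 * 4 ^ j)"
        by (intro mult_left_mono) (auto simp: r_def)
      then show "norm (\<bar>r ^ j / fact j\<bar> * (1 + 2 * (real j)\<^sup>2)) \<le> 3 * (inverse (fact j) * (4 * r) ^ j)"
        by (simp add: r_def power_mult_distrib field_simps abs_mult)
    qed
    show "(\<lambda>j. r ^ j / fact j * (e \<bullet> u) ^ j) sums exp (w \<bullet> u)" for u
      using exp_converges[of "r * (e \<bullet> u)"] by (simp add: w power_mult_distrib field_simps)
  qed (auto intro: pow e circ_C2_inner_power)
qed

end

text \<open>Sharpens the bound on \<open>F\<close> alone. For \<open>Y\<close> in
  \<open>gf_softmax\<close> the bound \<open>r < 1\<close> comes from the range of the whole sum,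
  and adding up the bounds of the terms would lose it.\<close>

lemma circ_C2_bound:
  assumes "circ_C2 F A B C" "\<And>u. norm u = 1 \<Longrightarrow> \<bar>F u\<bar> \<le> A'"
  shows "circ_C2 F A' B C"
proof (rule circ_C2I[where ?g1.0 = "circ_deriv F" and ?g2.0 = "\<lambda>a b. deriv (circ_deriv F a b)"])
  fix a b :: 'a and t assume ab: "orthonormal a b"
  show "\<bar>F (circ a b t)\<bar> \<le> A'" by (rule assms(2)[OF norm_circ[OF ab]])
qed (rule circ_C2D[OF assms(1)]; assumption)+

section \<open>Soft maxima and polytopes\<close>

definition softmax_sum :: "'a::real_inner set \<Rightarrow> real \<Rightarrow> 'a \<Rightarrow> real" where
  "softmax_sum X \<beta> u = (\<Sum>p\<in>X. exp (\<beta> * (p \<bullet> u)))"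

lemma softmax_sum_pos: "finite X \<Longrightarrow> X \<noteq> {} \<Longrightarrow> 0 < softmax_sum X \<beta> u"
  unfolding softmax_sum_def by (intro sum_pos) auto

lemma inner_le_ln_softmax_sum:
  assumes "finite X" "p \<in> X" "0 < \<beta>"
  shows "p \<bullet> u \<le> ln (softmax_sum X \<beta> u) / \<beta>"
proof -
  have "exp (\<beta> * (p \<bullet> u)) \<le> softmax_sum X \<beta> u"
    unfolding softmax_sum_def using assms by (intro member_le_sum) auto
  then have "ln (exp (\<beta> * (p \<bullet> u))) \<le> ln (softmax_sum X \<beta> u)"
    by (subst ln_le_cancel_iff) (use softmax_sum_pos[of X \<beta> u] assms in auto)
  then show ?thesis using assms by (simp add: pos_le_divide_eq mult.commute)
qed

text \<open>With weights proportional to \<open>exp (\<beta> (p \<bullet> c t))\<close> the second derivative along a great circle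
  \<open>c\<close> is \<open>\<beta>\<close> times a variance minus the mean of \<open>p \<bullet> c t\<close>, and the mean is at most the function
  itself.\<close>

lemma sublinear_softmax:
  fixes X :: "'a::euclidean_space set"
  assumes X: "finite X" "X \<noteq> {}" and \<beta>: "0 < \<beta>" and dim: "DIM('a) \<ge> 2"
  shows "sublinear (\<lambda>u. norm u * (ln (softmax_sum X \<beta> (sgn u)) / \<beta>))"
proof (rule sublinear_circI[where F = "\<lambda>u. ln (softmax_sum X \<beta> u) / \<beta>", OF dim])
  fix a b :: 'a
  define E where "E p t = exp (\<beta> * (p \<bullet> circ a b t))" for p t
  define q where "q p t = \<beta> * (p \<bullet> circ b (- a) t)" for p t
  define S where "S t = (\<Sum>p\<in>X. E p t)" for t
  define S1 where "S1 t = (\<Sum>p\<in>X. E p t * q p t)" for t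
  define S2 where "S2 t = (\<Sum>p\<in>X. E p t * ((q p t)\<^sup>2 - \<beta> * (p \<bullet> circ a b t)))" for t
  have S_eq: "softmax_sum X \<beta> (circ a b t) = S t" for t
    by (simp add: softmax_sum_def S_def E_def)
  have S_pos: "S t > 0" for t unfolding S_eq[symmetric] by (rule softmax_sum_pos[OF X])
  have dE: "(E p has_real_derivative E p t * q p t) (at t)" for p t
    unfolding E_def q_def by (rule DERIV_fun_exp[OF DERIV_cmult[OF inner_circ_deriv(1)]])
  have dq: "(q p has_real_derivative - (\<beta> * (p \<bullet> circ a b t))) (at t)" for p t
    using DERIV_cmult[OF inner_circ_deriv(2)[of p b a t], of \<beta>] unfolding q_def by simp
  have dS: "(S has_real_derivative S1 t) (at t)" for t
    unfolding S_def S1_def by (rule DERIV_sum) (rule dE)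
  have dEq: "((\<lambda>t. E p t * q p t) has_real_derivative E p t * ((q p t)\<^sup>2 - \<beta> * (p \<bullet> circ a b t))) (at t)" for p t
    using DERIV_mult[OF dE[of p t] dq[of p t]] by (simp add: algebra_simps power2_eq_square)
  have dS1: "(S1 has_real_derivative S2 t) (at t)" for t
    unfolding S1_def S2_def by (rule DERIV_sum) (rule dEq)
  show "\<exists>g1 g2. \<forall>t. ((\<lambda>t. ln (softmax_sum X \<beta> (circ a b t)) / \<beta>) has_real_derivative g1 t) (at t) \<and>
      (g1 has_real_derivative g2 t) (at t) \<and> ln (softmax_sum X \<beta> (circ a b t)) / \<beta> + g2 t \<ge> 0"
    unfolding S_eq
  proof (rule exI[of _ "\<lambda>t. S1 t / S t / \<beta>"],
      rule exI[of _ "\<lambda>t. (S2 t * S t - S1 t * S1 t) / (S t * S t) / \<beta>"], intro allI conjI)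
    fix t
    have nz: "S t \<noteq> 0" using S_pos[of t] by simp
    have "((\<lambda>t. ln (S t)) has_real_derivative S1 t / S t) (at t)"
      using DERIV_chain2[OF DERIV_ln_divide[OF S_pos] dS] by simp
    then show "((\<lambda>t. ln (S t) / \<beta>) has_real_derivative S1 t / S t / \<beta>) (at t)"
      by (rule DERIV_cdivide)
    show "((\<lambda>t. S1 t / S t / \<beta>) has_real_derivative (S2 t * S t - S1 t * S1 t) / (S t * S t) / \<beta>) (at t)"
      by (rule DERIV_cdivide[OF DERIV_divide[OF dS1 dS nz]])
    define m where "m = (\<Sum>p\<in>X. E p t * (p \<bullet> circ a b t))"
    have "S1 t * S1 t \<le> (\<Sum>p\<in>X. E p t * (q p t)\<^sup>2) * S t"
    proof -
      have "(\<Sum>p\<in>X. (sqrt (E p t) * q p t) * sqrt (E p t))\<^sup>2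
          \<le> (\<Sum>p\<in>X. (sqrt (E p t) * q p t)\<^sup>2) * (\<Sum>p\<in>X. (sqrt (E p t))\<^sup>2)"
        by (rule Cauchy_Schwarz_ineq_sum)
      moreover have "(sqrt (E p t) * q p t) * sqrt (E p t) = E p t * q p t" for p
      proof -
        have "(sqrt (E p t) * q p t) * sqrt (E p t) = (sqrt (E p t) * sqrt (E p t)) * q p t"
          by (simp only: mult_ac)
        then show ?thesis by (simp add: E_def)
      qed
      ultimately show ?thesis
        by (simp add: S1_def S_def E_def power2_eq_square power_mult_distrib mult_ac)
    qed
    moreover have "S2 t = (\<Sum>p\<in>X. E p t * (q p t)\<^sup>2) - \<beta> * m"
      by (simp add: S2_def m_def sum_distrib_left sum_subtractf right_diff_distrib mult_ac)
    ultimately have "S2 t * S t - S1 t * S1 t \<ge> - (\<beta> * m * S t)"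
      by (simp add: left_diff_distrib)
    moreover define L where "L = ln (S t) / \<beta>"
    have "m \<le> L * S t"
    proof -
      have "m \<le> (\<Sum>p\<in>X. E p t * L)"
        unfolding m_def L_def S_eq[symmetric]
        by (intro sum_mono mult_left_mono inner_le_ln_softmax_sum X \<beta>) (auto simp: E_def)
      then show ?thesis unfolding S_def sum_distrib_left by (simp add: mult.commute)
    qed
    then have "\<beta> * m * S t \<le> \<beta> * (L * S t) * S t"
      using \<beta> S_pos[of t] by (intro mult_right_mono mult_left_mono) auto
    moreover have "\<beta> * (L * S t) * S t = ln (S t) * (S t * S t)"
      using \<beta> by (simp add: L_def)
    ultimately have "- (ln (S t) * (S t * S t)) \<le> S2 t * S t - S1 t * S1 t"
      by linarith
    then have "- ln (S t) \<le> (S2 t * S t - S1 t * S1 t) / (S t * S t)"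
      using S_pos[of t] by (subst pos_le_divide_eq) auto
    then have "- ln (S t) / \<beta> \<le> (S2 t * S t - S1 t * S1 t) / (S t * S t) / \<beta>"
      using \<beta> by (intro divide_right_mono) auto
    then show "ln (S t) / \<beta> + (S2 t * S t - S1 t * S1 t) / (S t * S t) / \<beta> \<ge> 0" by simp
  qed
qed

context good_bodies
begin

text \<open>After division by \<open>M\<close> the sum lies between \<open>m / M\<close> and
  \<open>1\<close>, so \<open>Y\<close> stays in \<open>[0, r]\<close> with \<open>r < 1\<close> and
  \<open>ln (1 - Y)\<close> is a power series in \<open>Y\<close>. The powers of \<open>Y\<close>
  are in the space because products of exponentials of linear functions are again such
  exponentials.\<close>

lemma gf_softmax:
  fixes X :: "'a set"
  assumes pow: "\<And>w m. norm w = 1 \<Longrightarrow> gf (\<lambda>u. norm u * (w \<bullet> sgn u) ^ m)"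
    and X: "finite X" "X \<noteq> {}" and \<beta>: "0 < \<beta>"
  shows "gf (\<lambda>u. norm u * (ln (softmax_sum X \<beta> (sgn u)) / \<beta>))"
proof -
  define m where "m = (\<Sum>p\<in>X. exp (- (\<beta> * norm p)))"
  \<comment> \<open>The summand \<open>1\<close> gives \<open>m < M\<close> and hence
    \<open>r > 0\<close>, as \<open>circ_C2_power\<close> requires.\<close>
  define M where "M = (\<Sum>p\<in>X. exp (\<beta> * norm p)) + 1"
  define Y where "Y u = 1 - softmax_sum X \<beta> u / M" for u :: 'a
  define r where "r = 1 - m / M"
  have M: "M > 0" unfolding M_def by (intro add_nonneg_pos sum_nonneg) auto
  have m: "m > 0" unfolding m_def using X by (intro sum_pos) auto
  have "m < M"
  proof -
    have "m \<le> (\<Sum>p\<in>X. exp (\<beta> * norm p))" unfolding m_def using \<beta> by (intro sum_mono) simp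
    then show ?thesis by (simp add: M_def)
  qed
  then have r: "0 < r" "r < 1" using M m by (auto simp: r_def)
  have bounds: "m \<le> softmax_sum X \<beta> u \<and> softmax_sum X \<beta> u \<le> M" if "norm u = 1" for u
  proof -
    have "\<bar>\<beta> * (p \<bullet> u)\<bar> \<le> \<beta> * norm p" for p
      using Cauchy_Schwarz_ineq2[of p u] that \<beta> by (simp add: abs_mult)
    then have "- (\<beta> * norm p) \<le> \<beta> * (p \<bullet> u)" "\<beta> * (p \<bullet> u) \<le> \<beta> * norm p" for p
      by (simp_all add: abs_le_iff minus_le_iff)
    then have "m \<le> softmax_sum X \<beta> u" "softmax_sum X \<beta> u \<le> (\<Sum>p\<in>X. exp (\<beta> * norm p))"
      unfolding m_def softmax_sum_def by (intro sum_mono; simp)+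
    then show ?thesis by (simp add: M_def)
  qed
  have Y: "0 \<le> Y u" "Y u \<le> r" if "norm u = 1" for u
    using bounds[OF that] M by (auto simp: Y_def r_def divide_right_mono)
  define B where "B = (\<Sum>p\<in>X. \<bar>- 1 / M\<bar> * (exp (norm (\<beta> *\<^sub>R p)) * norm (\<beta> *\<^sub>R p)))"
  define C where "C = (\<Sum>p\<in>X. \<bar>- 1 / M\<bar> * (exp (norm (\<beta> *\<^sub>R p)) * ((norm (\<beta> *\<^sub>R p))\<^sup>2 + norm (\<beta> *\<^sub>R p))))"
  have BC: "0 \<le> B" "0 \<le> C" unfolding B_def C_def using M by (auto intro!: sum_nonneg)
  have C2: "circ_C2 Y r B C"
  proof (rule circ_C2_bound)
    have *: "circ_C2 (\<lambda>u. (\<Sum>p\<in>X. (- 1 / M) * exp ((\<beta> *\<^sub>R p) \<bullet> u)))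
        (\<Sum>p\<in>X. \<bar>- 1 / M\<bar> * exp (norm (\<beta> *\<^sub>R p))) B C"
      unfolding B_def C_def by (intro circ_C2_sum circ_C2_cmult circ_C2_exp)
    have "Y = (\<lambda>u. 1 + (\<Sum>p\<in>X. (- 1 / M) * exp ((\<beta> *\<^sub>R p) \<bullet> u)))"
      by (rule ext) (simp add: Y_def softmax_sum_def sum_divide_distrib sum_negf)
    then show "circ_C2 Y (\<bar>1\<bar> + (\<Sum>p\<in>X. \<bar>- 1 / M\<bar> * exp (norm (\<beta> *\<^sub>R p)))) B C"
      using circ_C2_add[OF circ_C2_const[of 1] *] by simp
    show "\<bar>Y u\<bar> \<le> r" if "norm u = 1" for u using Y[OF that] by simp
  qed
  \<comment> \<open>The extra factor \<open>exp (w \<bullet> sgn u)\<close> makes the induction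
    close: multiplying by \<open>Y\<close> brings in terms in which \<open>w\<close> is replaced by
    \<open>w + \<beta> *\<^sub>R p\<close>.\<close>
  have gfY': "gf (\<lambda>u. norm u * (exp (w \<bullet> sgn u) * Y (sgn u) ^ j))" for w j
  proof (induction j arbitrary: w)
    case 0
    then show ?case using gf_exp[OF pow] by simp
  next
    case (Suc j)
    have "gf (\<lambda>u. norm u * (exp (w \<bullet> sgn u) * Y (sgn u) ^ j)
        - (\<Sum>p\<in>X. (1 / M) * (norm u * (exp ((w + \<beta> *\<^sub>R p) \<bullet> sgn u) * Y (sgn u) ^ j))))"
      by (intro gf_diff gf_sum gf_cmult Suc)
    moreover have "norm u * (exp (w \<bullet> sgn u) * Y (sgn u) ^ j)
        - (\<Sum>p\<in>X. (1 / M) * (norm u * (exp ((w + \<beta> *\<^sub>R p) \<bullet> sgn u) * Y (sgn u) ^ j)))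
        = norm u * (exp (w \<bullet> sgn u) * Y (sgn u) ^ Suc j)" for u
    proof -
      have "(\<Sum>p\<in>X. (1 / M) * (norm u * (exp ((w + \<beta> *\<^sub>R p) \<bullet> sgn u) * Y (sgn u) ^ j)))
          = norm u * (exp (w \<bullet> sgn u) * Y (sgn u) ^ j) * (softmax_sum X \<beta> (sgn u) / M)"
        by (simp add: softmax_sum_def sum_distrib_left sum_divide_distrib inner_add_left exp_add mult_ac)
      then show ?thesis by (simp add: Y_def algebra_simps)
    qed
    ultimately show ?case by simp
  qed
  have gfY: "gf (\<lambda>u. norm u * Y (sgn u) ^ j)" for j
    using gfY'[of 0 j] by simp
  define D where "D = (B / r)\<^sup>2 + C / r"
  have D: "0 \<le> D" unfolding D_def using BC r by simp
  \<comment> \<open>The coefficient \<open>- 1 / real j\<close> is zero for \<open>j = 0\<close> by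
    the convention on division, in agreement with the logarithmic series.\<close>
  have "gf (\<lambda>u. norm u * ln (1 - Y (sgn u)))"
  proof (rule gf_series(1)[where F = "\<lambda>j u. Y u ^ j" and A = "\<lambda>j. r ^ j" and B = "\<lambda>j. real j * r ^ (j - 1) * B"
        and C = "\<lambda>j. (real j)\<^sup>2 * r ^ j * D" and c = "\<lambda>j. - 1 / real j" and G = "\<lambda>u. ln (1 - Y u)"])
    show "circ_C2 (\<lambda>u. Y u ^ j) (r ^ j) (real j * r ^ (j - 1) * B) ((real j)\<^sup>2 * r ^ j * D)" for j
      unfolding D_def by (rule circ_C2_power[OF C2 r(1)])
    show "summable (\<lambda>j. \<bar>- 1 / real j\<bar> * (r ^ j + (real j)\<^sup>2 * r ^ j * D))"
    proof (rule summable_comparison_test'[of "\<lambda>j. (1 + D) * (r ^ j * (1 + 2 * (real (1 * (j + 0) + 0))\<^sup>2))" 0])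
      show "summable (\<lambda>j. (1 + D) * (r ^ j * (1 + 2 * (real (1 * (j + 0) + 0))\<^sup>2)))"
        using r by (intro summable_mult summable_poly_geometric) auto
      fix j :: nat
      have nn: "0 \<le> r ^ j" using r by simp
      have nn2: "0 \<le> (real j)\<^sup>2 * r ^ j" using nn by (intro mult_nonneg_nonneg) auto
      have nn3: "0 \<le> (real j)\<^sup>2 * r ^ j * D" "0 \<le> r ^ j * D" using nn nn2 D by (auto intro: mult_nonneg_nonneg)
      have "\<bar>- 1 / real j\<bar> \<le> 1" by (cases j) auto
      then have "\<bar>- 1 / real j\<bar> * (r ^ j + (real j)\<^sup>2 * r ^ j * D) \<le> 1 * (r ^ j + (real j)\<^sup>2 * r ^ j * D)"
        using nn nn3 by (intro mult_right_mono) linarith+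
      also have "\<dots> \<le> (1 + D) * (r ^ j * (1 + 2 * (real j)\<^sup>2))"
      proof -
        have "(1 + D) * (r ^ j * (1 + 2 * (real j)\<^sup>2))
            = r ^ j + (real j)\<^sup>2 * r ^ j * D + (r ^ j * D + 2 * ((real j)\<^sup>2 * r ^ j) + (real j)\<^sup>2 * r ^ j * D)"
          by (simp add: algebra_simps)
        moreover have "0 \<le> r ^ j * D + 2 * ((real j)\<^sup>2 * r ^ j) + (real j)\<^sup>2 * r ^ j * D"
          using nn2 nn3 by (intro add_nonneg_nonneg) auto
        ultimately show ?thesis by (simp add: algebra_simps)
      qed
      finally show "norm (\<bar>- 1 / real j\<bar> * (r ^ j + (real j)\<^sup>2 * r ^ j * D))
          \<le> (1 + D) * (r ^ j * (1 + 2 * (real (1 * (j + 0) + 0))\<^sup>2))"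
        using nn nn3 by (simp add: abs_mult)
    qed
    show "(\<lambda>j. - 1 / real j * Y u ^ j) sums ln (1 - Y u)" if "norm u = 1" for u
      using ln_series'[of "- Y u"] Y[OF that] r by simp
  qed (rule gfY)
  then have "gf (\<lambda>u. (1 / \<beta>) * (norm u * ln (1 - Y (sgn u)) + ln M * norm u))"
    by (intro gf_cmult gf_add gf_norm)
  moreover have "(1 / \<beta>) * (norm u * ln (1 - Y (sgn u)) + ln M * norm u)
      = norm u * (ln (softmax_sum X \<beta> (sgn u)) / \<beta>)" for u
  proof -
    have "ln (1 - Y (sgn u)) = ln (softmax_sum X \<beta> (sgn u)) - ln M"
      using softmax_sum_pos[OF X, of \<beta> "sgn u"] M by (simp add: Y_def ln_div)
    show ?thesis unfolding \<open>ln (1 - Y (sgn u)) = ln (softmax_sum X \<beta> (sgn u)) - ln M\<close>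
      by (simp add: algebra_simps)
  qed
  ultimately show ?thesis by (simp only:)
qed

text \<open>The soft maximum exceeds the maximum by at most \<open>ln (card X) / \<beta>\<close>, so
  it converges to the support function of the hull. Soft maxima are sublinear themselves, hence
  \<open>c = 0\<close> in \<open>gf_LIMSEQ\<close>.\<close>

lemma good_convex_hull:
  assumes pow: "\<And>w m. norm w = 1 \<Longrightarrow> gf (\<lambda>u. norm u * (w \<bullet> sgn u) ^ m)"
    and X: "finite X" "X \<noteq> {}"
  shows "good (convex hull X)"
proof (rule good_of_gf)
  show body: "convex hull X \<in> convex_bodies" using X by auto
  define f where "f j u = norm u * (ln (softmax_sum X (real (Suc j)) (sgn u)) / real (Suc j))" for j u
  show "gf (hs (convex hull X))"
  proof (rule gf_LIMSEQ[where f = f and c = 0])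
    show "gf (f j)" for j
      unfolding f_def using gf_softmax[OF pow X, of "real (Suc j)"] by simp
    show "sublinear (\<lambda>u. f j u + 0 * norm u)" for j
      unfolding f_def using sublinear_softmax[OF X, of "real (Suc j)"] dim by simp
    fix u
    show "(\<lambda>j. f j u) \<longlonglongrightarrow> hs (convex hull X) u"
    proof (cases "u = 0")
      case True
      then show ?thesis
        by (simp add: f_def sublinearD(3)[OF sublinear_hs[OF body]])
    next
      case False
      define v where "v = sgn u"
      define m where "m = hs (convex hull X) v"
      have m: "p \<bullet> v \<le> m" if "p \<in> X" for p
        unfolding m_def inner_commute[of p] using that by (intro inner_le_hs body) (simp add: hull_inc)
      have "\<exists>p\<in>X. p \<bullet> v = m"
      proof -
        have "Max ((\<bullet>) v ` X) \<in> (\<bullet>) v ` X" using X by (intro Max_in) auto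
        then show ?thesis by (auto simp: m_def hs_convex_hull[OF X] inner_commute)
      qed
      then obtain p where p: "p \<in> X" "p \<bullet> v = m" by blast
      have lower: "m \<le> ln (softmax_sum X (real (Suc j)) v) / real (Suc j)" for j
        using inner_le_ln_softmax_sum[OF X(1) p(1), of "real (Suc j)" v] p(2) by simp
      have upper: "ln (softmax_sum X (real (Suc j)) v) / real (Suc j)
          \<le> m + ln (real (card X)) * inverse (real (Suc j))" for j
      proof -
        define b where "b = real (Suc j)"
        have b: "b > 0" by (simp add: b_def)
        have "softmax_sum X b v \<le> (\<Sum>p\<in>X. exp (b * m))"
          unfolding softmax_sum_def using m b by (intro sum_mono) simp
        also have "\<dots> = real (card X) * exp (b * m)" by simp
        finally have "ln (softmax_sum X b v) \<le> ln (real (card X) * exp (b * m))"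
          using X softmax_sum_pos[OF X, of b v] by (subst ln_le_cancel_iff) (auto simp: card_gt_0_iff)
        also have "\<dots> = ln (real (card X)) + b * m"
          using X by (subst ln_mult) (auto simp: card_gt_0_iff)
        finally have "ln (softmax_sum X b v) / b \<le> (ln (real (card X)) + b * m) / b"
          using b by (intro divide_right_mono) auto
        also have "\<dots> = m + ln (real (card X)) * inverse b" using b by (simp add: field_simps)
        finally show ?thesis by (simp add: b_def)
      qed
      have "(\<lambda>j. ln (softmax_sum X (real (Suc j)) v) / real (Suc j)) \<longlonglongrightarrow> m"
      proof (rule LIMSEQ_inverse_bound)
        fix j
        show "\<bar>ln (softmax_sum X (real (Suc j)) v) / real (Suc j) - m\<bar> \<le> ln (real (card X)) * inverse (real (Suc j))"
          using lower[of j] upper[of j] by linarith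
      qed
      then have "(\<lambda>j. f j u) \<longlonglongrightarrow> norm u * m"
        unfolding f_def v_def[symmetric] by (rule tendsto_mult_left)
      moreover have "norm u * m = hs (convex hull X) (norm u *\<^sub>R v)"
        unfolding m_def by (rule sublinearD(2)[OF sublinear_hs[OF body], symmetric]) simp
      moreover have "norm u *\<^sub>R v = u" using False by (simp add: v_def sgn_div_norm)
      ultimately show ?thesis by simp
    qed
  qed
qed

text \<open>Once the zonal functions \<open>norm u (w \<bullet> u / norm u) ^ m\<close> are differences of support functions of
  good bodies, so are the exponentials, which span an algebra, hence the soft maxima of linear
  functions, hence every support function.\<close>

theorem good_all:
  assumes pow: "\<And>w m. norm w = 1 \<Longrightarrow> gf (\<lambda>u. norm u * (w \<bullet> sgn u) ^ m)"
    and K: "K \<in> convex_bodies"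
  shows "good K"
proof -
  \<comment> \<open>\<open>X\<close> is a finite net of mesh \<open>1 / (j + 1)\<close> in
    \<open>K\<close>, so the support function of its hull misses \<open>hs K u\<close> by at most
    \<open>norm u / (j + 1)\<close>.\<close>
  define P where "P j X \<longleftrightarrow> finite X \<and> X \<noteq> {} \<and> X \<subseteq> K \<and> K \<subseteq> (\<Union>x\<in>X. ball x (inverse (real (Suc j))))" for j X
  have "\<exists>X. P j X" for j
  proof -
    obtain X where X: "X \<subseteq> K" "finite X" "K \<subseteq> (\<Union>x\<in>X. ball x (inverse (real (Suc j))))"
    proof (rule compactE_image[OF convex_bodiesD(2)[OF K], of K "\<lambda>x. ball x (inverse (real (Suc j)))"])
      show "K \<subseteq> (\<Union>x\<in>K. ball x (inverse (real (Suc j))))" by force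
    qed auto
    have "X \<noteq> {}"
    proof
      assume "X = {}"
      then have "K \<subseteq> {}" using X(3) by simp
      then show False using convex_bodiesD(1)[OF K] by simp
    qed
    then have "P j X" using X unfolding P_def by simp
    then show ?thesis by (rule exI[of "P j" X])
  qed
  then have "P j (SOME X. P j X)" for j by (rule someI_ex)
  moreover define X where "X j = (SOME X. P j X)" for j
  ultimately have "P j (X j)" for j by simp
  then have X: "finite (X j)" "X j \<noteq> {}" "X j \<subseteq> K"
    "K \<subseteq> (\<Union>x\<in>X j. ball x (inverse (real (Suc j))))" for j unfolding P_def by simp_all
  show ?thesis
  proof (rule good_LIMSEQ[where Ks = "\<lambda>j. convex hull X j"])
    show "good (convex hull X j)" for j by (rule good_convex_hull[OF pow X(1,2)])
    show "K \<in> convex_bodies" by (rule K)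
    fix u
    obtain x where x: "x \<in> K" "hs K u = u \<bullet> x" using hs_attained[OF K] by metis
    have body: "convex hull X j \<in> convex_bodies" for j using X by auto
    have lower: "hs K u - norm u * inverse (real (Suc j)) \<le> hs (convex hull X j) u" for j
    proof -
      obtain p where p: "p \<in> X j" "dist p x < inverse (real (Suc j))" using X(4)[of j] x(1) by auto
      have "u \<bullet> x - u \<bullet> p \<le> norm u * norm (x - p)"
        using norm_cauchy_schwarz[of u "x - p"] by (simp add: inner_diff_right)
      also have "\<dots> \<le> norm u * inverse (real (Suc j))"
        using p(2) by (intro mult_left_mono) (auto simp: dist_norm norm_minus_commute)
      finally have "u \<bullet> x - u \<bullet> p \<le> norm u * inverse (real (Suc j))" .
      moreover have "u \<bullet> p \<le> hs (convex hull X j) u"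
        using p(1) by (intro inner_le_hs body) (simp add: hull_inc)
      ultimately show ?thesis using x(2) by linarith
    qed
    have upper: "hs (convex hull X j) u \<le> hs K u" for j
    proof (rule hs_leI[OF body])
      fix y assume "y \<in> convex hull X j"
      moreover have "convex hull X j \<subseteq> K" by (rule hull_minimal[of "X j" K convex, OF X(3) convex_bodiesD(3)[OF K]])
      ultimately have "y \<in> K" by (rule subsetD[rotated])
      then show "u \<bullet> y \<le> hs K u" by (rule inner_le_hs[OF K])
    qed
    show "(\<lambda>j. hs (convex hull X j) u) \<longlonglongrightarrow> hs K u"
    proof (rule LIMSEQ_inverse_bound)
      fix j
      show "\<bar>hs (convex hull X j) u - hs K u\<bar> \<le> norm u * inverse (real (Suc j))"
        using lower[of j] upper[of j] by linarith
    qed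
  qed
qed

end

section \<open>Integration over the sphere\<close>

text \<open>The double integral of \<open>1\<^sub>A (f x) 1\<^sub>B (y)\<close> is evaluated in two ways, using the translation
  invariance of Lebesgue measure.\<close>

lemma emeasure_lborel_linear_vimage:
  fixes f :: "'a::euclidean_space \<Rightarrow> 'a"
  assumes f: "linear f" "surj f" and A: "A \<in> sets borel" and B: "B \<in> sets borel"
  shows "emeasure lborel (f -` A) * emeasure lborel B
    = emeasure lborel ((\<lambda>x. - f x) -` B) * emeasure lborel A"
proof -
  have fm [measurable]: "f \<in> borel_measurable borel"
    using f(1) by (intro borel_measurable_continuous_onI linear_continuous_on)
      (simp add: linear_conv_bounded_linear)
  note [measurable] = A B
  have shift: "(\<integral>\<^sup>+ y. g y \<partial>lborel) = (\<integral>\<^sup>+ y. g (c + y) \<partial>lborel)"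
    if [measurable]: "g \<in> borel_measurable borel" for g :: "'a \<Rightarrow> ennreal" and c
    by (subst lborel_distr_plus[of c, symmetric]) (simp add: nn_integral_distr)
  have "f -` A \<in> sets borel" "(\<lambda>x. - f x) -` B \<in> sets borel"
    using measurable_sets_borel[OF fm A] measurable_sets_borel[of "\<lambda>x. - f x", OF _ B] by measurable
  moreover have "indicator (f -` A) = (\<lambda>x. indicator A (f x) :: ennreal)"
    "indicator ((\<lambda>x. - f x) -` B) = (\<lambda>x. indicator B (- f x) :: ennreal)"
    by (auto simp: indicator_def)
  ultimately have m: "emeasure lborel (f -` A) = (\<integral>\<^sup>+ x. indicator A (f x) \<partial>lborel)"
    and m': "emeasure lborel ((\<lambda>x. - f x) -` B) = (\<integral>\<^sup>+ x. indicator B (- f x) \<partial>lborel)"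
    using nn_integral_indicator[of "f -` A" lborel] nn_integral_indicator[of "(\<lambda>x. - f x) -` B" lborel]
    by simp_all
  have "emeasure lborel (f -` A) * emeasure lborel B
      = (\<integral>\<^sup>+ x. indicator A (f x) * (\<integral>\<^sup>+ y. indicator B y \<partial>lborel) \<partial>lborel)"
    by (simp add: m nn_integral_multc)
  also have "\<dots> = (\<integral>\<^sup>+ x. (\<integral>\<^sup>+ y. indicator A (f x) * indicator B (- f x + y) \<partial>lborel) \<partial>lborel)"
  proof (rule nn_integral_cong)
    fix x
    have "(\<integral>\<^sup>+ y. indicator B y \<partial>lborel) = (\<integral>\<^sup>+ y. indicator B (- f x + y) \<partial>lborel :: ennreal)"
      by (rule shift) measurable
    moreover have "(\<integral>\<^sup>+ y. indicator A (f x) * indicator B (- f x + y) \<partial>lborel)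
        = indicator A (f x) * (\<integral>\<^sup>+ y. indicator B (- f x + y) \<partial>lborel :: ennreal)"
      by (rule nn_integral_cmult) measurable
    ultimately show "indicator A (f x) * (\<integral>\<^sup>+ y. indicator B y \<partial>lborel)
        = (\<integral>\<^sup>+ y. indicator A (f x) * indicator B (- f x + y) \<partial>lborel :: ennreal)" by simp
  qed
  also have "\<dots> = (\<integral>\<^sup>+ y. (\<integral>\<^sup>+ x. indicator A (f x) * indicator B (- f x + y) \<partial>lborel) \<partial>lborel)"
    by (rule lborel_pair.Fubini') measurable
  \<comment> \<open>Surjectivity enters here: translating \<open>x\<close> by a preimage of
    \<open>y\<close> moves \<open>y\<close> from the argument of \<open>B\<close> to that of
    \<open>A\<close>.\<close>
  also have "\<dots> = (\<integral>\<^sup>+ y. (\<integral>\<^sup>+ x. indicator A (y + f x) * indicator B (- f x) \<partial>lborel) \<partial>lborel)"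
  proof (rule nn_integral_cong)
    fix y
    obtain c where c: "f c = y" using f(2) by (metis surjD)
    show "(\<integral>\<^sup>+ x. indicator A (f x) * indicator B (- f x + y) \<partial>lborel)
        = (\<integral>\<^sup>+ x. indicator A (y + f x) * indicator B (- f x) \<partial>lborel :: ennreal)"
      by (subst shift[of _ c]) (auto simp: linear_add[OF f(1)] c)
  qed
  also have "\<dots> = (\<integral>\<^sup>+ x. (\<integral>\<^sup>+ y. indicator A (y + f x) * indicator B (- f x) \<partial>lborel) \<partial>lborel)"
    by (rule lborel_pair.Fubini'[symmetric]) measurable
  also have "\<dots> = (\<integral>\<^sup>+ x. (\<integral>\<^sup>+ y. indicator A y \<partial>lborel) * indicator B (- f x) \<partial>lborel)"
  proof (rule nn_integral_cong)
    fix x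
    have "(\<integral>\<^sup>+ y. indicator A (y + f x) * indicator B (- f x) \<partial>lborel)
        = (\<integral>\<^sup>+ y. indicator A (y + f x) \<partial>lborel) * (indicator B (- f x) :: ennreal)"
      by (rule nn_integral_multc) measurable
    then show "(\<integral>\<^sup>+ y. indicator A (y + f x) * indicator B (- f x) \<partial>lborel)
        = (\<integral>\<^sup>+ y. indicator A y \<partial>lborel) * (indicator B (- f x) :: ennreal)"
      using shift[of "indicator A" "f x"] by (simp add: add.commute)
  qed
  also have "\<dots> = emeasure lborel A * (\<integral>\<^sup>+ x. indicator B (- f x) \<partial>lborel)"
    by (simp add: nn_integral_cmult)
  finally show ?thesis by (simp add: m' mult.commute)
qed

lemma emeasure_lborel_cball_pos_finite:
  "emeasure lborel (cball (0::'a::euclidean_space) 1) \<noteq> 0" "emeasure lborel (cball (0::'a) 1) \<noteq> \<infinity>"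
proof -
  have "\<not> negligible (cball (0::'a) 1)"
    by (metis negligible_subset open_not_negligible ball_subset_cball open_ball ball_eq_empty not_one_le_zero)
  then show "emeasure lborel (cball (0::'a) 1) \<noteq> 0"
    by (simp add: negligible_iff_emeasure0)
  show "emeasure lborel (cball (0::'a) 1) \<noteq> \<infinity>"
    using emeasure_bounded_finite[of "cball (0::'a) 1"] by simp
qed

text \<open>For \<open>B\<close> the unit ball, which \<open>- f\<close> leaves invariant, the
  volume of the ball cancels from \<open>emeasure_lborel_linear_vimage\<close>.\<close>

lemma emeasure_lborel_orthogonal_vimage:
  fixes f :: "'a::euclidean_space \<Rightarrow> 'a"
  assumes f: "orthogonal_transformation f" and A: "A \<in> sets borel"
  shows "emeasure lborel (f -` A) = emeasure lborel A"
proof -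
  have "(\<lambda>x. - f x) -` cball 0 1 = cball 0 1"
    using f by (auto simp: orthogonal_transformation_norm)
  then have "emeasure lborel (f -` A) * emeasure lborel (cball (0::'a) 1)
      = emeasure lborel (cball (0::'a) 1) * emeasure lborel A"
    using emeasure_lborel_linear_vimage[OF orthogonal_transformation_linear[OF f]
        orthogonal_transformation_surj[OF f] A, of "cball 0 1"] by simp
  then show ?thesis
    using emeasure_lborel_cball_pos_finite[where 'a = 'a]
    unfolding mult.commute[of _ "emeasure lborel (cball (0::'a) 1)"] ennreal_mult_cancel_left by simp
qed

section \<open>The spherical measure and its rotation invariance\<close>

abbreviation SM :: "'a::euclidean_space measure" where
  "SM \<equiv> spherical_measure"

abbreviation SI :: "('a::euclidean_space \<Rightarrow> real) \<Rightarrow> real" where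
  "SI g \<equiv> (\<integral>u. g u \<partial>SM)"

lemma space_SM: "space SM = sphere (0::'a::euclidean_space) 1"
  and sets_SM: "sets SM = sets (restrict_space borel (sphere (0::'a) 1))"
  by (simp_all add: spherical_measure_def space_scale_measure space_restrict_space)

lemma sets_SM_iff: "A \<in> sets SM \<longleftrightarrow> A \<in> sets borel \<and> A \<subseteq> sphere (0::'a::euclidean_space) 1"
  by (auto simp: sets_SM sets_restrict_space)

lemma cone_eq:
  fixes A :: "'a::euclidean_space set"
  assumes "A \<subseteq> sphere 0 1"
  shows "{r *\<^sub>R u |r u. u \<in> A \<and> 0 < r \<and> r \<le> 1} = {x. 0 < norm x \<and> norm x \<le> 1 \<and> sgn x \<in> A}"
proof (intro equalityI subsetI)
  fix x assume "x \<in> {r *\<^sub>R u |r u. u \<in> A \<and> 0 < r \<and> r \<le> 1}"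
  then obtain r u where x: "x = r *\<^sub>R u" "u \<in> A" "0 < r" "r \<le> 1" by blast
  then have "norm u = 1" "u \<noteq> 0" using assms by auto
  then show "x \<in> {x. 0 < norm x \<and> norm x \<le> 1 \<and> sgn x \<in> A}"
    using x by (simp add: sgn_scaleR sgn_div_norm)
next
  fix x assume x: "x \<in> {x. 0 < norm x \<and> norm x \<le> 1 \<and> sgn x \<in> A}"
  then have "x = norm x *\<^sub>R sgn x" by (simp add: sgn_div_norm)
  then show "x \<in> {r *\<^sub>R u |r u. u \<in> A \<and> 0 < r \<and> r \<le> 1}" using x by blast
qed

lemma emeasure_SM:
  fixes A :: "'a::euclidean_space set"
  assumes "A \<in> sets SM"
  shows "emeasure SM A = of_nat DIM('a) * emeasure lborel {x. 0 < norm x \<and> norm x \<le> 1 \<and> sgn x \<in> A}"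
  using assms emeasure_spherical_measure[of A] cone_eq[of A] by (simp add: sets_SM_iff)

lemma cone_borel:
  fixes A :: "'a::euclidean_space set"
  assumes [measurable]: "A \<in> sets borel"
  shows "{x. 0 < norm x \<and> norm x \<le> 1 \<and> sgn x \<in> A} \<in> sets borel"
proof -
  have [measurable]: "(sgn :: 'a \<Rightarrow> 'a) \<in> borel_measurable borel"
    unfolding sgn_div_norm by measurable
  show ?thesis by measurable
qed

lemma emeasure_SM_space:
  "emeasure SM (sphere (0::'a::euclidean_space) 1) = of_nat DIM('a) * emeasure lborel (cball (0::'a) 1)"
proof -
  have "emeasure lborel {x::'a. 0 < norm x \<and> norm x \<le> 1 \<and> sgn x \<in> sphere 0 1}
      = emeasure lborel (cball (0::'a) 1 - {0})"
    by (rule arg_cong[where f = "emeasure lborel"]) (auto simp: norm_sgn)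
  also have "\<dots> = emeasure lborel (cball (0::'a) 1)"
    by (subst emeasure_Diff) auto
  finally show ?thesis by (subst emeasure_SM) (auto simp: sets_SM_iff)
qed

lemma finite_measure_SM: "finite_measure (SM :: 'a::euclidean_space measure)"
proof
  show "emeasure (SM :: 'a measure) (space SM) \<noteq> \<infinity>"
    unfolding space_SM emeasure_SM_space
    using emeasure_lborel_cball_pos_finite(2)[where 'a = 'a] by (simp add: ennreal_mult_eq_top_iff)
qed

interpretation SM: finite_measure "SM :: 'a::euclidean_space measure"
  by (rule finite_measure_SM)

lemma measure_SM_space:
  "measure SM (sphere (0::'a::euclidean_space) 1) = real DIM('a) * measure lebesgue (cball (0::'a) 1)"
  by (simp add: measure_def emeasure_SM_space enn2real_mult)

text \<open>The cone over a preimage under \<open>f\<close> is the preimage of the cone, so the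
  invariance of the spherical measure is that of Lebesgue measure.\<close>

lemma SM_distr:
  fixes f :: "'a::euclidean_space \<Rightarrow> 'a"
  assumes f: "orthogonal_transformation f"
  shows "f \<in> measurable SM SM" "distr SM SM f = SM"
proof -
  have fm: "f \<in> borel_measurable borel"
    using orthogonal_transformation_linear[OF f] by (intro borel_measurable_continuous_onI linear_continuous_on)
      (simp add: linear_conv_bounded_linear)
  have nf: "norm (f x) = norm x" for x using f by (simp add: orthogonal_transformation_norm)
  have f0: "f x = 0 \<longleftrightarrow> x = 0" for x using nf[of x] by (metis norm_eq_zero)
  have sgnf: "sgn (f x) = f (sgn x)" for x
    using f by (simp add: sgn_div_norm nf orthogonal_transformation_scaleR)
  have "f \<in> measurable (restrict_space borel (sphere 0 1)) (restrict_space borel (sphere 0 1))"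
    by (rule measurable_restrict_space3[OF fm]) (auto simp: nf)
  then show meas: "f \<in> measurable SM SM"
    using measurable_cong_sets[OF sets_SM sets_SM] by blast
  show "distr SM SM f = SM"
  proof (rule measure_eqI)
    fix A assume "A \<in> sets (distr SM SM f)"
    then have A: "A \<in> sets SM" by simp
    have B: "f -` A \<inter> space SM \<in> sets SM" using measurable_sets[OF meas A] .
    have "{x. 0 < norm x \<and> norm x \<le> 1 \<and> sgn x \<in> f -` A \<inter> space SM}
        = f -` {x. 0 < norm x \<and> norm x \<le> 1 \<and> sgn x \<in> A}"
      by (auto simp: space_SM nf f0 sgnf norm_sgn)
    moreover have "{x. 0 < norm x \<and> norm x \<le> 1 \<and> sgn x \<in> A} \<in> sets borel"
      using A by (simp only: cone_borel sets_SM_iff)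
    ultimately have "emeasure SM (f -` A \<inter> space SM) = emeasure SM A"
      unfolding emeasure_SM[OF A] emeasure_SM[OF B]
      by (simp only: emeasure_lborel_orthogonal_vimage[OF f])
    then show "emeasure (distr SM SM f) A = emeasure SM A"
      by (subst emeasure_distr[OF meas A])
  qed simp
qed

lemma SM_measurable:
  fixes g :: "'a::euclidean_space \<Rightarrow> 'b::{real_normed_vector,second_countable_topology}"
  assumes "continuous_on (sphere 0 1) g"
  shows "g \<in> borel_measurable SM"
  using borel_measurable_continuous_on_restrict[OF assms] measurable_cong_sets[OF sets_SM refl] by blast

lemma SM_integrable:
  fixes g :: "'a::euclidean_space \<Rightarrow> 'b::{banach,second_countable_topology}"
  assumes "continuous_on (sphere 0 1) g"
  shows "integrable SM g"
proof -
  have "bounded (g ` sphere 0 1)"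
    by (intro compact_imp_bounded compact_continuous_image assms) simp
  then obtain B where "\<And>x. x \<in> sphere 0 1 \<Longrightarrow> norm (g x) \<le> B" unfolding bounded_iff by blast
  then have "AE x in SM. norm (g x) \<le> B" by (intro AE_I2) (simp add: space_SM)
  then show ?thesis by (rule SM.integrable_const_bound[OF _ SM_measurable[OF assms]])
qed

lemma SI_cong: "(\<And>u. norm u = 1 \<Longrightarrow> f u = g u) \<Longrightarrow> SI f = SI g"
  by (rule Bochner_Integration.integral_cong) (auto simp: space_SM)

lemma SI_orthogonal:
  fixes f :: "'a::euclidean_space \<Rightarrow> 'a" and g :: "'a \<Rightarrow> 'b::{banach,second_countable_topology}"
  assumes f: "orthogonal_transformation f" and g: "continuous_on (sphere 0 1) g"
  shows "(\<integral>x. g (f x) \<partial>SM) = (\<integral>x. g x \<partial>SM)"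
  using integral_distr[OF SM_distr(1)[OF f] SM_measurable[OF g]] by (simp add: SM_distr(2)[OF f])

lemma SI_mono:
  assumes "continuous_on (sphere 0 1) f" "continuous_on (sphere 0 1) g"
    "\<And>u. norm u = 1 \<Longrightarrow> f u \<le> g u"
  shows "SI f \<le> SI g"
  using assms by (intro integral_mono SM_integrable) (auto simp: space_SM)

lemma SI_nonneg: "(\<And>u. norm u = 1 \<Longrightarrow> 0 \<le> f u) \<Longrightarrow> 0 \<le> SI f"
  by (intro Bochner_Integration.integral_nonneg_AE AE_I2) (auto simp: space_SM)

text \<open>If the integral vanished, \<open>g\<close> would vanish almost everywhere; but the cone
  over the set where it is nonzero contains a nonempty open set.\<close>

lemma SI_pos:
  fixes g :: "'a::euclidean_space \<Rightarrow> real"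
  assumes g: "continuous_on (sphere 0 1) g" and nn: "\<And>u. norm u = 1 \<Longrightarrow> 0 \<le> g u"
    and u: "norm u = 1" "0 < g u"
  shows "0 < SI g"
proof (rule ccontr)
  assume "\<not> 0 < SI g"
  moreover have "0 \<le> SI g" by (rule SI_nonneg[OF nn])
  ultimately have "SI g = 0" by simp
  then have ae: "AE x in SM. g x = 0"
  proof -
    have "AE x in SM. 0 \<le> g x" by (intro AE_I2) (simp add: space_SM nn)
    then show ?thesis using integral_nonneg_eq_0_iff_AE[OF SM_integrable[OF g]] \<open>SI g = 0\<close> by simp
  qed
  define A where "A = {x \<in> sphere 0 1. g x \<noteq> 0}"
  have A: "A \<in> sets SM"
proof -
    have "{x \<in> space SM. g x \<noteq> 0} \<in> sets SM"
      using SM_measurable[OF g] by measurable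
    then show ?thesis by (simp add: A_def space_SM)
  qed
  have "emeasure SM A = 0"
    using ae A by (subst (asm) AE_iff_measurable[of A]) (auto simp: A_def space_SM)
  then have z: "emeasure lborel {x. 0 < norm x \<and> norm x \<le> 1 \<and> sgn x \<in> A} = 0"
    by (simp add: emeasure_SM[OF A])
  define U where "U = {x. 0 < norm x \<and> norm x < 1 \<and> g (sgn x) \<noteq> 0}"
  have "open U"
  proof -
    have V: "open (ball 0 1 - {0::'a})" by auto
    have c: "continuous_on (ball 0 1 - {0::'a}) (\<lambda>x. g (sgn x))"
      by (rule continuous_on_compose2[OF g]) (auto intro!: continuous_intros continuous_on_sgn simp: norm_sgn split: if_splits)
    have "U = (ball 0 1 - {0}) \<inter> (\<lambda>x. g (sgn x)) -` (- {0})" by (auto simp: U_def)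
    then show ?thesis
      using continuous_on_open_vimage[OF V, of "\<lambda>x. g (sgn x)"] c
      by (metis Int_commute open_Compl closed_singleton)
  qed
  moreover have "(1/2) *\<^sub>R u \<in> U"
  proof -
    have "u \<noteq> 0" "sgn u = u" using u(1) by (auto simp: sgn_div_norm)
    then show ?thesis using u by (simp add: U_def sgn_scaleR)
  qed
  ultimately have "\<not> negligible U" using open_not_negligible by blast
  have "U \<subseteq> {x. 0 < norm x \<and> norm x \<le> 1 \<and> sgn x \<in> A}"
  proof
    fix x assume "x \<in> U"
    then show "x \<in> {x. 0 < norm x \<and> norm x \<le> 1 \<and> sgn x \<in> A}"
      by (simp add: U_def A_def norm_sgn)
  qed
  moreover have "negligible {x. 0 < norm x \<and> norm x \<le> 1 \<and> sgn x \<in> A}"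
  proof -
    have "{x. 0 < norm x \<and> norm x \<le> 1 \<and> sgn x \<in> A} \<in> null_sets lborel"
      using z A unfolding sets_SM_iff null_sets_def by (simp only: cone_borel sets_lborel mem_Collect_eq)
    then show ?thesis by (simp only: negligible_iff_null_sets null_sets_completionI)
  qed
  ultimately have "negligible U" using negligible_subset by blast
  with \<open>\<not> negligible U\<close> show False by blast
qed

text \<open>Riemann sums with nonnegative weights and the same nodes for all continuous integrands.
  They turn averages of bodies into limits of finite Minkowski combinations. The nodes are the
  values of simple functions tending to the identity, projected to the sphere.\<close>

lemma SM_discrete_approximation:
  obtains F :: "nat \<Rightarrow> 'a::euclidean_space set" and c :: "nat \<Rightarrow> 'a \<Rightarrow> real" where
    "\<And>j. finite (F j)" "\<And>j. F j \<subseteq> sphere 0 1" "\<And>j p. 0 \<le> c j p"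
    "\<And>g. continuous_on (sphere 0 1) g \<Longrightarrow> (\<lambda>j. \<Sum>p\<in>F j. c j p * g p) \<longlonglongrightarrow> SI g"
proof -
  have "(\<lambda>x::'a. x) \<in> borel_measurable SM" by (rule SM_measurable) simp
  from borel_measurable_implies_sequence_metric[OF this]
  obtain s :: "nat \<Rightarrow> 'a \<Rightarrow> 'a" where s: "\<And>i. simple_function SM (s i)"
    "\<And>x. x \<in> space SM \<Longrightarrow> (\<lambda>i. s i x) \<longlonglongrightarrow> x" by blast
  define e :: 'a where "e = (SOME b. b \<in> Basis)"
  have e: "norm e = 1" unfolding e_def by (rule norm_Basis[OF SOME_Basis])
  \<comment> \<open>The value \<open>0\<close> has no direction; it is sent to the fixed unit vector
    \<open>e\<close>, and at each point of the sphere it occurs only finitely often.\<close>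
  define r where "r i x = (if s i x = 0 then e else sgn (s i x))" for i x
  have r_simple: "simple_function SM (r i)" for i
    unfolding r_def by (rule simple_function_compose1[OF s(1), where g = "\<lambda>y. if y = 0 then e else sgn y"])
  have r_sphere: "norm (r i x) = 1" for i x using e by (simp add: r_def norm_sgn)
  have r_lim: "(\<lambda>i. r i x) \<longlonglongrightarrow> x" if "norm x = 1" for x
  proof -
    have lim: "(\<lambda>i. s i x) \<longlonglongrightarrow> x" using s(2) that by (simp add: space_SM)
    have "x \<noteq> 0" using that by auto
    then have "eventually (\<lambda>i. s i x \<noteq> 0) sequentially"
      using tendsto_imp_eventually_ne[OF lim] by blast
    then have ev: "eventually (\<lambda>i. sgn (s i x) = r i x) sequentially"
      by eventually_elim (simp add: r_def)
    have "(\<lambda>i. sgn (s i x)) \<longlonglongrightarrow> sgn x" by (rule tendsto_sgn[OF lim \<open>x \<noteq> 0\<close>])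
    then have "(\<lambda>i. r i x) \<longlonglongrightarrow> sgn x" by (rule Lim_transform_eventually[OF _ ev])
    then show ?thesis using that by (simp add: sgn_div_norm)
  qed
  define F where "F i = r i ` space SM" for i
  define c where "c i p = measure SM (r i -` {p} \<inter> space SM)" for i p
  show thesis
  proof (rule that[of F c])
    show "finite (F j)" for j unfolding F_def by (rule simple_functionD(1)[OF r_simple])
    then have finF: "finite (F j)" for j .
    show "F j \<subseteq> sphere 0 1" for j unfolding F_def using r_sphere by auto
    show "0 \<le> c j p" for j p by (simp add: c_def)
    fix g :: "'a \<Rightarrow> real" assume g: "continuous_on (sphere 0 1) g"
    have "(\<lambda>j. SI (\<lambda>x. g (r j x))) \<longlonglongrightarrow> SI g"
    proof -
      have "bounded (g ` sphere 0 1)"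
        by (intro compact_imp_bounded compact_continuous_image g) simp
      then obtain B where B: "\<And>x. x \<in> sphere 0 1 \<Longrightarrow> norm (g x) \<le> B" unfolding bounded_iff by blast
      show ?thesis
      proof (rule integral_dominated_convergence[where w = "\<lambda>_. B"])
        show "g \<in> borel_measurable SM" by (rule SM_measurable[OF g])
        show "(\<lambda>x. g (r i x)) \<in> borel_measurable SM" for i
          by (rule borel_measurable_simple_function[OF simple_function_compose1[OF r_simple]])
        show "AE x in SM. (\<lambda>i. g (r i x)) \<longlonglongrightarrow> g x"
        proof (intro AE_I2)
          fix x :: 'a assume "x \<in> space SM"
          then have x: "norm x = 1" by (simp add: space_SM)
          show "(\<lambda>i. g (r i x)) \<longlonglongrightarrow> g x"
            by (rule continuous_on_tendsto_compose[OF g r_lim[OF x]]) (auto simp: x r_sphere)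
        qed
        show "AE x in SM. norm (g (r i x)) \<le> B" for i
          by (intro AE_I2 B) (simp add: r_sphere)
      qed simp
    qed
    moreover have "SI (\<lambda>x. g (r j x)) = (\<Sum>p\<in>F j. c j p * g p)" for j
    proof -
      have meas: "r j -` {p} \<inter> space SM \<in> sets SM" for p
        by (rule simple_functionD(2)[OF r_simple])
      have "SI (\<lambda>x. g (r j x)) = SI (\<lambda>x. \<Sum>p\<in>F j. indicator (r j -` {p} \<inter> space SM) x * g p)"
      proof (rule SI_cong)
        fix u :: 'a assume "norm u = 1"
        then have u: "u \<in> space SM" by (simp add: space_SM)
        have "(\<Sum>p\<in>F j. indicator (r j -` {p} \<inter> space SM) u * g p)
            = (\<Sum>p\<in>F j. if p = r j u then g p else 0)"
          using u by (intro sum.cong) (auto simp: indicator_def)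
        also have "\<dots> = g (r j u)" using finF[of j] u by (simp add: F_def)
        finally show "g (r j u) = (\<Sum>p\<in>F j. indicator (r j -` {p} \<inter> space SM) u * g p)" ..
      qed
      also have "\<dots> = (\<Sum>p\<in>F j. SI (\<lambda>x. indicator (r j -` {p} \<inter> space SM) x * g p))"
        by (intro Bochner_Integration.integral_sum Bochner_Integration.integrable_mult_left
            integrable_real_indicator meas) (simp add: less_top[symmetric])
      also have "\<dots> = (\<Sum>p\<in>F j. c j p * g p)"
        using meas by (intro sum.cong refl) (simp add: c_def less_top[symmetric])
      finally show ?thesis .
    qed
    ultimately show "(\<lambda>j. \<Sum>p\<in>F j. c j p * g p) \<longlonglongrightarrow> SI g" by simp
  qed
qed


subsection \<open>Zonal moments\<close>

text \<open>The reflection at the hyperplane orthogonal to \<open>a\<close>. For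
  \<open>a = 0\<close> it is the identity, so for vectors of equal norm
  \<open>householder (x - y)\<close> takes \<open>x\<close> to \<open>y\<close> also when they
  coincide.\<close>

definition householder :: "'a::real_inner \<Rightarrow> 'a \<Rightarrow> 'a" where
  "householder a x = x - (2 * (a \<bullet> x) / (a \<bullet> a)) *\<^sub>R a"

lemma orthogonal_householder: "orthogonal_transformation (householder a)"
  unfolding orthogonal_transformation_def
proof (intro conjI allI)
  show "linear (householder a)"
    by (rule linearI) (simp_all add: householder_def inner_add_right algebra_simps add_divide_distrib)
  show "householder a v \<bullet> householder a w = v \<bullet> w" for v w
  proof (cases "a = 0")
    case False
    define c where "c = 2 / (a \<bullet> a)"
    have c: "c * (a \<bullet> a) = 2" using False by (simp add: c_def)
    have h: "householder a x = x - (c * (a \<bullet> x)) *\<^sub>R a" for x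
      by (simp add: householder_def c_def)
    have "householder a v \<bullet> householder a w
        = v \<bullet> w - c * (a \<bullet> v) * (a \<bullet> w) - c * (a \<bullet> w) * (v \<bullet> a - c * (a \<bullet> v) * (a \<bullet> a))"
      unfolding h inner_diff_left inner_diff_right inner_scaleR_left inner_scaleR_right ..
    also have "c * (a \<bullet> v) * (a \<bullet> a) = (a \<bullet> v) * (c * (a \<bullet> a))"
      by (simp only: mult_ac)
    finally show ?thesis unfolding c inner_commute[of v a] by (simp add: algebra_simps)
  qed (simp add: householder_def)
qed

lemma householder_orthogonal: "a \<bullet> x = 0 \<Longrightarrow> householder a x = x"
  by (simp add: householder_def)

lemma householder_diff:
  assumes "norm x = norm y"
  shows "householder (x - y) x = y"
proof (cases "x = y")
  case False
  have eq: "x \<bullet> x = y \<bullet> y" using assms by (simp add: norm_eq)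
  then have eq2: "2 * ((x - y) \<bullet> x) = (x - y) \<bullet> (x - y)"
    by (simp add: inner_diff_left inner_diff_right inner_commute)
  have "(x - y) \<bullet> (x - y) \<noteq> 0" using False by simp
  then have "2 * ((x - y) \<bullet> x) / ((x - y) \<bullet> (x - y)) = 1" unfolding eq2 by (rule divide_self)
  then show ?thesis unfolding householder_def by (simp only: scaleR_one diff_diff_eq2 add_diff_cancel_left')
qed (simp add: householder_def)

text \<open>Two reflections suffice: one takes \<open>v\<close> to \<open>v'\<close>, the other
  takes the image of \<open>z\<close> to \<open>z'\<close> and fixes \<open>v'\<close>, which is
  orthogonal to both.\<close>

lemma orthonormal_pairs_congruent:
  fixes v z v' z' :: "'a::euclidean_space"
  assumes "orthonormal v z" "orthonormal v' z'"
  shows "\<exists>f. orthogonal_transformation f \<and> f v = v' \<and> f z = z'"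
proof -
  define g where "g = householder (v - v')"
  have g: "orthogonal_transformation g" "g v = v'"
    using assms by (auto simp: g_def orthogonal_householder intro!: householder_diff simp: orthonormal_def)
  define h where "h = householder (g z - z')"
  have n: "norm (g z) = norm z'"
    using assms g by (simp add: orthonormal_def orthogonal_transformation_norm)
  have "g v \<bullet> g z = v \<bullet> z" using g(1) by (simp add: orthogonal_transformation_def)
  then have "v' \<bullet> g z = 0" using assms g(2) by (simp add: orthonormal_def)
  then have "h v' = v'"
    unfolding h_def using assms(2) by (intro householder_orthogonal)
      (simp add: orthonormal_def inner_diff_left inner_diff_right inner_commute[of _ v'])
  moreover have "h (g z) = z'" unfolding h_def by (rule householder_diff[OF n])
  moreover have "orthogonal_transformation (h \<circ> g)"
    unfolding h_def by (intro orthogonal_transformation_compose orthogonal_householder g(1))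
  ultimately show ?thesis using g(2) by (intro exI[of _ "h \<circ> g"]) simp
qed

text \<open>Reduces zonal integrals to a fixed orthonormal pair; comparison with a pair in which a
  sign is changed makes odd moments vanish.\<close>

lemma SI_orthonormal_pair:
  fixes F :: "real \<Rightarrow> real \<Rightarrow> real" and v z v' z' :: "'a::euclidean_space"
  assumes on: "orthonormal v z" "orthonormal v' z'" and F: "continuous_on UNIV (\<lambda>(s, t). F s t)"
  shows "SI (\<lambda>x. F (x \<bullet> v) (x \<bullet> z)) = SI (\<lambda>x. F (x \<bullet> v') (x \<bullet> z'))"
proof -
  obtain f where f: "orthogonal_transformation f" "f v = v'" "f z = z'"
    using orthonormal_pairs_congruent[OF on] by blast
  have c: "continuous_on (sphere 0 1) (\<lambda>x. F (x \<bullet> v') (x \<bullet> z'))"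
  proof -
    have "continuous_on (sphere 0 1) (\<lambda>x. (x \<bullet> v', x \<bullet> z'))" by (intro continuous_intros)
    from continuous_on_compose2[OF F this] show ?thesis by simp
  qed
  have "f x \<bullet> v' = x \<bullet> v" "f x \<bullet> z' = x \<bullet> z" for x
    using f by (auto simp: orthogonal_transformation_def)
  then show ?thesis using SI_orthogonal[OF f(1) c] by simp
qed

lemma exists_orthonormal:
  assumes "norm (v :: 'a::euclidean_space) = 1" "DIM('a) \<ge> 2"
  obtains z where "orthonormal v z"
  using exists_orthonormal_decomp[OF assms] by metis

text \<open>Mixed moments vanish by a change of sign, the squares have the same integral for all
  unit vectors, and over a basis they add up to the total mass \<open>n V(B)\<close>. This is why
  the factor \<open>1 / V(B)\<close> makes the Steiner point reproduce points.\<close>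

lemma SI_inner_inner:
  fixes s t :: "'a::euclidean_space"
  assumes dim: "DIM('a) \<ge> 2"
  shows "SI (\<lambda>x. (x \<bullet> s) * (x \<bullet> t)) = measure lebesgue (cball (0::'a) 1) * (s \<bullet> t)"
proof -
  have c1: "continuous_on UNIV (\<lambda>(s, t). s * s :: real)" "continuous_on UNIV (\<lambda>(s, t). s * t :: real)"
    unfolding case_prod_unfold by (auto intro!: continuous_intros)
  have same: "SI (\<lambda>x. (x \<bullet> v) * (x \<bullet> v)) = SI (\<lambda>x. (x \<bullet> w) * (x \<bullet> w))"
    if vw: "norm v = 1" "norm w = 1" for v w :: 'a
  proof -
    obtain z z' where "orthonormal v z" "orthonormal w z'"
      using exists_orthonormal[OF vw(1) dim] exists_orthonormal[OF vw(2) dim] by metis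
    then show ?thesis using SI_orthonormal_pair[OF _ _ c1(1)] by blast
  qed
  have orth: "SI (\<lambda>x. (x \<bullet> v) * (x \<bullet> z)) = 0" if "orthonormal v z" for v z :: 'a
    using SI_orthonormal_pair[OF that orthonormal_minus[OF that] c1(2)] by simp
  have int: "integrable SM (\<lambda>x. (x \<bullet> v) * (x \<bullet> w))" for v w :: 'a
    by (intro SM_integrable continuous_intros)
  have unit: "SI (\<lambda>x. (x \<bullet> v) * (x \<bullet> v)) = measure lebesgue (cball (0::'a) 1)" if v: "norm v = 1" for v :: 'a
  proof -
    have "real DIM('a) * SI (\<lambda>x. (x \<bullet> v) * (x \<bullet> v)) = (\<Sum>b\<in>Basis. SI (\<lambda>x. (x \<bullet> b) * (x \<bullet> (b::'a))))"
      using same[OF _ v] by simp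
    also have "\<dots> = SI (\<lambda>x. \<Sum>b\<in>Basis. (x \<bullet> b) * (x \<bullet> (b::'a)))"
      by (rule Bochner_Integration.integral_sum[symmetric]) (rule int)
    also have "\<dots> = SI (\<lambda>x::'a. 1)"
    proof (rule SI_cong)
      fix u :: 'a assume "norm u = 1"
      then show "(\<Sum>b\<in>Basis. (u \<bullet> b) * (u \<bullet> b)) = 1"
        using euclidean_inner[of u u] by (simp add: dot_square_norm)
    qed
    also have "\<dots> = real DIM('a) * measure lebesgue (cball (0::'a) 1)"
      by (simp add: space_SM measure_SM_space)
    finally show ?thesis by simp
  qed
  show ?thesis
  proof (cases "t = 0")
    case False
    define a where "a = sgn t"
    have a: "norm a = 1" "t = norm t *\<^sub>R a" using False by (auto simp: a_def norm_sgn sgn_div_norm)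
    obtain b q where b: "orthonormal a b" "s = (a \<bullet> s) *\<^sub>R a + q *\<^sub>R b"
      using exists_orthonormal_decomp[OF a(1) dim, of s] by metis
    have "(x \<bullet> s) * (x \<bullet> t) = norm t * ((a \<bullet> s) * ((x \<bullet> a) * (x \<bullet> a)) + q * ((x \<bullet> b) * (x \<bullet> a)))" for x
      by (subst b(2), subst a(2)) (simp add: inner_add_right algebra_simps)
    then have "SI (\<lambda>x. (x \<bullet> s) * (x \<bullet> t))
        = norm t * ((a \<bullet> s) * SI (\<lambda>x. (x \<bullet> a) * (x \<bullet> a)) + q * SI (\<lambda>x. (x \<bullet> b) * (x \<bullet> a)))"
      by (simp add: int)
    also have "\<dots> = norm t * ((a \<bullet> s) * measure lebesgue (cball (0::'a) 1))"
      by (simp add: unit[OF a(1)] orth[OF orthonormal_sym[OF b(1)]])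
    also have "\<dots> = measure lebesgue (cball (0::'a) 1) * (norm t * (a \<bullet> s))" by (simp only: mult_ac)
    also have "norm t * (a \<bullet> s) = s \<bullet> t" using a(2) by (metis inner_commute inner_scaleR_right)
    finally show ?thesis .
  qed simp
qed

text \<open>In terms of bodies: the average over the sphere of the segments from \<open>- x\<close>
  to \<open>x\<close> is a ball.\<close>

lemma SI_abs_inner:
  fixes v :: "'a::euclidean_space"
  assumes dim: "DIM('a) \<ge> 2"
  obtains C where "0 < C" "\<And>v::'a. SI (\<lambda>x. \<bar>x \<bullet> v\<bar>) = C * norm v"
proof -
  define v0 :: 'a where "v0 = (SOME b. b \<in> Basis)"
  have v0: "norm v0 = 1" unfolding v0_def by (rule norm_Basis[OF SOME_Basis])
  obtain z0 where z0: "orthonormal v0 z0" using exists_orthonormal[OF v0 dim] by metis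
  have cF: "continuous_on UNIV (\<lambda>(s, t::real). \<bar>s\<bar> :: real)"
    unfolding case_prod_unfold by (auto intro!: continuous_intros)
  show thesis
  proof (rule that[of "SI (\<lambda>x. \<bar>x \<bullet> v0\<bar>)"])
    show "0 < SI (\<lambda>x. \<bar>x \<bullet> v0\<bar>)"
      by (rule SI_pos[of _ v0]) (auto intro!: continuous_intros simp: v0 dot_square_norm)
    fix v :: 'a
    show "SI (\<lambda>x. \<bar>x \<bullet> v\<bar>) = SI (\<lambda>x. \<bar>x \<bullet> v0\<bar>) * norm v"
    proof (cases "v = 0")
      case False
      define u where "u = sgn v"
      have u: "norm u = 1" "v = norm v *\<^sub>R u" using False by (auto simp: u_def norm_sgn sgn_div_norm)
      obtain z where z: "orthonormal u z" using exists_orthonormal[OF u(1) dim] by metis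
      have "SI (\<lambda>x. \<bar>x \<bullet> v\<bar>) = SI (\<lambda>x. norm v * \<bar>x \<bullet> u\<bar>)"
        by (subst u(2)) (simp add: abs_mult)
      then show ?thesis using SI_orthonormal_pair[OF z z0 cF] by simp
    qed simp
  qed
qed

text \<open>The odd part of \<open>max t s\<close> is convex on the positive axis, hence superadditive there.\<close>

lemma soft_threshold_sum:
  fixes p q r s :: real
  assumes "p + q + r = 0" "0 \<le> s"
  shows "0 \<le> ((max p s - max (- p) s) + (max q s - max (- q) s) + (max r s - max (- r) s)) * (p * q * r)"
proof -
  have core: "0 \<le> ((max p s - max (- p) s) + (max q s - max (- q) s) + (max r s - max (- r) s)) * (p * q * r)"
    if "p + q + r = 0" "p \<le> 0 \<and> q \<le> 0 \<or> p \<ge> 0 \<and> q \<ge> 0" for p q r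
  proof -
    define S where "S = (max p s - max (- p) s) + (max q s - max (- q) s) + (max r s - max (- r) s)"
    have "0 \<le> S \<and> 0 \<le> r \<or> S \<le> 0 \<and> r \<le> 0"
      using that assms(2) unfolding S_def by (auto simp: max_def)
    then have "0 \<le> S * r" by (simp add: zero_le_mult_iff)
    moreover have "0 \<le> p * q" using that(2) by (simp add: zero_le_mult_iff) blast
    ultimately have "0 \<le> (p * q) * (S * r)" by (rule mult_nonneg_nonneg[rotated])
    then show ?thesis unfolding S_def[symmetric] by (simp only: mult_ac)
  qed
  \<comment> \<open>Two of three reals share a sign; \<open>core\<close> applies to these two, and
    the third is minus their sum.\<close>
  consider "p \<le> 0 \<and> q \<le> 0 \<or> p \<ge> 0 \<and> q \<ge> 0" | "p \<le> 0 \<and> r \<le> 0 \<or> p \<ge> 0 \<and> r \<ge> 0"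
    | "q \<le> 0 \<and> r \<le> 0 \<or> q \<ge> 0 \<and> r \<ge> 0" by linarith
  then show ?thesis
  proof cases
    case 1
    then show ?thesis using core assms(1) by blast
  next
    case 2
    have "p + r + q = 0" using assms(1) by simp
    from core[OF this 2] show ?thesis by (simp only: mult_ac add_ac)
  next
    case 3
    have "q + r + p = 0" using assms(1) by simp
    from core[OF this 3] show ?thesis by (simp only: mult_ac add_ac)
  qed
qed

lemma continuous_on_SI_max:
  fixes v :: "'a::euclidean_space"
  assumes "continuous_on S f"
  shows "continuous_on S (\<lambda>x. SI (\<lambda>y. max (f x) \<bar>y \<bullet> v\<bar>))"
proof -
  define k where "k t = SI (\<lambda>y. max t \<bar>y \<bullet> v\<bar>)" for t
  define m where "m = SI (\<lambda>y::'a. 1)"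
  have m: "0 \<le> m" unfolding m_def by (rule SI_nonneg) simp
  have int: "integrable SM (\<lambda>y. max t \<bar>y \<bullet> v\<bar>)" for t
    by (intro SM_integrable continuous_intros)
  have k_le: "k t \<le> k s + m * \<bar>t - s\<bar>" for s t
  proof -
    have "k t \<le> SI (\<lambda>y. max s \<bar>y \<bullet> v\<bar> + 1 * \<bar>t - s\<bar>)"
      unfolding k_def by (rule SI_mono) (auto intro!: continuous_intros)
    also have "\<dots> = k s + m * \<bar>t - s\<bar>"
      unfolding k_def m_def by (subst Bochner_Integration.integral_add) (auto intro: int SM_integrable)
    finally show ?thesis .
  qed
  have k_lip: "m-lipschitz_on (UNIV :: real set) k"
  proof (rule lipschitz_onI[OF _ m])
    show "dist (k s) (k t) \<le> m * dist s t" for s t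
      using k_le[of s t] k_le[of t s] by (simp add: dist_real_def abs_le_iff abs_minus_commute)
  qed
  show ?thesis
    using continuous_on_compose2[OF lipschitz_on_continuous_on[OF k_lip] assms] by (simp add: k_def)
qed

text \<open>The left side is the support function of an average of triangles, and the point is
  \<open>0 < A\<close>: it has a genuine cubic part. With
  \<open>e = c *\<^sub>R u + d *\<^sub>R z\<close>, where \<open>u\<close> is the direction of
  \<open>v\<close>, odd powers of the \<open>z\<close>-coordinate integrate to zero and
  \<open>d * d = 1 - c * c\<close> leaves the powers \<open>c ^ 3\<close> and \<open>c\<close>, so
  that \<open>A = N F30 - 3 * N F12\<close>. For the sign, \<open>t ^ 3 - 3 * t * s\<^sup>2\<close>
  is invariant under rotation by a third of a turn, so \<open>k\<close> may be averaged over three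
  directions whose coordinates add up to zero; \<open>soft_threshold_sum\<close> then makes the
  integrand nonnegative.\<close>

lemma SI_zonal_cubic:
  assumes dim: "DIM('a::euclidean_space) \<ge> 2"
  obtains A B C :: real where "0 < A"
    "\<And>e v :: 'a. norm e = 1 \<Longrightarrow> SI (\<lambda>x. (1 + (e \<bullet> x) ^ 3) * SI (\<lambda>y. max (x \<bullet> v) \<bar>y \<bullet> v\<bar>))
      = C * norm v + A * ((e \<bullet> v) ^ 3 / (norm v)\<^sup>2) + B * (e \<bullet> v)"
proof -
  define v0 :: 'a where "v0 = (SOME b. b \<in> Basis)"
  have v0: "norm v0 = 1" unfolding v0_def by (rule norm_Basis[OF SOME_Basis])
  obtain z0 where z0: "orthonormal v0 z0" using exists_orthonormal[OF v0 dim] by metis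
  define k where "k t = SI (\<lambda>y. max t \<bar>y \<bullet> v0\<bar>)" for t
  have cmax: "continuous_on S (\<lambda>y. max t \<bar>y \<bullet> v\<bar>)" for S t and v :: 'a
    by (intro continuous_intros)
  have int: "integrable SM (\<lambda>y. max t \<bar>y \<bullet> v\<bar>)" for t and v :: 'a
    by (rule SM_integrable[OF cmax])
  have ck [continuous_intros]: "continuous_on S (\<lambda>x. k (f x))" if "continuous_on S f" for S and f :: "'b::topological_space \<Rightarrow> real"
    unfolding k_def by (rule continuous_on_SI_max[OF that])
  define N where "N F = SI (\<lambda>x. F (x \<bullet> v0) (x \<bullet> z0))" for F
  have N_pair: "SI (\<lambda>x. F (x \<bullet> v) (x \<bullet> z)) = N F"
    if "orthonormal v z" "continuous_on UNIV (\<lambda>(s, t). F s t)" for F and v z :: 'a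
    unfolding N_def by (rule SI_orthonormal_pair[OF that(1) z0 that(2)])
  have cN: "integrable SM (\<lambda>x. F (x \<bullet> v0) (x \<bullet> z0))" if "continuous_on UNIV (\<lambda>(s, t). F s t)" for F :: "real \<Rightarrow> real \<Rightarrow> real"
  proof (rule SM_integrable)
    have "continuous_on (sphere 0 1) (\<lambda>x. (x \<bullet> v0, x \<bullet> z0))" by (intro continuous_intros)
    from continuous_on_compose2[OF that this] show "continuous_on (sphere 0 1) (\<lambda>x. F (x \<bullet> v0) (x \<bullet> z0))" by simp
  qed
  define F30 where "F30 = (\<lambda>t s :: real. t ^ 3 * k t)"
  define F21 where "F21 = (\<lambda>t s :: real. t\<^sup>2 * s * k t)"
  define F12 where "F12 = (\<lambda>t s :: real. t * s\<^sup>2 * k t)"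
  define F03 where "F03 = (\<lambda>t s :: real. s ^ 3 * k t)"
  define F00 where "F00 = (\<lambda>t s :: real. k t)"
  have cF: "continuous_on UNIV (\<lambda>(s, t). F30 s t)" "continuous_on UNIV (\<lambda>(s, t). F21 s t)"
    "continuous_on UNIV (\<lambda>(s, t). F12 s t)" "continuous_on UNIV (\<lambda>(s, t). F03 s t)"
    "continuous_on UNIV (\<lambda>(s, t). F00 s t)"
    unfolding F30_def F21_def F12_def F03_def F00_def case_prod_unfold
    by (auto intro!: continuous_intros)
  have odd: "N F = 0" if "continuous_on UNIV (\<lambda>(s, t). F s t)" "\<And>t s. F t (- s) = - F t s" for F :: "real \<Rightarrow> real \<Rightarrow> real"
  proof -
    have "N F = SI (\<lambda>x. F (x \<bullet> v0) (x \<bullet> (- z0)))"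
      by (rule N_pair[OF orthonormal_minus[OF z0] that(1), symmetric])
    also have "\<dots> = - N F" by (simp add: N_def that(2))
    finally show ?thesis by simp
  qed
  have odd1: "N F21 = 0" by (rule odd[OF cF(2)]) (simp add: F21_def)
  have odd3: "N F03 = 0" by (rule odd[OF cF(4)]) (simp add: F03_def)
  define A where "A = N F30 - 3 * N F12"
  \<comment> \<open>\<open>w\<close> is the sine of a third of a turn; \<open>Q t s\<close> is the
    product of \<open>t\<close> with its two rotates, named \<open>P t s\<close> and
    \<open>P' t s\<close> below.\<close>
  define w where "w = sqrt 3 / 2"
  have w: "w * w = 3 / 4" by (simp add: w_def)
  define Q where "Q t s = t * (- t / 2 + w * s) * (- t / 2 - w * s)" for t s
  have Q4: "4 * Q t s = t ^ 3 - 3 * t * s\<^sup>2" for t s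
  proof -
    have "4 * Q t s = t ^ 3 - 4 * (w * w) * (t * s\<^sup>2)"
      unfolding Q_def by (simp add: algebra_simps power2_eq_square power3_eq_cube)
    then show ?thesis unfolding w by simp
  qed
  define P where "P = (\<lambda>t s. - t / 2 + w * s)"
  define P' where "P' = (\<lambda>t s. - t / 2 - w * s)"
  have cQ: "continuous_on UNIV (\<lambda>(t, s). 4 * Q t s * k t)"
    unfolding Q_def case_prod_unfold by (auto intro!: continuous_intros)
  have A_N: "A = N (\<lambda>t s. 4 * Q t s * k t)"
  proof -
    have "N (\<lambda>t s. 4 * Q t s * k t) = SI (\<lambda>x. F30 (x \<bullet> v0) (x \<bullet> z0) - 3 * F12 (x \<bullet> v0) (x \<bullet> z0))"
      unfolding N_def Q4 F30_def F12_def by (simp add: left_diff_distrib mult.assoc)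
    also have "\<dots> = N F30 - 3 * N F12"
      unfolding N_def by (simp add: cN[OF cF(1)] cN[OF cF(3)])
    finally show ?thesis by (simp add: A_def)
  qed
  have rot: "orthonormal (c *\<^sub>R v0 + d *\<^sub>R z0) ((- d) *\<^sub>R v0 + c *\<^sub>R z0)" if "c * c + d * d = 1" for c d
    using that orthonormalD[OF z0] unfolding orthonormal_def norm_eq_1
    by (simp add: inner_add_left inner_add_right algebra_simps)
  have A_rot: "A = N (\<lambda>t s. 4 * Q (c * t + d * s) (- d * t + c * s) * k (c * t + d * s))"
    if "c * c + d * d = 1" for c d
  proof -
    have "A = SI (\<lambda>x. 4 * Q (x \<bullet> (c *\<^sub>R v0 + d *\<^sub>R z0)) (x \<bullet> ((- d) *\<^sub>R v0 + c *\<^sub>R z0)) * k (x \<bullet> (c *\<^sub>R v0 + d *\<^sub>R z0)))"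
      unfolding A_N by (rule N_pair[OF rot[OF that] cQ, symmetric])
    then show ?thesis by (simp add: N_def inner_add_right inner_diff_right)
  qed
  have Qs: "Q (- t) (- s) = - Q t s"
    "Q (P t s) (- w * t - s / 2) = Q t s" "Q (P' t s) (w * t - s / 2) = Q t s" for t s
  proof -
    show "Q (- t) (- s) = - Q t s" unfolding Q_def by (simp add: algebra_simps)
    have "- P t s / 2 + w * (- w * t - s / 2) = t / 4 - w * s - (w * w) * t"
      "- P t s / 2 - w * (- w * t - s / 2) = t / 4 + (w * w) * t"
      "- P' t s / 2 + w * (w * t - s / 2) = t / 4 + (w * w) * t"
      "- P' t s / 2 - w * (w * t - s / 2) = t / 4 + w * s - (w * w) * t"
      unfolding P_def P'_def by (simp_all add: field_simps)
    then have 1: "- P t s / 2 + w * (- w * t - s / 2) = P' t s" "- P t s / 2 - w * (- w * t - s / 2) = t"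
      "- P' t s / 2 + w * (w * t - s / 2) = t" "- P' t s / 2 - w * (w * t - s / 2) = P t s"
      unfolding w P_def P'_def by simp_all
    show "Q (P t s) (- w * t - s / 2) = Q t s"
      unfolding Q_def[of "P t s"] 1 unfolding Q_def P_def P'_def by (simp only: mult_ac)
    show "Q (P' t s) (w * t - s / 2) = Q t s"
      unfolding Q_def[of "P' t s"] 1 unfolding Q_def P_def P'_def by (simp only: mult_ac)
  qed
  have A1: "A = N (\<lambda>t s. 4 * Q t s * k (P t s))"
    using A_rot[of "- 1 / 2" w] w Qs(2) by (simp add: P_def mult.commute)
  have A2: "A = N (\<lambda>t s. 4 * Q t s * k (P' t s))"
    using A_rot[of "- 1 / 2" "- w"] w Qs(3) by (simp add: P'_def mult.commute)
  define H where "H t = k t - k (- t)" for t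
  \<comment> \<open>\<open>Q\<close> is odd, so only the odd part of \<open>k\<close> contributes;
    \<open>H\<close> is twice that part.\<close>
  have A_neg: "A = N (\<lambda>t s. - (4 * Q t s * k (- p t s)))"
    if A: "A = N (\<lambda>t s. 4 * Q t s * k (p t s))" and p: "continuous_on UNIV (\<lambda>(t, s). p t s)" "\<And>t s. p (- t) (- s) = - p t s" for p
  proof -
    have c: "continuous_on UNIV (\<lambda>(t, s). 4 * Q t s * k (p t s))"
      using p(1) unfolding Q_def case_prod_unfold by (auto intro!: continuous_intros)
    have "orthonormal (- v0) (- z0)" by (intro orthonormal_minus orthonormal_minus_left z0)
    from N_pair[OF this c] show ?thesis unfolding A N_def by (simp add: Qs(1) p(2))
  qed
  have A_H: "2 * A = N (\<lambda>t s. 4 * Q t s * H (p t s))"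
    if A: "A = N (\<lambda>t s. 4 * Q t s * k (p t s))" and p: "continuous_on UNIV (\<lambda>(t, s). p t s)" "\<And>t s. p (- t) (- s) = - p t s" for p
  proof -
    have c: "continuous_on UNIV (\<lambda>(t, s). 4 * Q t s * k (p t s))" "continuous_on UNIV (\<lambda>(t, s). - (4 * Q t s * k (- p t s)))"
      using p(1) unfolding Q_def case_prod_unfold by (auto intro!: continuous_intros)
    have "2 * A = N (\<lambda>t s. 4 * Q t s * k (p t s)) + N (\<lambda>t s. - (4 * Q t s * k (- p t s)))"
      using A A_neg[OF A p] by simp
    also have "\<dots> = SI (\<lambda>x. 4 * Q (x \<bullet> v0) (x \<bullet> z0) * k (p (x \<bullet> v0) (x \<bullet> z0))
        + - (4 * Q (x \<bullet> v0) (x \<bullet> z0) * k (- p (x \<bullet> v0) (x \<bullet> z0))))"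
      unfolding N_def by (rule Bochner_Integration.integral_add[OF cN[OF c(1)] cN[OF c(2)], symmetric])
    finally show ?thesis by (simp add: N_def H_def right_diff_distrib)
  qed
  define G where "G t s = 4 * Q t s * (H t + H (P t s) + H (P' t s))" for t s
  have cp: "continuous_on UNIV (\<lambda>(t, s). 4 * Q t s * H t)" "continuous_on UNIV (\<lambda>(t, s). 4 * Q t s * H (P t s))"
    "continuous_on UNIV (\<lambda>(t, s). 4 * Q t s * H (P' t s))"
    unfolding Q_def H_def P_def P'_def case_prod_unfold by (auto intro!: continuous_intros)
  have "6 * A = N G"
  proof -
    have "continuous_on UNIV (\<lambda>(t, s::real). t :: real)" "continuous_on UNIV (\<lambda>(t, s). P t s)" "continuous_on UNIV (\<lambda>(t, s). P' t s)"
      unfolding P_def P'_def case_prod_unfold by (auto intro!: continuous_intros)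
    then have "2 * A + 2 * A + 2 * A = N (\<lambda>t s. 4 * Q t s * H t) + N (\<lambda>t s. 4 * Q t s * H (P t s)) + N (\<lambda>t s. 4 * Q t s * H (P' t s))"
      using A_H[OF A_N] A_H[OF A1] A_H[OF A2] by (simp add: P_def P'_def)
    also have "\<dots> = N G"
      unfolding N_def G_def
      by (simp add: cN[OF cp(1)] cN[OF cp(2)] cN[OF cp(3)] distrib_left)
    finally show ?thesis by simp
  qed
  moreover have "0 < N G"
  proof -
    have H: "H t = SI (\<lambda>y. max t \<bar>y \<bullet> v0\<bar> - max (- t) \<bar>y \<bullet> v0\<bar>)" for t
      unfolding H_def k_def by (simp add: int)
    have intH: "integrable SM (\<lambda>y. max t \<bar>y \<bullet> v0\<bar> - max (- t) \<bar>y \<bullet> v0\<bar>)" for t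
      by (intro Bochner_Integration.integrable_diff int)
    define f where "f t s y = ((max t \<bar>y \<bullet> v0\<bar> - max (- t) \<bar>y \<bullet> v0\<bar>)
        + (max (P t s) \<bar>y \<bullet> v0\<bar> - max (- P t s) \<bar>y \<bullet> v0\<bar>)
        + (max (P' t s) \<bar>y \<bullet> v0\<bar> - max (- P' t s) \<bar>y \<bullet> v0\<bar>)) * (t * P t s * P' t s)" for t s y
    have G: "G t s = 4 * SI (f t s)" for t s
    proof -
      have "SI (f t s) = (H t + H (P t s) + H (P' t s)) * (t * P t s * P' t s)"
        unfolding f_def H by (simp add: intH)
      then show ?thesis by (simp add: G_def Q_def P_def P'_def)
    qed
    have f_nonneg: "0 \<le> f t s y" for t s y
      unfolding f_def by (rule soft_threshold_sum) (simp_all add: P_def P'_def)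
    have cG: "continuous_on UNIV (\<lambda>(t, s). G t s)"
      unfolding G_def Q_def H_def P_def P'_def case_prod_unfold by (auto intro!: continuous_intros)
    show ?thesis
      unfolding N_def
    proof (rule SI_pos[of _ v0])
      have "continuous_on (sphere 0 1) (\<lambda>x. (x \<bullet> v0, x \<bullet> z0))" by (intro continuous_intros)
      from continuous_on_compose2[OF cG this] show "continuous_on (sphere 0 1) (\<lambda>x. G (x \<bullet> v0) (x \<bullet> z0))" by simp
      show "0 \<le> G (x \<bullet> v0) (x \<bullet> z0)" for x
        unfolding G using SI_nonneg[OF f_nonneg] by simp
      show "norm v0 = 1" by (rule v0)
      \<comment> \<open>The threshold \<open>\<bar>y0 \<bullet> v0\<bar> = 1 / 2\<close> lies below
        \<open>1\<close> and equals the moduli of \<open>P 1 0\<close> and \<open>P' 1 0\<close>, so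
        in \<open>f 1 0 y0\<close> only the first of the three differences survives.\<close>
      define y0 where "y0 = (1/2) *\<^sub>R v0 + w *\<^sub>R z0"
      have "norm y0 = 1"
        unfolding y0_def norm_eq_1 using orthonormalD[OF z0] w by (simp add: inner_add_left inner_add_right)
      moreover have "y0 \<bullet> v0 = 1 / 2" using orthonormalD[OF z0] by (simp add: y0_def inner_add_left)
      then have "0 < f 1 0 y0" unfolding f_def P_def P'_def by simp
      moreover have "continuous_on (sphere 0 1) (f 1 0)"
        unfolding f_def[abs_def] by (intro continuous_intros)
      ultimately have "0 < SI (f 1 0)"
        using SI_pos[of "f 1 0" y0] f_nonneg by blast
      then show "0 < G (v0 \<bullet> v0) (v0 \<bullet> z0)"
        using orthonormalD[OF z0] by (simp add: G)
    qed
  qed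
  ultimately have "0 < A" by simp
  show thesis
  proof (rule that[OF \<open>0 < A\<close>, of "N F00" "3 * N F12"])
    fix e v :: 'a assume e: "norm e = 1"
    show "SI (\<lambda>x. (1 + (e \<bullet> x) ^ 3) * SI (\<lambda>y. max (x \<bullet> v) \<bar>y \<bullet> v\<bar>))
      = N F00 * norm v + A * ((e \<bullet> v) ^ 3 / (norm v)\<^sup>2) + 3 * N F12 * (e \<bullet> v)"
    proof (cases "v = 0")
      case False
      define r where "r = norm v"
      define u where "u = sgn v"
      have r: "r > 0" "norm u = 1" "v = r *\<^sub>R u" using False by (auto simp: r_def u_def norm_sgn sgn_div_norm)
      obtain z d where z: "orthonormal u z" "e = (u \<bullet> e) *\<^sub>R u + d *\<^sub>R z"
        using exists_orthonormal_decomp[OF r(2) dim, of e] by metis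
      define c where "c = u \<bullet> e"
      have e_eq: "e = c *\<^sub>R u + d *\<^sub>R z" using z(2) by (simp add: c_def)
      have cd: "d * d = 1 - c * c"
      proof -
        have "e \<bullet> e = c * c + d * d"
          using orthonormalD[OF z(1)] by (subst (1 2) e_eq) (simp add: inner_add_left inner_add_right)
        then show ?thesis using e by (simp add: dot_square_norm)
      qed
      have inner: "SI (\<lambda>y. max (x \<bullet> v) \<bar>y \<bullet> v\<bar>) = r * k (x \<bullet> u)" for x
      proof -
        have "SI (\<lambda>y. max (x \<bullet> v) \<bar>y \<bullet> v\<bar>) = SI (\<lambda>y. r * max (x \<bullet> u) \<bar>y \<bullet> u\<bar>)"
          using r(1) unfolding r(3) by (simp add: abs_mult max_mult_distrib_left)
        also have "\<dots> = r * SI (\<lambda>y. max (x \<bullet> u) \<bar>y \<bullet> u\<bar>)" by simp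
        also have "SI (\<lambda>y. max (x \<bullet> u) \<bar>y \<bullet> u\<bar>) = k (x \<bullet> u)"
        proof -
          have "continuous_on UNIV (\<lambda>(s, t::real). max (x \<bullet> u) \<bar>s\<bar>)"
            unfolding case_prod_unfold by (auto intro!: continuous_intros)
          from SI_orthonormal_pair[OF z(1) z0 this] show ?thesis by (simp add: k_def)
        qed
        finally show ?thesis .
      qed
      define F where "F = (\<lambda>t s. (1 + (c * t + d * s) ^ 3) * k t)"
      have cFF: "continuous_on UNIV (\<lambda>(t, s). F t s)"
        unfolding F_def case_prod_unfold by (auto intro!: continuous_intros)
      have "SI (\<lambda>x. (1 + (e \<bullet> x) ^ 3) * SI (\<lambda>y. max (x \<bullet> v) \<bar>y \<bullet> v\<bar>)) = r * SI (\<lambda>x. F (x \<bullet> u) (x \<bullet> z))"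
      proof -
        have "e \<bullet> x = c * (x \<bullet> u) + d * (x \<bullet> z)" for x
          by (subst e_eq) (simp add: inner_add_left inner_commute[of u x] inner_commute[of z x])
        then show ?thesis unfolding inner F_def by (simp add: mult_ac)
      qed
      also have "SI (\<lambda>x. F (x \<bullet> u) (x \<bullet> z)) = N F" by (rule N_pair[OF z(1) cFF])
      also have "N F = N F00 + c ^ 3 * N F30 + 3 * (c * c) * d * N F21 + 3 * c * (d * d) * N F12 + d ^ 3 * N F03"
      proof -
        have "F t s = F00 t s + c ^ 3 * F30 t s + 3 * (c * c) * d * F21 t s + 3 * c * (d * d) * F12 t s + d ^ 3 * F03 t s" for t s
          unfolding F_def F00_def F30_def F21_def F12_def F03_def
          by (simp add: algebra_simps power2_eq_square power3_eq_cube)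
        then show ?thesis unfolding N_def
          by (simp add: cN[OF cF(1)] cN[OF cF(2)] cN[OF cF(3)] cN[OF cF(4)] cN[OF cF(5)])
      qed
      also have "\<dots> = N F00 + A * c ^ 3 + 3 * N F12 * c"
        unfolding odd1 odd3 cd A_def by (simp add: algebra_simps power3_eq_cube)
      also have "r * \<dots> = N F00 * norm v + A * ((e \<bullet> v) ^ 3 / (norm v)\<^sup>2) + 3 * N F12 * (e \<bullet> v)"
      proof -
        have "e \<bullet> v = r * c" by (simp add: r(3) c_def inner_commute)
        moreover have "(r * c) ^ 3 / r\<^sup>2 = r * c ^ 3"
          using r(1) by (simp add: power_mult_distrib power2_eq_square power3_eq_cube)
        ultimately show ?thesis unfolding r_def[symmetric] by (simp add: algebra_simps)
      qed
      finally show ?thesis .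
    qed simp
  qed
qed

section \<open>Stretched bodies and the zonal functions\<close>

definition stretch :: "real \<Rightarrow> 'a::real_inner \<Rightarrow> 'a \<Rightarrow> 'a" where
  "stretch \<sigma> w u = u + (\<sigma> * (w \<bullet> u)) *\<^sub>R w"

lemma inner_stretch: "x \<bullet> stretch \<sigma> w u = stretch \<sigma> w x \<bullet> u"
  by (simp add: stretch_def inner_add_left inner_add_right inner_commute mult_ac)

lemma inner_stretch_axis: "norm w = 1 \<Longrightarrow> w \<bullet> stretch \<sigma> w u = (1 + \<sigma>) * (w \<bullet> u)"
  by (simp add: stretch_def inner_add_right dot_square_norm algebra_simps)

text \<open>The parameter \<open>sqrt (1 + s) - 1\<close> stretches the axis by
  \<open>sqrt (1 + s)\<close>; the squared norm is then affine in \<open>s\<close>, which gives the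
  binomial series treated by \<open>gf_extract\<close>.\<close>

lemma norm_stretch:
  assumes w: "norm w = 1" and s: "0 \<le> s"
  shows "norm (stretch (sqrt (1 + s) - 1) w u) = norm u * (1 + s * (w \<bullet> sgn u)\<^sup>2) powr (1 / 2)"
proof (cases "u = 0")
  case False
  define \<sigma> where "\<sigma> = sqrt (1 + s) - 1"
  define t where "t = w \<bullet> sgn u"
  have wu: "w \<bullet> u = norm u * t" using False by (simp add: t_def sgn_div_norm)
  have "(\<sigma> + 1)\<^sup>2 = 1 + s" using s by (simp add: \<sigma>_def)
  then have \<sigma>: "2 * \<sigma> + \<sigma> * \<sigma> = s" by (simp add: power2_eq_square algebra_simps)
  have "stretch \<sigma> w u \<bullet> stretch \<sigma> w u = u \<bullet> u + (2 * \<sigma> + \<sigma> * \<sigma>) * (w \<bullet> u)\<^sup>2"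
    using w by (simp add: stretch_def inner_add_left inner_add_right inner_commute[of u w]
        dot_square_norm[of w] algebra_simps power2_eq_square)
  also have "\<dots> = (norm u)\<^sup>2 * (1 + s * t\<^sup>2)"
    unfolding \<sigma> wu by (simp add: dot_square_norm algebra_simps power2_eq_square)
  finally have "norm (stretch \<sigma> w u) = sqrt ((norm u)\<^sup>2 * (1 + s * t\<^sup>2))"
    by (simp add: norm_eq_sqrt_inner)
  also have "\<dots> = norm u * sqrt (1 + s * t\<^sup>2)" by (simp add: real_sqrt_mult)
  also have "sqrt (1 + s * t\<^sup>2) = (1 + s * t\<^sup>2) powr (1 / 2)"
    using s by (intro powr_half_sqrt[symmetric]) simp
  finally show ?thesis by (simp add: \<sigma>_def t_def)
qed (simp add: stretch_def)

lemma hs_triangle: "hs (convex hull {x, y, - y}) u = max (x \<bullet> u) \<bar>y \<bullet> u\<bar>"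
  by (subst hs_convex_hull) (auto simp: inner_commute abs_real_def max_def)

lemma convex_hull3_convex_bodies: "convex hull {x, y, z} \<in> convex_bodies"
  by (rule convex_hull_convex_bodies) auto

lemma gbinomial_nonzero:
  fixes \<beta> :: real
  assumes "\<And>j. \<beta> \<noteq> real j"
  shows "\<beta> gchoose i \<noteq> 0"
proof (induction i)
  case (Suc i)
  have "real (Suc i) * (\<beta> gchoose Suc i) = (\<beta> gchoose i) * (\<beta> - real i)"
    using gbinomial_mult_1[of \<beta> i] by (simp add: algebra_simps)
  moreover have "(\<beta> gchoose i) * (\<beta> - real i) \<noteq> 0" using Suc assms[of i] by simp
  ultimately show ?case by (metis mult_zero_right)
qed simp

context good_bodies
begin

text \<open>The Riemann sums are nonnegative combinations of support functions, hence sublinear, so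
  they converge without correction by a ball.\<close>

lemma good_integral:
  fixes K :: "'a \<Rightarrow> 'a set" and w :: "'a \<Rightarrow> real"
  assumes K: "\<And>p. norm p = 1 \<Longrightarrow> good (K p)"
    and cont: "\<And>u. continuous_on (sphere 0 1) (\<lambda>p. hs (K p) u)"
    and w: "continuous_on (sphere 0 1) w" "\<And>p. norm p = 1 \<Longrightarrow> 0 \<le> w p"
  shows "\<exists>M. good M \<and> (\<forall>u. hs M u = SI (\<lambda>p. w p * hs (K p) u))"
proof (rule SM_discrete_approximation)
  fix F :: "nat \<Rightarrow> 'a set" and c :: "nat \<Rightarrow> 'a \<Rightarrow> real"
  assume F: "\<And>j. finite (F j)" "\<And>j. F j \<subseteq> sphere 0 1" "\<And>j p. 0 \<le> c j p"
    "\<And>g. continuous_on (sphere 0 1) g \<Longrightarrow> (\<lambda>j. \<Sum>p\<in>F j. c j p * g p) \<longlonglongrightarrow> SI g"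
  have unit: "norm p = 1" if "p \<in> F j" for p j using F(2)[of j] that by auto
  define f where "f j u = (\<Sum>p\<in>F j. (c j p * w p) * hs (K p) u)" for j u
  define g where "g u = SI (\<lambda>p. w p * hs (K p) u)" for u
  have gff: "gf (f j)" for j
    unfolding f_def by (intro gf_sum gf_cmult gf_hs K unit)
  have sub: "sublinear (f j)" for j
    unfolding f_def
    by (intro sublinear_sum sublinear_cmult sublinear_hs good_body K mult_nonneg_nonneg F(3) w(2)) (rule unit; assumption)+
  have lim: "(\<lambda>j. f j u) \<longlonglongrightarrow> g u" for u
    using F(4)[OF continuous_on_mult[OF w(1) cont[of u]]] by (simp add: f_def g_def mult.assoc)
  have sub0: "sublinear (\<lambda>u. f j u + 0 * norm u)" for j using sub by simp
  have "gf g" by (rule gf_LIMSEQ[where f = f, OF gff sub0 lim])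
  moreover have "sublinear g" by (rule sublinear_LIMSEQ[where f = f, OF sub lim])
  then obtain M where M: "M \<in> convex_bodies" "hs M = g" using ex_hs_eq by blast
  ultimately have "good M" using good_of_gf by blast
  moreover have "hs M u = SI (\<lambda>p. w p * hs (K p) u)" for u
    unfolding M(2) g_def ..
  ultimately show ?thesis by blast
qed

context
  fixes w :: 'a and s :: real
  assumes tri: "\<And>x y. good (convex hull {x, y, - y})"
    and w: "norm w = 1" and s: "0 < s" "s \<le> 1 / 2"
begin

definition T :: "'a \<Rightarrow> 'a" where "T = stretch (sqrt (1 + s) - 1) w"

lemma inner_T: "T x \<bullet> u = x \<bullet> T u"
  by (simp add: T_def inner_stretch)

lemma norm_T: "norm (T u) = norm u * (1 + s * (w \<bullet> sgn u)\<^sup>2) powr (1 / 2)"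
  unfolding T_def using norm_stretch[OF w] s by simp

text \<open>The images under \<open>T\<close> of all segments average to an ellipsoid. A segment is
  taken as the degenerate triangle in which two vertices coincide.\<close>

lemma gf_norm_T: "gf (\<lambda>u. norm u * (1 + s * (w \<bullet> sgn u)\<^sup>2) powr (1 / 2))"
proof (rule SI_abs_inner[OF dim])
  fix C :: real assume C: "0 < C" "\<And>v::'a. SI (\<lambda>x. \<bar>x \<bullet> v\<bar>) = C * norm v"
  have hsK: "hs (convex hull {T p, T p, - T p}) u = \<bar>p \<bullet> T u\<bar>" for p u
    by (simp add: hs_triangle[of "T p" "T p", simplified] inner_T)
  have "\<exists>M. good M \<and> (\<forall>u. hs M u = SI (\<lambda>p. 1 * hs (convex hull {T p, T p, - T p}) u))"
    by (rule good_integral) (auto intro!: tri continuous_intros simp del: insert_absorb2 simp: hsK)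
  then obtain M where M: "good M" "\<And>u. hs M u = C * norm (T u)"
    unfolding hsK by (auto simp: C(2))
  from gf_cmult[OF gf_hs[OF M(1)], of "1 / C"] show ?thesis
    using C(1) by (simp add: M(2) norm_T)
qed

text \<open>Averaging first over \<open>y\<close> and then over \<open>x\<close> gives a body whose
  support function at \<open>u\<close> is the function of \<open>SI_zonal_cubic\<close> at
  \<open>T u\<close>. The ellipsoid part and the linear part are already available, and in the rest
  the denominator \<open>(norm (T u))\<^sup>2\<close> produces the exponent
  \<open>- 1\<close>.\<close>

lemma gf_cubic_T: "gf (\<lambda>u. norm u * ((w \<bullet> sgn u) ^ 3 * (1 + s * (w \<bullet> sgn u)\<^sup>2) powr - 1))"
proof (rule SI_zonal_cubic[OF dim])
  fix A B C :: real
  assume A: "0 < A" "\<And>e v :: 'a. norm e = 1 \<Longrightarrow> SI (\<lambda>x. (1 + (e \<bullet> x) ^ 3) * SI (\<lambda>y. max (x \<bullet> v) \<bar>y \<bullet> v\<bar>))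
      = C * norm v + A * ((e \<bullet> v) ^ 3 / (norm v)\<^sup>2) + B * (e \<bullet> v)"
  define P where "P x M \<longleftrightarrow> good M \<and> (\<forall>u. hs M u = SI (\<lambda>y. max (x \<bullet> T u) \<bar>y \<bullet> T u\<bar>))" for x M
  have "\<exists>M. P x M" for x
  proof -
    have hsK: "hs (convex hull {T x, T p, - T p}) u = max (x \<bullet> T u) \<bar>p \<bullet> T u\<bar>" for p u
      by (simp add: hs_triangle inner_T)
    have "\<exists>M. good M \<and> (\<forall>u. hs M u = SI (\<lambda>p. 1 * hs (convex hull {T x, T p, - T p}) u))"
      by (rule good_integral) (auto intro!: tri continuous_intros simp: hsK)
    then show ?thesis unfolding hsK P_def by simp
  qed
  then have "P x (SOME M. P x M)" for x by (rule someI_ex)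
  moreover define M where "M x = (SOME M. P x M)" for x
  ultimately have "P x (M x)" for x by simp
  then have M: "good (M x)" "hs (M x) u = SI (\<lambda>y. max (x \<bullet> T u) \<bar>y \<bullet> T u\<bar>)" for x u
    unfolding P_def by auto
  \<comment> \<open>The summand \<open>1\<close> makes the weight nonnegative, as an average of
    bodies demands.\<close>
  have "\<exists>L. good L \<and> (\<forall>u. hs L u = SI (\<lambda>x. (1 + (w \<bullet> x) ^ 3) * hs (M x) u))"
  proof (rule good_integral)
    show "good (M p)" for p by (rule M(1))
    show "continuous_on (sphere 0 1) (\<lambda>p. hs (M p) u)" for u
      unfolding M(2) by (intro continuous_on_SI_max continuous_intros)
    show "continuous_on (sphere 0 1) (\<lambda>p. 1 + (w \<bullet> p) ^ 3)" by (intro continuous_intros)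
    fix p :: 'a assume "norm p = 1"
    then have "\<bar>w \<bullet> p\<bar> ^ 3 \<le> 1"
      using Cauchy_Schwarz_ineq2[of w p] w by (intro power_le_one) auto
    then have "\<bar>(w \<bullet> p) ^ 3\<bar> \<le> 1" by (simp only: power_abs)
    then show "0 \<le> 1 + (w \<bullet> p) ^ 3" by linarith
  qed
  then obtain L where L: "good L" "\<And>u. hs L u = C * norm (T u) + A * ((w \<bullet> T u) ^ 3 / (norm (T u))\<^sup>2) + B * (w \<bullet> T u)"
    unfolding M(2) A(2)[OF w] by blast
  define k where "k = sqrt (1 + s)"
  have k: "k > 0" using s by (simp add: k_def)
  have wT: "w \<bullet> T u = k * (w \<bullet> u)" for u
    by (simp add: T_def inner_stretch_axis[OF w] k_def)
  have "gf (\<lambda>u. (1 / (A * k ^ 3)) * (hs L u - (C * (norm u * (1 + s * (w \<bullet> sgn u)\<^sup>2) powr (1 / 2)) + B * k * (w \<bullet> u))))"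
    by (intro gf_cmult gf_diff gf_add gf_hs L(1) gf_norm_T gf_inner)
  moreover have "(1 / (A * k ^ 3)) * (hs L u - (C * (norm u * (1 + s * (w \<bullet> sgn u)\<^sup>2) powr (1 / 2)) + B * k * (w \<bullet> u)))
      = norm u * ((w \<bullet> sgn u) ^ 3 * (1 + s * (w \<bullet> sgn u)\<^sup>2) powr - 1)" for u
  proof (cases "u = 0")
    case True
    then show ?thesis by (simp add: L(2) T_def stretch_def)
  next
    case False
    define t where "t = w \<bullet> sgn u"
    have wu: "w \<bullet> u = norm u * t" using False by (simp add: t_def sgn_div_norm)
    have pos: "0 < 1 + s * t\<^sup>2" using s by (simp add: add_pos_nonneg)
    have "(norm (T u))\<^sup>2 = (norm u)\<^sup>2 * (1 + s * t\<^sup>2)"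
      using pos unfolding norm_T t_def[symmetric] by (simp add: power_mult_distrib powr_half_sqrt)
    then have "(w \<bullet> T u) ^ 3 / (norm (T u))\<^sup>2 = (k * (norm u * t)) ^ 3 / ((norm u)\<^sup>2 * (1 + s * t\<^sup>2))"
      by (simp add: wT wu)
    also have "\<dots> = k ^ 3 * (norm u * (t ^ 3 * (1 + s * t\<^sup>2) powr - 1))"
    proof -
      define q where "q = 1 + s * t\<^sup>2"
      have q: "q > 0" "q powr - 1 = 1 / q" using pos by (simp_all add: q_def powr_minus_divide)
      have "(k * (norm u * t)) ^ 3 / ((norm u)\<^sup>2 * q) = k ^ 3 * (norm u * (t ^ 3 * (1 / q)))"
        using q(1) False by (simp add: field_simps power2_eq_square power3_eq_cube)
      then show ?thesis using q(2) by (simp add: q_def)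
    qed
    finally have "hs L u - (C * (norm u * (1 + s * t\<^sup>2) powr (1 / 2)) + B * k * (w \<bullet> u))
        = A * (k ^ 3 * (norm u * (t ^ 3 * (1 + s * t\<^sup>2) powr - 1)))"
      by (simp add: L(2) norm_T wT t_def[symmetric])
    then show ?thesis using A(1) k by (simp add: t_def[symmetric])
  qed
  ultimately show ?thesis by (simp only:)
qed

end

text \<open>Even degrees come from the ellipsoids, odd degrees from three on from the cubic bodies,
  and degree one is linear, hence given by points. The exponents \<open>1 / 2\<close> and
  \<open>- 1\<close> are not natural numbers, so no binomial coefficient vanishes.\<close>

theorem gf_zonal:
  assumes tri: "\<And>x y. good (convex hull {x, y, - y})" and w: "norm w = 1"
  shows "gf (\<lambda>u. norm u * (w \<bullet> sgn u) ^ m)"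
proof -
  have even: "gf (\<lambda>u. norm u * (w \<bullet> sgn u) ^ (2 * k + 0))" for k
  proof (rule gf_extract[OF w, where \<beta> = "1 / 2"])
    show "(1 / 2 :: real) gchoose i \<noteq> 0" for i
    proof (rule gbinomial_nonzero)
      fix j :: nat show "1 / 2 \<noteq> real j" by (cases j) auto
    qed
    show "gf (\<lambda>u. norm u * ((w \<bullet> sgn u) ^ 0 * (1 + s * (w \<bullet> sgn u)\<^sup>2) powr (1 / 2)))"
      if "0 < s" "s \<le> 1 / 2" for s
      using gf_norm_T[OF tri w that] by simp
  qed simp
  have odd: "gf (\<lambda>u. norm u * (w \<bullet> sgn u) ^ (2 * k + 3))" for k
  proof (rule gf_extract[OF w, where \<beta> = "- 1"])
    show "(- 1 :: real) gchoose i \<noteq> 0" for i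
      by (rule gbinomial_nonzero) (simp add: eq_commute)
    show "gf (\<lambda>u. norm u * ((w \<bullet> sgn u) ^ 3 * (1 + s * (w \<bullet> sgn u)\<^sup>2) powr - 1))"
      if "0 < s" "s \<le> 1 / 2" for s
      by (rule gf_cubic_T[OF tri w that])
  qed simp
  consider k where "m = 2 * k + 0" | "m = 1" | k where "m = 2 * k + 3"
  proof (cases "even m")
    case True
    then show ?thesis using that(1) by (auto elim: evenE)
  next
    case False
    then obtain k where k: "m = 2 * k + 1" by (elim oddE)
    show ?thesis using that(2) that(3)[of "k - 1"] k by (cases k) auto
  qed
  then show ?thesis
  proof cases
    case 2
    have "norm u * (w \<bullet> sgn u) ^ m = w \<bullet> u" for u
      using 2 by (cases "u = 0") (auto simp: sgn_div_norm)
    then show ?thesis using gf_inner[of w] by simp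
  qed (use even odd in auto)
qed

end

section \<open>Widths and volume\<close>

definition wd :: "'a::euclidean_space set \<Rightarrow> 'a \<Rightarrow> real" where
  "wd K u = hs K u + hs K (- u)"

lemma wd_eq_0_iff:
  assumes K: "K \<in> convex_bodies"
  shows "wd K u = 0 \<longleftrightarrow> (\<forall>x\<in>K. \<forall>y\<in>K. u \<bullet> x = u \<bullet> y)"
proof
  assume wd: "wd K u = 0"
  have "u \<bullet> x \<le> u \<bullet> y" if "x \<in> K" "y \<in> K" for x y
    using inner_le_hs[OF K that(1), of u] inner_le_hs[OF K that(2), of "- u"] wd by (simp add: wd_def)
  then show "\<forall>x\<in>K. \<forall>y\<in>K. u \<bullet> x = u \<bullet> y" by (meson order_antisym)
next
  assume *: "\<forall>x\<in>K. \<forall>y\<in>K. u \<bullet> x = u \<bullet> y"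
  obtain x y where "x \<in> K" "hs K u = u \<bullet> x" "y \<in> K" "hs K (- u) = - u \<bullet> y"
    using hs_attained[OF K, of u] hs_attained[OF K, of "- u"] by metis
  moreover from this have "u \<bullet> x = u \<bullet> y" using * by blast
  ultimately show "wd K u = 0" by (simp add: wd_def)
qed

lemma wd_nonneg:
  assumes K: "K \<in> convex_bodies"
  shows "0 \<le> wd K u"
proof -
  obtain x where "x \<in> K" using convex_bodiesD(1)[OF K] by auto
  then show ?thesis
    using inner_le_hs[OF K, of x u] inner_le_hs[OF K, of x "- u"] by (simp add: wd_def)
qed

lemma wd_plus: "K \<in> convex_bodies \<Longrightarrow> L \<in> convex_bodies \<Longrightarrow> wd (K + L) u = wd K u + wd L u"
  by (simp add: wd_def hs_plus)

lemma hs_wd_0: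
  assumes K: "K \<in> convex_bodies" and "wd K v = 0" "x \<in> K"
  shows "hs K (u + v) = hs K u + v \<bullet> x"
proof -
  have *: "v \<bullet> y = v \<bullet> x" if "y \<in> K" for y
    using assms(2,3) that unfolding wd_eq_0_iff[OF K] by blast
  obtain y where y: "y \<in> K" "hs K u = u \<bullet> y" using hs_attained[OF K] by metis
  show ?thesis
  proof (rule hs_eqI[OF K y(1)])
    show "(u + v) \<bullet> y = hs K u + v \<bullet> x" using y *[OF y(1)] by (simp add: inner_add_left)
    show "(u + v) \<bullet> z \<le> hs K u + v \<bullet> x" if "z \<in> K" for z
      using inner_le_hs[OF K that, of u] *[OF that] by (simp add: inner_add_left)
  qed
qed

text \<open>A convex set without interior points lies in a hyperplane. Unlike volumes, widths add
  under Minkowski addition.\<close>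

lemma measure_eq_0_iff_wd:
  fixes K :: "'a::euclidean_space set"
  assumes K: "K \<in> convex_bodies"
  shows "measure lebesgue K = 0 \<longleftrightarrow> (\<exists>a. a \<noteq> 0 \<and> wd K a = 0)"
proof -
  have meas: "K \<in> lmeasurable" using convex_bodiesD(2)[OF K] by (rule lmeasurable_compact)
  have "negligible K \<longleftrightarrow> (\<exists>a. a \<noteq> 0 \<and> wd K a = 0)"
  proof
    assume neg: "negligible K"
    have "interior K = {}"
      using negligible_subset[OF neg interior_subset] open_not_negligible[OF open_interior] by blast
    then obtain a b where ab: "a \<noteq> 0" "K \<subseteq> {x. a \<bullet> x = b}"
      using empty_interior_subset_hyperplane[OF convex_bodiesD(3)[OF K]] by metis
    then have "wd K a = 0" unfolding wd_eq_0_iff[OF K] by auto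
    then show "\<exists>a. a \<noteq> 0 \<and> wd K a = 0" using ab(1) by blast
  next
    assume "\<exists>a. a \<noteq> 0 \<and> wd K a = 0"
    then obtain a where a: "a \<noteq> 0" "wd K a = 0" by blast
    obtain x where "x \<in> K" using convex_bodiesD(1)[OF K] by auto
    then have "K \<subseteq> {y. a \<bullet> y = a \<bullet> x}" using a(2) unfolding wd_eq_0_iff[OF K] by blast
    then show "negligible K" using negligible_hyperplane[of a "a \<bullet> x"] a(1) negligible_subset by blast
  qed
  then show ?thesis using negligible_iff_measure[of K] meas by simp
qed

section \<open>Rotations\<close>

lemma inner_transpose: "x \<bullet> (transpose g *v y) = (g *v x) \<bullet> (y :: real^'n)"
  by (metis dot_lmul_matrix inner_commute transpose_matrix_vector)

lemma orthogonal_matrix_inverse: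
  assumes "orthogonal_matrix (g :: real^'n^'n)"
  shows "transpose g *v (g *v x) = x" "g *v (transpose g *v x) = x"
  using assms unfolding matrix_vector_mul_assoc orthogonal_matrix_def by (simp_all only: matrix_vector_mul_lid)

lemma rotation_matrix_inverse:
  assumes "rotation_matrix (g :: real^'n^'n)"
  shows "transpose g *v (g *v x) = x" "g *v (transpose g *v x) = x"
  using assms unfolding rotation_matrix_def by (simp_all only: orthogonal_matrix_inverse)

text \<open>The reflection at the hyperplane orthogonal to \<open>a\<close>, written as a rotated
  diagonal matrix so that its determinant can be read off.\<close>

lemma exists_rotoinversion_fixing:
  fixes a :: "real^'n"
  assumes n: "CARD('n) \<ge> 2" and "norm a = 1"
  shows "\<exists>N :: real^'n^'n. orthogonal_matrix N \<and> det N = - 1 \<and> (\<forall>x. a \<bullet> x = 0 \<longrightarrow> N *v x = x)"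
proof -
  define k :: 'n where "k = undefined"
  obtain A :: "real^'n^'n" where A: "rotation_matrix A" "A *v axis k 1 = a"
    using rotation_matrix_exists_basis[OF assms] by metis
  define D :: "real^'n^'n" where "D = (\<chi> i j. if i = j then (if i = k then - 1 else 1) else 0)"
  have detD: "det D = - 1"
  proof -
    have "det D = (\<Prod>i\<in>UNIV. D $ i $ i)" by (rule det_diagonal) (simp add: D_def)
    also have "\<dots> = (\<Prod>i\<in>UNIV. if i = k then - 1 else 1)" by (simp add: D_def)
    also have "\<dots> = - 1" by (subst prod.delta) auto
    finally show ?thesis .
  qed
  have Dv: "(D *v y) $ i = (if i = k then - y $ i else y $ i)" for y i
  proof -
    have "(D *v y) $ i = (\<Sum>j\<in>UNIV. D $ i $ j * y $ j)" by (simp add: matrix_vector_mult_def)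
    also have "\<dots> = (\<Sum>j\<in>UNIV. if j = i then (if i = k then - y $ i else y $ i) else 0)"
      by (rule sum.cong) (auto simp: D_def)
    finally show ?thesis by simp
  qed
  have orthD: "orthogonal_matrix D"
  proof -
    have "transpose D = D" unfolding D_def transpose_def vec_eq_iff by auto
    moreover have "D ** D = mat 1"
      unfolding matrix_eq matrix_vector_mul_assoc[symmetric] matrix_vector_mul_lid vec_eq_iff Dv by simp
    ultimately show ?thesis by (simp add: orthogonal_matrix_def)
  qed
  define N where "N = A ** D ** transpose A"
  have orthA: "orthogonal_matrix A" "det A = 1" using A(1) by (auto simp: rotation_matrix_def)
  have "orthogonal_matrix N"
    unfolding N_def by (intro orthogonal_matrix_mul orthA orthD) (simp add: orthA orthogonal_matrix_transpose)
  moreover have "det N = - 1" by (simp add: N_def det_mul detD orthA det_transpose)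
  moreover have "N *v x = x" if "a \<bullet> x = 0" for x
  proof -
    have "(transpose A *v x) $ k = axis k 1 \<bullet> (transpose A *v x)" by (simp add: inner_axis')
    also have "\<dots> = (A *v axis k 1) \<bullet> x" by (rule inner_transpose)
    finally have "(transpose A *v x) $ k = 0" using that A(2) by simp
    then have "D *v (transpose A *v x) = transpose A *v x"
      by (auto simp: vec_eq_iff Dv)
    then have "N *v x = A *v (transpose A *v x)"
      by (simp add: N_def matrix_vector_mul_assoc[symmetric])
    also have "\<dots> = x" by (rule orthogonal_matrix_inverse(2)[OF orthA(1)])
    finally show ?thesis .
  qed
  ultimately show ?thesis by blast
qed

text \<open>A dimension beyond the plane of \<open>v'\<close> and \<open>z'\<close> leaves room for
  a reflection that corrects the determinant without moving them.\<close>

lemma rotation_pair: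
  fixes v z v' z' :: "real^'n"
  assumes n: "CARD('n) \<ge> 3" and on: "orthonormal v z" "orthonormal v' z'"
  shows "\<exists>g. rotation_matrix g \<and> g *v v = v' \<and> g *v z = z'"
proof -
  obtain f where f: "orthogonal_transformation f" "f v = v'" "f z = z'"
    using orthonormal_pairs_congruent[OF on] by blast
  define B where "B = matrix f"
  have B: "orthogonal_matrix B" "B *v v = v'" "B *v z = z'"
    using f by (auto simp: B_def orthogonal_transformation_matrix matrix_works)
  show ?thesis
  proof (cases "det B = 1")
    case True
    then show ?thesis using B by (auto simp: rotation_matrix_def)
  next
    case False
    then have detB: "det B = - 1" using det_orthogonal_matrix[OF B(1)] by blast
    have "dim {v', z'} \<le> card {v', z'}" by (rule dim_le_card') simp
    also have "\<dots> \<le> 2" by (simp add: card_insert_if)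
    finally have "dim {v', z'} < DIM(real^'n)" using n by simp
    then obtain a where a: "a \<noteq> 0" "\<And>y. y \<in> span {v', z'} \<Longrightarrow> orthogonal a y"
      using orthogonal_to_subspace_exists by blast
    then have av: "a \<bullet> v' = 0" "a \<bullet> z' = 0" by (auto simp: orthogonal_def span_base)
    have "norm (sgn a) = 1" using a(1) by (simp add: norm_sgn)
    then obtain N :: "real^'n^'n" where N: "orthogonal_matrix N" "det N = - 1"
      "\<And>x. sgn a \<bullet> x = 0 \<Longrightarrow> N *v x = x" using exists_rotoinversion_fixing[of "sgn a"] n by auto
    have "N *v v' = v'" "N *v z' = z'" using av by (auto intro!: N(3) simp: sgn_div_norm)
    then have "rotation_matrix (N ** B) \<and> (N ** B) *v v = v' \<and> (N ** B) *v z = z'"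
      using N B detB by (auto simp: rotation_matrix_def orthogonal_matrix_mul det_mul
          matrix_vector_mul_assoc[symmetric])
    then show ?thesis by blast
  qed
qed

section \<open>The image of a segment\<close>

definition seg :: "'a::real_vector \<Rightarrow> 'a set" where
  "seg u = convex hull {u, - u}"

lemma seg_body [simp]: "seg u \<in> convex_bodies"
  unfolding seg_def by (rule convex_hull_convex_bodies) auto

lemma hs_seg: "hs (seg u) y = \<bar>u \<bullet> y\<bar>"
  using hs_triangle[of u u y] by (simp add: seg_def max_def)

lemma sum_convex_bodies: "finite I \<Longrightarrow> (\<And>i. i \<in> I \<Longrightarrow> K i \<in> convex_bodies) \<Longrightarrow> sum K I \<in> convex_bodies"
proof (induction I rule: finite_induct)
  case empty
  then show ?case by (simp add: set_zero)
qed auto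

lemma hs_sum: "finite I \<Longrightarrow> (\<And>i. i \<in> I \<Longrightarrow> K i \<in> convex_bodies) \<Longrightarrow> hs (sum K I) u = (\<Sum>i\<in>I. hs (K i) u)"
proof (induction I rule: finite_induct)
  case empty
  then show ?case by (simp add: set_zero)
next
  case (insert i I)
  then show ?case by (simp add: hs_plus sum_convex_bodies)
qed

locale endomorphism =
  fixes \<Phi> :: "(real^'n) set \<Rightarrow> (real^'n) set"
  assumes endo: "minkowski_endomorphism \<Phi>"
    and n3: "CARD('n) \<ge> 3"
begin

abbreviation H :: "(real^'n) set \<Rightarrow> real^'n \<Rightarrow> real" where
  "H K u \<equiv> hs (\<Phi> K) u"

lemma dim2: "DIM(real^'n) \<ge> 2"
  using n3 by simp

lemma body [simp]: "K \<in> convex_bodies \<Longrightarrow> \<Phi> K \<in> convex_bodies"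
  using endo by (auto simp: minkowski_endomorphism_def)

lemma H_add: "K \<in> convex_bodies \<Longrightarrow> L \<in> convex_bodies \<Longrightarrow> H (K + L) u = H K u + H L u"
  using endo by (simp add: minkowski_endomorphism_def hs_plus)

lemma Phi_translation: "K \<in> convex_bodies \<Longrightarrow> \<Phi> ((\<lambda>x. x + t) ` K) = \<Phi> K"
  using endo by (auto simp: minkowski_endomorphism_def)

lemma H_rotation:
  "K \<in> convex_bodies \<Longrightarrow> rotation_matrix g \<Longrightarrow> H ((*v) g ` K) u = H K (transpose g *v u)"
  using endo by (simp add: minkowski_endomorphism_def hs_matrix)

lemma H_LIMSEQ:
  assumes "\<And>j. K j \<in> convex_bodies" "M \<in> convex_bodies" "\<And>u. (\<lambda>j. hs (K j) u) \<longlonglongrightarrow> hs M u"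
  shows "(\<lambda>j. H (K j) u) \<longlonglongrightarrow> H M u"
proof (rule hausdorff_continuous_hs_LIMSEQ[OF _ _ assms])
  show "hausdorff_continuous \<Phi>" using endo by (simp only: minkowski_endomorphism_def)
qed (rule funcsetI[OF body])

text \<open>All points have the same image by translation invariance, and
  \<open>{0} + {0} = {0}\<close> makes its support function zero.\<close>

lemma H_point [simp]: "H {p} u = 0"
proof -
  have "\<Phi> {p} = \<Phi> {0}" using Phi_translation[of "{0}" p] by simp
  moreover have "H ({0} + {0}) u = H {0} u + H {0} u" by (rule H_add) auto
  ultimately show ?thesis by (simp add: set_plus_def)
qed

text \<open>Additivity gives rational factors and continuity all others, as for Cauchy's functional
  equation.\<close>

lemma H_scale:
  assumes K: "K \<in> convex_bodies" and c: "0 \<le> c"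
  shows "H ((*\<^sub>R) c ` K) u = c * H K u"
proof -
  define q where "q c = H ((*\<^sub>R) c ` K) u" for c
  have add: "q (c + d) = q c + q d" if "0 \<le> c" "0 \<le> d" for c d
  proof -
    have "(*\<^sub>R) (c + d) ` K = (*\<^sub>R) c ` K + (*\<^sub>R) d ` K"
      by (rule hs_inject) (use K that in \<open>auto simp: hs_plus hs_scaleR scaleR_convex_bodies distrib_right\<close>)
    then show ?thesis using K by (simp add: q_def H_add scaleR_convex_bodies)
  qed
  have one: "(*\<^sub>R) 1 ` K = K" by simp
  have zero: "q 0 = 0"
  proof -
    have "(*\<^sub>R) 0 ` K = {0}" using convex_bodiesD(1)[OF K] by auto
    then show ?thesis by (simp add: q_def)
  qed
  have mult: "q (real m * c) = real m * q c" if "0 \<le> c" for m c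
  proof (induction m)
    case (Suc m)
    have "q (real (Suc m) * c) = q (real m * c + c)" by (simp add: algebra_simps)
    also have "\<dots> = q (real m * c) + q c" using that by (intro add) auto
    finally show ?case using Suc by (simp add: algebra_simps)
  qed (simp add: zero)
  define r where "r j = real (nat \<lfloor>c * real (Suc j)\<rfloor>) / real (Suc j)" for j
  have r0: "0 \<le> r j" for j by (simp add: r_def)
  have r: "r \<longlonglongrightarrow> c"
  proof (rule LIMSEQ_inverse_bound)
    fix j
    have nn: "0 \<le> c * real (Suc j)" using c by simp
    have "\<bar>real (nat \<lfloor>c * real (Suc j)\<rfloor>) - c * real (Suc j)\<bar> \<le> 1"
      using nn by (simp add: abs_le_iff) linarith
    moreover have "r j - c = (real (nat \<lfloor>c * real (Suc j)\<rfloor>) - c * real (Suc j)) / real (Suc j)"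
      by (simp add: r_def diff_divide_distrib del: of_nat_Suc)
    ultimately show "\<bar>r j - c\<bar> \<le> 1 * inverse (real (Suc j))"
      unfolding divide_inverse by (simp only: abs_mult) (intro mult_mono, auto)
  qed
  have "(\<lambda>j. q (r j)) \<longlonglongrightarrow> q c"
    unfolding q_def
  proof (rule H_LIMSEQ)
    show "(\<lambda>j. hs ((*\<^sub>R) (r j) ` K) u) \<longlonglongrightarrow> hs ((*\<^sub>R) c ` K) u" for u
      unfolding hs_scaleR[OF K r0] hs_scaleR[OF K c] by (intro tendsto_mult_right r)
  qed (use K in auto)
  moreover have "q (r j) = r j * q 1" for j
  proof -
    have "real (Suc j) * q (r j) = q (real (Suc j) * r j)" by (rule mult[OF r0, symmetric])
    also have "real (Suc j) * r j = real (nat \<lfloor>c * real (Suc j)\<rfloor>) * 1" by (simp add: r_def)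
    also have "q \<dots> = real (nat \<lfloor>c * real (Suc j)\<rfloor>) * q 1" by (rule mult) simp
    finally show ?thesis by (simp add: r_def field_simps del: of_nat_Suc)
  qed
  then have "(\<lambda>j. q (r j)) \<longlonglongrightarrow> c * q 1" using tendsto_mult_right[OF r, of "q 1"] by simp
  ultimately have "q c = c * q 1" by (rule LIMSEQ_unique)
  then show ?thesis by (simp add: q_def one)
qed

lemma H_sum: "finite I \<Longrightarrow> (\<And>i. i \<in> I \<Longrightarrow> K i \<in> convex_bodies) \<Longrightarrow> H (sum K I) u = (\<Sum>i\<in>I. H (K i) u)"
proof (induction I rule: finite_induct)
  case empty
  then show ?case by (simp add: set_zero)
next
  case (insert i I)
  then show ?case by (simp add: H_add sum_convex_bodies)
qed

end

text \<open>The volume constraint enters only through the fact that \<open>\<Phi> K\<close> is full-dimensional if and only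
  if \<open>K\<close> is.\<close>

locale vc_endomorphism = endomorphism \<Phi> for \<Phi> :: "(real^'n) set \<Rightarrow> (real^'n) set" +
  assumes vc: "volume_constraint \<Phi>"
begin

lemma flat_iff:
  assumes K: "K \<in> convex_bodies"
  shows "(\<exists>a. a \<noteq> 0 \<and> wd (\<Phi> K) a = 0) \<longleftrightarrow> (\<exists>a. a \<noteq> 0 \<and> wd K a = 0)"
proof -
  obtain c C where c: "c > 0" "C > 0" "c * measure lebesgue K \<le> measure lebesgue (\<Phi> K)"
    "measure lebesgue (\<Phi> K) \<le> C * measure lebesgue K"
    using vc K unfolding volume_constraint_def by blast
  have "measure lebesgue (\<Phi> K) = 0 \<longleftrightarrow> measure lebesgue K = 0"
  proof
    assume "measure lebesgue (\<Phi> K) = 0"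
    then have "c * measure lebesgue K \<le> 0" using c(3) by simp
    then have "measure lebesgue K \<le> 0" using c(1) by (simp add: mult_le_0_iff)
    then show "measure lebesgue K = 0" using measure_nonneg[of lebesgue K] by linarith
  next
    assume "measure lebesgue K = 0"
    then show "measure lebesgue (\<Phi> K) = 0" using c(4) measure_nonneg[of lebesgue "\<Phi> K"] by simp
  qed
  then show ?thesis using measure_eq_0_iff_wd[OF K] measure_eq_0_iff_wd[OF body[OF K]] by simp
qed

lemma seg_rotation:
  assumes "rotation_matrix g" "g *v u = w"
  shows "H (seg w) (g *v y) = H (seg u) y"
proof -
  have "(*v) g ` seg u = seg w"
  proof (rule hs_inject)
    fix y
    have "u \<bullet> (transpose g *v y) = w \<bullet> y"
      unfolding inner_transpose assms(2) ..
    then show "hs ((*v) g ` seg u) y = hs (seg w) y" by (simp add: hs_matrix hs_seg)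
  qed auto
  then have "H (seg w) (g *v y) = H (seg u) (transpose g *v (g *v y))"
    using H_rotation[OF seg_body assms(1), of u] by simp
  also have "transpose g *v (g *v y) = y"
    by (rule rotation_matrix_inverse(1)[OF assms(1)])
  finally show ?thesis .
qed

lemma seg_minus [simp]: "seg (- u) = seg u"
  by (simp add: seg_def insert_commute)

lemma wd_seg_rotation:
  assumes "rotation_matrix g" "g *v u = w"
  shows "wd (\<Phi> (seg w)) (g *v y) = wd (\<Phi> (seg u)) y"
  using seg_rotation[OF assms, of y] seg_rotation[OF assms, of "- y"]
  by (simp add: wd_def vec.neg)

text \<open>A rotation fixing \<open>u\<close> and reversing \<open>b\<close> shows that the image
  is flat also in the direction \<open>c *\<^sub>R u - q *\<^sub>R b\<close>, hence in the direction
  \<open>b\<close>; rotations about \<open>u\<close> carry \<open>b\<close> to every direction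
  orthogonal to \<open>u\<close>.\<close>

lemma wd_zero_seg_orthogonal_aux:
  assumes ub: "orthonormal u b" and a: "wd (\<Phi> (seg u)) (c *\<^sub>R u + q *\<^sub>R b) = 0" "q \<noteq> 0"
    and uz: "orthonormal u z"
  shows "wd (\<Phi> (seg u)) z = 0"
proof -
  obtain g where g: "rotation_matrix g" "g *v u = u" "g *v b = - b"
    using rotation_pair[OF n3 ub orthonormal_minus[OF ub]] by blast
  have "g *v (c *\<^sub>R u + q *\<^sub>R b) = c *\<^sub>R u - q *\<^sub>R b"
    using g by (simp add: matrix_vector_right_distrib matrix_vector_mult_scaleR)
  then have a': "wd (\<Phi> (seg u)) (c *\<^sub>R u - q *\<^sub>R b) = 0"
    using wd_seg_rotation[OF g(1,2), of "c *\<^sub>R u + q *\<^sub>R b"] a(1) by simp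
  have "wd (\<Phi> (seg u)) b = 0"
    unfolding wd_eq_0_iff[OF body[OF seg_body]]
  proof (intro ballI)
    fix x y assume xy: "x \<in> \<Phi> (seg u)" "y \<in> \<Phi> (seg u)"
    have "(c *\<^sub>R u + q *\<^sub>R b) \<bullet> x = (c *\<^sub>R u + q *\<^sub>R b) \<bullet> y" "(c *\<^sub>R u - q *\<^sub>R b) \<bullet> x = (c *\<^sub>R u - q *\<^sub>R b) \<bullet> y"
      using a(1) a' xy unfolding wd_eq_0_iff[OF body[OF seg_body]] by blast+
    then have "c * (u \<bullet> x) + q * (b \<bullet> x) = c * (u \<bullet> y) + q * (b \<bullet> y)"
      "c * (u \<bullet> x) - q * (b \<bullet> x) = c * (u \<bullet> y) - q * (b \<bullet> y)"
      by (simp_all only: inner_add_left inner_diff_left inner_scaleR_left)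
    then have "q * (b \<bullet> x) = q * (b \<bullet> y)" by linarith
    then show "b \<bullet> x = b \<bullet> y" using a(2) by simp
  qed
  moreover obtain h where "rotation_matrix h" "h *v u = u" "h *v b = z"
    using rotation_pair[OF n3 ub uz] by blast
  ultimately show ?thesis using wd_seg_rotation[of h u u b] by simp
qed

text \<open>In dimension at least three \<open>seg u + seg z\<close> is flat, so its image is flat
  in some direction \<open>a\<close>; since widths add and are nonnegative,
  \<open>\<Phi> (seg u)\<close> and \<open>\<Phi> (seg z)\<close> are both flat in this
  direction.\<close>

lemma wd_zero_seg_orthogonal:
  assumes uz: "orthonormal u z"
  shows "wd (\<Phi> (seg u)) z = 0"
proof -
  have "dim {u, z} \<le> card {u, z}" by (rule dim_le_card') simp
  also have "\<dots> \<le> 2" by (simp add: card_insert_if)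
  finally have "dim {u, z} < DIM(real^'n)" using n3 by simp
  then obtain a0 where a0: "a0 \<noteq> 0" "\<And>y. y \<in> span {u, z} \<Longrightarrow> orthogonal a0 y"
    using orthogonal_to_subspace_exists by blast
  have "u \<bullet> a0 = 0" "z \<bullet> a0 = 0"
    using a0(2)[of u] a0(2)[of z] by (simp_all add: orthogonal_def span_base inner_commute)
  then have "wd (seg u + seg z) a0 = 0" by (simp add: wd_def hs_plus hs_seg)
  then have "\<exists>a. a \<noteq> 0 \<and> wd (seg u + seg z) a = 0" using a0(1) by (intro exI[of _ a0] conjI)
  then have "\<exists>a. a \<noteq> 0 \<and> wd (\<Phi> (seg u + seg z)) a = 0"
    by (rule iffD2[OF flat_iff[OF set_plus_convex_bodies[OF seg_body seg_body]]])
  then obtain a where a: "a \<noteq> 0" "wd (\<Phi> (seg u + seg z)) a = 0" by blast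
  have "wd (\<Phi> (seg u)) a + wd (\<Phi> (seg z)) a = 0"
    using a(2) by (simp add: wd_def H_add)
  moreover have "0 \<le> wd (\<Phi> (seg u)) a" "0 \<le> wd (\<Phi> (seg z)) a" by (simp_all add: wd_nonneg)
  ultimately have wda: "wd (\<Phi> (seg u)) a = 0" "wd (\<Phi> (seg z)) a = 0" by linarith+
  have "norm u = 1" using uz by (simp add: orthonormal_def)
  from exists_orthonormal_decomp[OF this dim2] obtain b q where b: "orthonormal u b" "a = (u \<bullet> a) *\<^sub>R u + q *\<^sub>R b"
    by metis
  show ?thesis
  proof (cases "q = 0")
    case False
    then show ?thesis using wd_zero_seg_orthogonal_aux[OF b(1) _ _ uz] b(2) wda(1) by metis
  next
    \<comment> \<open>If \<open>a\<close> is parallel to \<open>u\<close>, it is orthogonal to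
      \<open>z\<close>; the argument is then made for \<open>seg z\<close> and carried back by a
      rotation.\<close>
    case True
    then have "a = 0 *\<^sub>R z + (u \<bullet> a) *\<^sub>R u" "u \<bullet> a \<noteq> 0" using b(2) a(1) by auto
    then have *: "wd (\<Phi> (seg z)) (- u) = 0"
      using wd_zero_seg_orthogonal_aux[OF orthonormal_sym[OF uz] _ _ orthonormal_minus[OF orthonormal_sym[OF uz]]] wda(2)
      by metis
    obtain g where "rotation_matrix g" "g *v z = u" "g *v (- u) = z"
      using rotation_pair[OF n3 orthonormal_minus[OF orthonormal_sym[OF uz]] uz] by blast
    then show ?thesis using wd_seg_rotation[of g z u "- u"] * by simp
  qed
qed

text \<open>The image is flat in all directions orthogonal to \<open>u\<close>, and rotations
  reversing such a direction place it on the line spanned by \<open>u\<close>; a rotation reversing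
  \<open>u\<close> makes it symmetric.\<close>

lemma H_seg_unit:
  assumes u: "norm u = 1"
  shows "H (seg u) y = H (seg u) u * \<bar>u \<bullet> y\<bar>"
proof -
  obtain b q where b: "orthonormal u b" "y = (u \<bullet> y) *\<^sub>R u + q *\<^sub>R b"
    using exists_orthonormal_decomp[OF u dim2] by metis
  define L where "L = \<Phi> (seg u)"
  have L: "L \<in> convex_bodies" by (simp add: L_def)
  have wd0: "wd L b = 0" unfolding L_def by (rule wd_zero_seg_orthogonal[OF b(1)])
  obtain g where g: "rotation_matrix g" "g *v u = u" "g *v b = - b"
    using rotation_pair[OF n3 b(1) orthonormal_minus[OF b(1)]] by blast
  have "hs L (- b) = hs L b" using seg_rotation[OF g(1,2), of b] g(3) by (simp add: L_def)
  then have hb: "hs L b = 0" "hs L (- b) = 0" using wd0 by (auto simp: wd_def)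
  have bx: "b \<bullet> x = 0" if "x \<in> L" for x
    using inner_le_hs[OF L that, of b] inner_le_hs[OF L that, of "- b"] hb by simp
  obtain x where x: "x \<in> L" using convex_bodiesD(1)[OF L] by auto
  have "wd L (q *\<^sub>R b) = 0" unfolding wd_eq_0_iff[OF L] by (simp add: bx)
  from hs_wd_0[OF L this x, of "(u \<bullet> y) *\<^sub>R u"] have "hs L y = hs L ((u \<bullet> y) *\<^sub>R u)"
    using b(2) bx[OF x] by simp
  also have "\<dots> = hs L u * \<bar>u \<bullet> y\<bar>"
  proof -
    obtain g where g: "rotation_matrix g" "g *v u = - u" "g *v b = b"
      using rotation_pair[OF n3 b(1) orthonormal_minus_left[OF b(1)]] by blast
    have sym: "hs L (- u) = hs L u" using seg_rotation[OF g(1,2), of u] g(2) by (simp add: L_def)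
    show ?thesis
    proof (cases "0 \<le> u \<bullet> y")
      case True
      then show ?thesis using sublinearD(2)[OF sublinear_hs[OF L] True, of u] by simp
    next
      case False
      then have "hs L ((- (u \<bullet> y)) *\<^sub>R (- u)) = (- (u \<bullet> y)) * hs L (- u)"
        by (intro sublinearD(2)[OF sublinear_hs[OF L]]) simp
      then show ?thesis using False sym by simp
    qed
  qed
  finally show ?thesis by (simp add: L_def)
qed

lemma exists_alpha: "\<exists>\<alpha>>0. \<forall>u y. H (seg u) y = \<alpha> * \<bar>u \<bullet> y\<bar>"
proof -
  define e :: "real^'n" where "e = (SOME b. b \<in> Basis)"
  have e: "norm e = 1" unfolding e_def by (rule norm_Basis[OF SOME_Basis])
  obtain e' where e': "orthonormal e e'" using exists_orthonormal[OF e dim2] by metis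
  define \<alpha> where "\<alpha> = H (seg e) e"
  have unit: "H (seg u) y = \<alpha> * \<bar>u \<bullet> y\<bar>" if u: "norm u = 1" for u y
  proof -
    obtain z where z: "orthonormal u z" using exists_orthonormal[OF u dim2] by metis
    obtain g where g: "rotation_matrix g" "g *v e = u" "g *v e' = z"
      using rotation_pair[OF n3 e' z] by blast
    have "H (seg u) u = \<alpha>" unfolding \<alpha>_def using seg_rotation[OF g(1,2), of e] g(2) by (simp only:)
    then show ?thesis unfolding H_seg_unit[OF u, of y] by (simp only:)
  qed
  have all: "H (seg u) y = \<alpha> * \<bar>u \<bullet> y\<bar>" for u y
  proof (cases "u = 0")
    case True
    then show ?thesis by (simp add: seg_def)
  next
    case False
    have "seg u = (*\<^sub>R) (norm u) ` seg (sgn u)"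
      by (rule hs_inject) (auto simp: hs_scaleR hs_seg sgn_div_norm abs_mult False)
    then have "H (seg u) y = norm u * (\<alpha> * \<bar>sgn u \<bullet> y\<bar>)"
      using H_scale[OF seg_body, of "norm u" "sgn u" y] unit[of "sgn u" y] False by (simp add: norm_sgn)
    then show ?thesis using False by (simp add: sgn_div_norm abs_mult)
  qed
  have "0 \<le> wd (\<Phi> (seg e)) e" by (simp add: wd_nonneg)
  then have "0 \<le> \<alpha>" using e by (simp add: wd_def all dot_square_norm)
  \<comment> \<open>With \<open>\<alpha> = 0\<close> the cube \<open>K\<close>, a sum of segments,
    would have a flat image although it is full-dimensional.\<close>
  moreover have "\<alpha> \<noteq> 0"
  proof
    assume "\<alpha> = 0"
    define K :: "(real^'n) set" where "K = (\<Sum>b\<in>Basis. seg b)"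
    have K: "K \<in> convex_bodies" unfolding K_def by (rule sum_convex_bodies) auto
    have "wd (\<Phi> K) e = 0" using \<open>\<alpha> = 0\<close> by (simp add: wd_def K_def H_sum all)
    moreover have "e \<noteq> 0" using e by auto
    ultimately have "\<exists>a. a \<noteq> 0 \<and> wd (\<Phi> K) a = 0" by (intro exI[of _ e] conjI)
    then have "\<exists>a. a \<noteq> 0 \<and> wd K a = 0" by (rule iffD1[OF flat_iff[OF K]])
    then obtain a where a: "a \<noteq> 0" "wd K a = 0" by blast
    have "wd K a = 2 * (\<Sum>b\<in>Basis. \<bar>b \<bullet> a\<bar>)"
      by (simp add: wd_def K_def hs_sum hs_seg)
    then have "\<forall>b\<in>Basis. \<bar>b \<bullet> a\<bar> = 0" using a(2) by (simp add: sum_nonneg_eq_0_iff)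
    then have "\<forall>b\<in>Basis. a \<bullet> b = 0" by (simp add: inner_commute[of a])
    then have "a = 0" by (simp only: euclidean_all_zero_iff)
    then show False using a(1) by simp
  qed
  ultimately show ?thesis using all by (intro exI[of _ \<alpha>]) auto
qed

definition \<alpha> :: real where
  "\<alpha> = (SOME \<alpha>. 0 < \<alpha> \<and> (\<forall>u y. H (seg u) y = \<alpha> * \<bar>u \<bullet> y\<bar>))"

lemma \<alpha>: "0 < \<alpha>" "H (seg u) y = \<alpha> * \<bar>u \<bullet> y\<bar>"
proof -
  have *: "0 < \<alpha> \<and> (\<forall>u y. H (seg u) y = \<alpha> * \<bar>u \<bullet> y\<bar>)"
    unfolding \<alpha>_def by (rule someI_ex[OF exists_alpha])
  show "0 < \<alpha>" by (rule conjunct1[OF *])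
  show "H (seg u) y = \<alpha> * \<bar>u \<bullet> y\<bar>" by (rule conjunct2[OF *, THEN spec, THEN spec])
qed

text \<open>The body \<open>L\<close> spans the hyperplane orthogonal to \<open>v\<close>, so
  \<open>K + L\<close> is still flat in the direction \<open>v\<close> and its image is flat in some
  direction \<open>a\<close>. Because \<open>\<alpha> > 0\<close>, the image of \<open>L\<close> is
  flat only in multiples of \<open>v\<close>; hence \<open>a\<close> is such a multiple, and
  \<open>\<Phi> K\<close> is flat in this direction too.\<close>

lemma wd_zero_image:
  assumes K: "K \<in> convex_bodies" and v: "wd K v = 0"
  shows "wd (\<Phi> K) v = 0"
proof (cases "v = 0")
  case True
  then show ?thesis using sublinearD(3)[OF sublinear_hs[OF body[OF K]]] by (simp add: wd_def)
next
  case False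
  define p where "p b = b - ((v \<bullet> b) / (v \<bullet> v)) *\<^sub>R v" for b
  define L where "L = (\<Sum>b\<in>Basis. seg (p b))"
  have L: "L \<in> convex_bodies" unfolding L_def by (rule sum_convex_bodies) auto
  have "p b \<bullet> v = 0" for b using False by (simp add: p_def inner_diff_left inner_commute[of b v])
  then have "wd L v = 0" by (simp add: wd_def L_def hs_sum hs_seg)
  then have "wd (K + L) v = 0" using v by (simp add: wd_plus K L)
  then have "\<exists>a. a \<noteq> 0 \<and> wd (K + L) a = 0" using False by (intro exI[of _ v] conjI)
  then have "\<exists>a. a \<noteq> 0 \<and> wd (\<Phi> (K + L)) a = 0"
    by (rule iffD2[OF flat_iff[OF set_plus_convex_bodies[OF K L]]])
  then obtain a where a: "a \<noteq> 0" "wd (\<Phi> (K + L)) a = 0" by blast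
  have "wd (\<Phi> K) a + wd (\<Phi> L) a = 0" using a(2) by (simp add: wd_def H_add K L)
  moreover have "0 \<le> wd (\<Phi> K) a" "0 \<le> wd (\<Phi> L) a" using K L by (simp_all add: wd_nonneg)
  ultimately have wda: "wd (\<Phi> K) a = 0" "wd (\<Phi> L) a = 0" by linarith+
  have "wd (\<Phi> L) a = 2 * \<alpha> * (\<Sum>b\<in>Basis. \<bar>p b \<bullet> a\<bar>)"
    by (simp add: wd_def L_def H_sum \<alpha>(2) sum_distrib_left mult.assoc)
  then have "(\<Sum>b\<in>Basis. \<bar>p b \<bullet> a\<bar>) = 0" using wda(2) \<alpha>(1) by simp
  then have pa: "p b \<bullet> a = 0" if "b \<in> Basis" for b using that by (simp add: sum_nonneg_eq_0_iff)
  have "a = ((v \<bullet> a) / (v \<bullet> v)) *\<^sub>R v"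
  proof (rule euclidean_eqI)
    fix b :: "real^'n" assume b: "b \<in> Basis"
    have "b \<bullet> a = (v \<bullet> b) / (v \<bullet> v) * (v \<bullet> a)" using pa[OF b] by (simp add: p_def inner_diff_left)
    then show "a \<bullet> b = ((v \<bullet> a) / (v \<bullet> v)) *\<^sub>R v \<bullet> b" by (simp add: inner_commute[of a b])
  qed
  moreover define c where "c = (v \<bullet> a) / (v \<bullet> v)"
  ultimately have c: "a = c *\<^sub>R v" "c \<noteq> 0" using a(1) by auto
  have cv: "\<forall>x\<in>\<Phi> K. \<forall>y\<in>\<Phi> K. (c *\<^sub>R v) \<bullet> x = (c *\<^sub>R v) \<bullet> y"
    using wda(1) unfolding c(1) wd_eq_0_iff[OF body[OF K]] .
  show ?thesis
    unfolding wd_eq_0_iff[OF body[OF K]]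
  proof (intro ballI)
    fix x y assume xy: "x \<in> \<Phi> K" "y \<in> \<Phi> K"
    have "(c *\<^sub>R v) \<bullet> x = (c *\<^sub>R v) \<bullet> y" by (rule bspec[OF bspec[OF cv xy(1)] xy(2)])
    then show "v \<bullet> x = v \<bullet> y" using c(2) by simp
  qed
qed

end

section \<open>The image of a triangle\<close>

declare transpose_matrix_vector [simp del]

text \<open>The support function of the triangle with vertices \<open>0\<close>, \<open>x\<close>,
  \<open>y\<close> in the coordinates \<open>s = x \<bullet> u\<close> and
  \<open>t = y \<bullet> u\<close>.\<close>

definition pmax :: "real \<Rightarrow> real \<Rightarrow> real" where
  "pmax s t = max 0 (max s t)"

lemma pmax_minus: "pmax (- s) (- t) = (\<bar>s\<bar> + \<bar>t\<bar> + \<bar>s - t\<bar>) / 2 - pmax s t"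
  by (auto simp: pmax_def max_def abs_if field_simps)

text \<open>Since \<open>k\<close> and its reflection are subadditive and add up to \<open>\<alpha> (\<bar>s\<bar> + \<bar>t\<bar> + \<bar>s - t\<bar>) / 2\<close>, both are
  additive on each of the six cones on which the sum is linear.\<close>

lemma planar_sublinear_decomposition:
  fixes k :: "real \<Rightarrow> real \<Rightarrow> real"
  assumes sub: "\<And>s t s' t'. k (s + s') (t + t') \<le> k s t + k s' t'"
    and hom: "\<And>c s t. 0 \<le> c \<Longrightarrow> k (c * s) (c * t) = c * k s t"
    and sym: "\<And>s t. k s t + k (- s) (- t) = \<alpha> * ((\<bar>s\<bar> + \<bar>t\<bar> + \<bar>s - t\<bar>) / 2)"
  shows "\<exists>a. 0 \<le> a \<and> a \<le> \<alpha> \<and> (\<exists>p q. \<forall>s t. k s t = a * pmax s t + (\<alpha> - a) * pmax (- s) (- t) + p * s + q * t)"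
proof -
  define r where "r s t = (\<bar>s\<bar> + \<bar>t\<bar> + \<bar>s - t\<bar>) / 2" for s t :: real
  have add: "k (s + s') (t + t') = k s t + k s' t'" if "r (s + s') (t + t') = r s t + r s' t'" for s t s' t'
  proof -
    have "k (s + s') (t + t') + k (- s + - s') (- t + - t') = (k s t + k (- s) (- t)) + (k s' t' + k (- s') (- t'))"
      using sym[of "s + s'" "t + t'"] sym[of s t] sym[of s' t'] that
      by (simp add: r_def[symmetric] distrib_left)
    then show ?thesis using sub[of s s' t t'] sub[of "- s" "- s'" "- t" "- t'"] by linarith
  qed
  define A where "A = k 1 0"
  define B where "B = k 1 1"
  define C where "C = k 0 1"
  have A': "k (- 1) 0 = \<alpha> - A" using sym[of 1 0] by (simp add: A_def)
  have B': "k (- 1) (- 1) = \<alpha> - B" using sym[of 1 1] by (simp add: B_def)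
  have C': "k 0 (- 1) = \<alpha> - C" using sym[of 0 1] by (simp add: C_def)
  have h: "k c 0 = c * A" "k c c = c * B" "k 0 c = c * C"
    "k (- c) 0 = c * (\<alpha> - A)" "k (- c) (- c) = c * (\<alpha> - B)" "k 0 (- c) = c * (\<alpha> - C)" if "0 \<le> c" for c
    using hom[OF that, of 1 0] hom[OF that, of 1 1] hom[OF that, of 0 1]
      hom[OF that, of "- 1" 0] hom[OF that, of "- 1" "- 1"] hom[OF that, of 0 "- 1"] A' B' C'
    by (simp_all add: A_def B_def C_def)
  \<comment> \<open>\<open>k 1 0 + k 0 1 - k 1 1\<close> is \<open>1\<close> for \<open>pmax\<close>
    and \<open>0\<close> for its reflection and for linear functions, so it picks out the
    coefficient of \<open>pmax\<close>.\<close>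
  define a where "a = A + C - B"
  have "k s t = a * pmax s t + (\<alpha> - a) * pmax (- s) (- t) + (B - C) * s + (B - A) * t" for s t
  proof -
    consider "0 \<le> t" "t \<le> s" | "0 \<le> s" "s \<le> t" | "s \<le> 0" "0 \<le> t" | "s \<le> t" "t \<le> 0"
      | "t \<le> s" "s \<le> 0" | "t \<le> 0" "0 \<le> s" by linarith
    then show ?thesis
    proof cases
      case 1
      have "k ((s - t) + t) (0 + t) = k (s - t) 0 + k t t" using 1 by (intro add) (simp add: r_def field_simps)
      then have "k s t = (s - t) * A + t * B" using 1 h(1)[of "s - t"] h(2)[of t] by simp
      moreover have "pmax s t = s" "pmax (- s) (- t) = 0" using 1 by (auto simp: pmax_def max_def)
      ultimately show ?thesis by (simp add: a_def algebra_simps)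
    next
      case 2
      have "k (s + 0) (s + (t - s)) = k s s + k 0 (t - s)" using 2 by (intro add) (simp add: r_def field_simps)
      then have "k s t = s * B + (t - s) * C" using 2 h(2)[of s] h(3)[of "t - s"] by simp
      moreover have "pmax s t = t" "pmax (- s) (- t) = 0" using 2 by (auto simp: pmax_def max_def)
      ultimately show ?thesis by (simp add: a_def algebra_simps)
    next
      case 3
      have "k (- (- s) + 0) (0 + t) = k (- (- s)) 0 + k 0 t" using 3 by (intro add) (simp add: r_def field_simps)
      then have "k s t = (- s) * (\<alpha> - A) + t * C" using 3 h(4)[of "- s"] h(3)[of t] by simp
      moreover have "pmax s t = t" "pmax (- s) (- t) = - s" using 3 by (auto simp: pmax_def max_def)
      ultimately show ?thesis by (simp add: a_def algebra_simps)
    next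
      case 4
      have "k (- (- t) + - (t - s)) (- (- t) + 0) = k (- (- t)) (- (- t)) + k (- (t - s)) 0" using 4 by (intro add) (simp add: r_def field_simps)
      then have "k s t = (- t) * (\<alpha> - B) + (t - s) * (\<alpha> - A)" using 4 h(5)[of "- t"] h(4)[of "t - s"] by simp
      moreover have "pmax s t = 0" "pmax (- s) (- t) = - s" using 4 by (auto simp: pmax_def max_def)
      ultimately show ?thesis by (simp add: a_def algebra_simps)
    next
      case 5
      have "k (- (- s) + 0) (- (- s) + - (s - t)) = k (- (- s)) (- (- s)) + k 0 (- (s - t))" using 5 by (intro add) (simp add: r_def field_simps)
      then have "k s t = (- s) * (\<alpha> - B) + (s - t) * (\<alpha> - C)" using 5 h(5)[of "- s"] h(6)[of "s - t"] by simp
      moreover have "pmax s t = 0" "pmax (- s) (- t) = - t" using 5 by (auto simp: pmax_def max_def)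
      ultimately show ?thesis by (simp add: a_def algebra_simps)
    next
      case 6
      have "k (s + 0) (0 + - (- t)) = k s 0 + k 0 (- (- t))" using 6 by (intro add) (simp add: r_def field_simps)
      then have "k s t = s * A + (- t) * (\<alpha> - C)" using 6 h(1)[of s] h(6)[of "- t"] by simp
      moreover have "pmax s t = s" "pmax (- s) (- t) = - t" using 6 by (auto simp: pmax_def max_def)
      ultimately show ?thesis by (simp add: a_def algebra_simps)
    qed
  qed
  moreover have "0 \<le> a" using sub[of 1 0 0 1] by (simp add: a_def A_def B_def C_def)
  moreover have "a \<le> \<alpha>" using sub[of "- 1" 0 0 "- 1"] A' B' C' by (simp add: a_def)
  ultimately show ?thesis by blast
qed

section \<open>Triangles and their coefficients\<close>

definition tri :: "'a::real_vector \<Rightarrow> 'a \<Rightarrow> 'a set" where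
  "tri x y = convex hull {0, x, y}"

lemma tri_body [simp]: "tri x y \<in> convex_bodies"
  unfolding tri_def by (rule convex_hull_convex_bodies) auto

lemma hs_tri: "hs (tri x y) u = pmax (x \<bullet> u) (y \<bullet> u)"
  unfolding tri_def by (subst hs_convex_hull) (auto simp: inner_commute pmax_def)

text \<open>The Gram determinant, positive exactly for linearly independent vectors.\<close>

definition indep :: "'a::real_inner \<Rightarrow> 'a \<Rightarrow> bool" where
  "indep x y \<longleftrightarrow> 0 < (x \<bullet> x) * (y \<bullet> y) - (x \<bullet> y) * (x \<bullet> y)"

lemma indep_commute: "indep x y \<longleftrightarrow> indep y x"
  by (simp add: indep_def inner_commute mult.commute)

lemma indep_comb:
  assumes "indep x y" "q \<noteq> 0"
  shows "indep x (p *\<^sub>R x + q *\<^sub>R y)"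
proof -
  have "(x \<bullet> x) * ((p *\<^sub>R x + q *\<^sub>R y) \<bullet> (p *\<^sub>R x + q *\<^sub>R y)) - (x \<bullet> (p *\<^sub>R x + q *\<^sub>R y)) * (x \<bullet> (p *\<^sub>R x + q *\<^sub>R y))
      = q\<^sup>2 * ((x \<bullet> x) * (y \<bullet> y) - (x \<bullet> y) * (x \<bullet> y))"
    by (simp add: inner_add_left inner_add_right inner_commute[of y x] algebra_simps power2_eq_square)
  then show ?thesis using assms by (simp add: indep_def)
qed

text \<open>Cramer's rule: \<open>p\<close> and \<open>q\<close> form the basis dual to
  \<open>x\<close>, \<open>y\<close> inside their span. The last conclusion is the consequence of
  lying in the span that \<open>exists_coef\<close> uses.\<close>

lemma indep_dual:
  fixes x y :: "'a::real_inner"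
  assumes "indep x y"
  obtains p q where "x \<bullet> p = 1" "y \<bullet> p = 0" "x \<bullet> q = 0" "y \<bullet> q = 1"
    "\<And>g. linear g \<Longrightarrow> g x = - x \<Longrightarrow> g y = - y \<Longrightarrow> g p = - p \<and> g q = - (q :: 'a)"
proof -
  define D where "D = (x \<bullet> x) * (y \<bullet> y) - (x \<bullet> y) * (x \<bullet> y)"
  have D: "D \<noteq> 0" using assms by (simp add: indep_def D_def)
  define p where "p = ((y \<bullet> y) / D) *\<^sub>R x + (- (x \<bullet> y) / D) *\<^sub>R y"
  define q where "q = (- (x \<bullet> y) / D) *\<^sub>R x + ((x \<bullet> x) / D) *\<^sub>R y"
  have "x \<bullet> p = ((x \<bullet> x) * (y \<bullet> y) - (x \<bullet> y) * (x \<bullet> y)) / D"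
    unfolding p_def by (simp add: inner_add_right inner_diff_right diff_divide_distrib mult.commute)
  then have 1: "x \<bullet> p = 1" using D by (simp add: D_def)
  have "y \<bullet> q = ((x \<bullet> x) * (y \<bullet> y) - (x \<bullet> y) * (x \<bullet> y)) / D"
    unfolding q_def by (simp add: inner_add_right inner_diff_right diff_divide_distrib inner_commute[of y x])
  then have 2: "y \<bullet> q = 1" using D by (simp add: D_def)
  have 3: "y \<bullet> p = 0" "x \<bullet> q = 0"
    unfolding p_def q_def by (simp_all add: inner_add_right inner_diff_right inner_commute[of y x] mult.commute)
  show ?thesis
    by (rule that[OF 1 3(1) 3(2) 2]) (simp add: p_def q_def linear_add linear_diff linear_cmul)
qed

context vc_endomorphism
begin

text \<open>The translation vector \<open>\<tau>\<close> is left open because cutting and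
  translating triangles changes it; only \<open>a\<close> is followed from one triangle to the
  next.\<close>

definition coef :: "real^'n \<Rightarrow> real^'n \<Rightarrow> real \<Rightarrow> bool" where
  "coef x y a \<longleftrightarrow> (\<exists>\<tau>. \<forall>u. H (tri x y) u
     = a * pmax (x \<bullet> u) (y \<bullet> u) + (\<alpha> - a) * pmax (- (x \<bullet> u)) (- (y \<bullet> u)) + \<tau> \<bullet> u)"

text \<open>A rotation reversing \<open>x\<close> and \<open>y\<close> maps the triangle to its
  reflection, and the hexagon obtained as their sum has a known image. Orthogonally to
  \<open>x\<close> and \<open>y\<close> the image is flat by \<open>wd_zero_image\<close>, so two
  coordinates describe its support function up to a linear term.\<close>

lemma exists_coef:
  assumes xy: "indep x y"
  shows "\<exists>a. 0 \<le> a \<and> a \<le> \<alpha> \<and> coef x y a"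
proof (rule indep_dual[OF xy])
  fix p q :: "real^'n"
  assume pq: "x \<bullet> p = 1" "y \<bullet> p = 0" "x \<bullet> q = 0" "y \<bullet> q = 1"
    "\<And>g. linear g \<Longrightarrow> g x = - x \<Longrightarrow> g y = - y \<Longrightarrow> g p = - p \<and> g q = - q"
  have x0: "x \<noteq> 0" using xy by (auto simp: indep_def)
  define e where "e = sgn x"
  have e: "norm e = 1" "x = norm x *\<^sub>R e" using x0 by (auto simp: e_def norm_sgn sgn_div_norm)
  obtain b d where b: "orthonormal e b" "y = (e \<bullet> y) *\<^sub>R e + d *\<^sub>R b"
    using exists_orthonormal_decomp[OF e(1) dim2] by metis
  obtain g where g: "rotation_matrix g" "g *v e = - e" "g *v b = - b"
    using rotation_pair[OF n3 b(1) orthonormal_minus[OF orthonormal_minus_left[OF b(1)]]] by blast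
  have "g *v (norm x *\<^sub>R e) = - (norm x *\<^sub>R e)"
    by (simp add: matrix_vector_mult_scaleR g)
  then have gx: "g *v x = - x" using e(2) by simp
  have "g *v ((e \<bullet> y) *\<^sub>R e + d *\<^sub>R b) = - ((e \<bullet> y) *\<^sub>R e + d *\<^sub>R b)"
    by (simp add: matrix_vector_right_distrib matrix_vector_mult_scaleR g)
  then have gy: "g *v y = - y" using b(2) by simp
  have gT: "transpose g *v (g *v z) = z" for z
    by (rule rotation_matrix_inverse(1)[OF g(1)])
  have tx: "transpose g *v x = - x" using gT[of "- x"] by (simp add: gx vec.neg)
  have ty: "transpose g *v y = - y" using gT[of "- y"] by (simp add: gy vec.neg)
  have tpq: "transpose g *v p = - p \<and> transpose g *v q = - q"
    by (rule pq(5)[OF matrix_vector_mul_linear tx ty])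
  define T where "T = tri x y"
  have T: "T \<in> convex_bodies" by (simp add: T_def)
  define Z where "Z = seg ((1/2) *\<^sub>R x) + seg ((1/2) *\<^sub>R y) + seg ((1/2) *\<^sub>R (x - y))"
  have xt: "x \<bullet> (transpose g *v u) = - (x \<bullet> u)" "y \<bullet> (transpose g *v u) = - (y \<bullet> u)" for u
    unfolding inner_transpose gx gy by simp_all
  have "T + (*v) g ` T = Z"
  proof (rule hs_inject)
    fix u
    have "hs (T + (*v) g ` T) u = pmax (x \<bullet> u) (y \<bullet> u) + pmax (- (x \<bullet> u)) (- (y \<bullet> u))"
      using T by (simp add: hs_plus matrix_convex_bodies hs_matrix T_def hs_tri xt)
    also have "\<dots> = hs Z u"
      unfolding pmax_minus Z_def by (simp add: hs_plus set_plus_convex_bodies hs_seg abs_mult inner_diff_left)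
    finally show "hs (T + (*v) g ` T) u = hs Z u" .
  qed (use T in \<open>auto simp: Z_def intro!: set_plus_convex_bodies matrix_convex_bodies\<close>)
  then have "H T u + H ((*v) g ` T) u = H Z u" for u
    using H_add[OF T matrix_convex_bodies[OF T], of g u] by simp
  then have sum: "H T u + H T (transpose g *v u) = \<alpha> * ((\<bar>x \<bullet> u\<bar> + \<bar>y \<bullet> u\<bar> + \<bar>x \<bullet> u - y \<bullet> u\<bar>) / 2)" for u
    by (simp add: H_rotation[OF T g(1)] Z_def H_add set_plus_convex_bodies \<alpha>(2) abs_mult inner_diff_left add_divide_distrib distrib_left)
  define k where "k s t = H T (s *\<^sub>R p + t *\<^sub>R q)" for s t
  have HT: "sublinear (H T)" by (rule sublinear_hs[OF body[OF T]])
  have "\<exists>a. 0 \<le> a \<and> a \<le> \<alpha> \<and> (\<exists>m n. \<forall>s t. k s t = a * pmax s t + (\<alpha> - a) * pmax (- s) (- t) + m * s + n * t)"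
  proof (rule planar_sublinear_decomposition)
    fix s t s' t'
    show "k (s + s') (t + t') \<le> k s t + k s' t'"
      unfolding k_def using sublinearD(1)[OF HT, of "s *\<^sub>R p + t *\<^sub>R q" "s' *\<^sub>R p + t' *\<^sub>R q"]
      by (simp add: algebra_simps)
  next
    fix c s t :: real assume "0 \<le> c"
    then show "k (c * s) (c * t) = c * k s t"
      unfolding k_def using sublinearD(2)[OF HT, of c "s *\<^sub>R p + t *\<^sub>R q"] by (simp add: scaleR_add_right)
  next
    fix s t :: real
    define u where "u = s *\<^sub>R p + t *\<^sub>R q"
    have "transpose g *v u = (- s) *\<^sub>R p + (- t) *\<^sub>R q"
      using tpq by (simp add: u_def matrix_vector_right_distrib matrix_vector_mult_scaleR)
    moreover have "x \<bullet> u = s" "y \<bullet> u = t" using pq(1-4) by (simp_all add: u_def inner_add_right)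
    ultimately show "k s t + k (- s) (- t) = \<alpha> * ((\<bar>s\<bar> + \<bar>t\<bar> + \<bar>s - t\<bar>) / 2)"
      using sum[of u] by (simp add: k_def u_def)
  qed
  then obtain a m n where a: "0 \<le> a" "a \<le> \<alpha>"
    "\<And>s t. k s t = a * pmax s t + (\<alpha> - a) * pmax (- s) (- t) + m * s + n * t" by blast
  obtain x0 where x0: "x0 \<in> \<Phi> T" using convex_bodiesD(1)[OF body[OF T]] by auto
  \<comment> \<open>Collects \<open>m * s + n * t\<close> and the contribution
    \<open>v \<bullet> x0\<close> of the component of \<open>u\<close> orthogonal to
    \<open>x\<close> and \<open>y\<close> into one linear function of \<open>u\<close>.\<close>
  define \<tau> where "\<tau> = m *\<^sub>R x + n *\<^sub>R y + x0 - (p \<bullet> x0) *\<^sub>R x - (q \<bullet> x0) *\<^sub>R y"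
  have "H (tri x y) u = a * pmax (x \<bullet> u) (y \<bullet> u) + (\<alpha> - a) * pmax (- (x \<bullet> u)) (- (y \<bullet> u)) + \<tau> \<bullet> u" for u
  proof -
    define s where "s = x \<bullet> u"
    define t where "t = y \<bullet> u"
    define v where "v = u - (s *\<^sub>R p + t *\<^sub>R q)"
    have "x \<bullet> v = 0" "y \<bullet> v = 0"
      using pq(1-4) by (simp_all add: v_def s_def t_def inner_diff_right inner_add_right)
    then have "wd T v = 0" by (simp add: wd_def T_def hs_tri pmax_def)
    then have "wd (\<Phi> T) v = 0" by (rule wd_zero_image[OF T])
    from hs_wd_0[OF body[OF T] this x0, of "s *\<^sub>R p + t *\<^sub>R q"]
    have "H T u = k s t + v \<bullet> x0" by (simp add: v_def k_def)
    then show ?thesis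
      by (simp add: a(3) T_def \<tau>_def s_def t_def v_def inner_add_left inner_diff_left inner_commute algebra_simps)
  qed
  then have "coef x y a" unfolding coef_def by blast
  then show ?thesis using a(1,2) by blast
qed

text \<open>The segment \<open>S\<close> from \<open>0\<close> to \<open>D\<close> cuts the triangle
  in two, and \<open>tri x y + S = tri x D + tri D y\<close>. Applying \<open>\<Phi>\<close> shows
  that the function \<open>f\<close> is linear. Across the hyperplane orthogonal to \<open>x\<close>
  it has a kink proportional to \<open>a1 - a\<close>, visible in the second difference at
  \<open>q\<close> along \<open>p\<close>.\<close>

lemma coef_cut_eq:
  assumes xy: "indep x y" and l: "0 < l" "l < 1" and D: "D = (1 - l) *\<^sub>R x + l *\<^sub>R y"
    and a: "coef x y a" "coef x D a1" "coef D y a2"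
  shows "a = a1"
proof (rule indep_dual[OF xy])
  fix p q :: "real^'n"
  assume pq: "x \<bullet> p = 1" "y \<bullet> p = 0" "x \<bullet> q = 0" "y \<bullet> q = 1"
  obtain \<tau> where \<tau>: "\<And>u. H (tri x y) u
      = a * pmax (x \<bullet> u) (y \<bullet> u) + (\<alpha> - a) * pmax (- (x \<bullet> u)) (- (y \<bullet> u)) + \<tau> \<bullet> u"
    using a(1) unfolding coef_def by blast
  obtain \<tau>1 where \<tau>1: "\<And>u. H (tri x D) u
      = a1 * pmax (x \<bullet> u) (D \<bullet> u) + (\<alpha> - a1) * pmax (- (x \<bullet> u)) (- (D \<bullet> u)) + \<tau>1 \<bullet> u"
    using a(2) unfolding coef_def by blast
  obtain \<tau>2 where \<tau>2: "\<And>u. H (tri D y) u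
      = a2 * pmax (D \<bullet> u) (y \<bullet> u) + (\<alpha> - a2) * pmax (- (D \<bullet> u)) (- (y \<bullet> u)) + \<tau>2 \<bullet> u"
    using a(3) unfolding coef_def by blast
  define S where "S = (\<lambda>z. z + (1/2) *\<^sub>R D) ` seg ((1/2) *\<^sub>R D)"
  have S: "S \<in> convex_bodies" unfolding S_def by auto
  have hsS: "hs S u = max 0 (D \<bullet> u)" for u
    unfolding S_def by (simp add: hs_translation hs_seg inner_commute max_def abs_mult)
  have HS: "H S u = \<alpha> / 2 * \<bar>D \<bullet> u\<bar>" for u
    unfolding S_def by (simp add: Phi_translation \<alpha>(2) abs_mult)
  have eq: "tri x y + S = tri x D + tri D y"
  proof (rule hs_inject)
    fix u
    define s where "s = x \<bullet> u"
    define t where "t = y \<bullet> u"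
    have m: "D \<bullet> u = (1 - l) * s + l * t" by (simp add: D s_def t_def inner_add_left)
    define m' where "m' = D \<bullet> u"
    have "s \<le> m' \<and> m' \<le> t \<or> t \<le> m' \<and> m' \<le> s"
    proof (cases "s \<le> t")
      case True
      have "m' - s = l * (t - s)" "t - m' = (1 - l) * (t - s)" by (simp_all add: m'_def m algebra_simps)
      then have "0 \<le> m' - s" "0 \<le> t - m'" using True l by (simp_all add: mult_nonneg_nonneg)
      then show ?thesis by simp
    next
      case False
      have "s - m' = l * (s - t)" "m' - t = (1 - l) * (s - t)" by (simp_all add: m'_def m algebra_simps)
      then have "0 \<le> s - m'" "0 \<le> m' - t" using False l by (simp_all add: mult_nonneg_nonneg)
      then show ?thesis by simp
    qed
    then have "pmax s t + max 0 m' = pmax s m' + pmax m' t"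
      by (auto simp: pmax_def max_def)
    then show "hs (tri x y + S) u = hs (tri x D + tri D y) u"
      using S by (simp add: hs_plus hs_tri hsS s_def t_def m'_def)
  qed (auto simp: S)
  define f where "f u = a * pmax (x \<bullet> u) (y \<bullet> u) + (\<alpha> - a) * pmax (- (x \<bullet> u)) (- (y \<bullet> u)) + \<alpha> / 2 * \<bar>D \<bullet> u\<bar>
    - (a1 * pmax (x \<bullet> u) (D \<bullet> u) + (\<alpha> - a1) * pmax (- (x \<bullet> u)) (- (D \<bullet> u)))
    - (a2 * pmax (D \<bullet> u) (y \<bullet> u) + (\<alpha> - a2) * pmax (- (D \<bullet> u)) (- (y \<bullet> u)))" for u
  have f: "f u = (\<tau>1 + \<tau>2 - \<tau>) \<bullet> u" for u
  proof -
    have "H (tri x y) u + H S u = H (tri x D) u + H (tri D y) u"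
      using arg_cong[OF eq, of "\<lambda>K. H K u"] S by (simp add: H_add)
    then show ?thesis by (simp add: f_def \<tau> \<tau>1 \<tau>2 HS inner_add_left inner_diff_left)
  qed
  \<comment> \<open>\<open>\<eta>\<close> is so small that among the three points only
    \<open>x \<bullet> u\<close> changes sign, while \<open>D \<bullet> u\<close> and
    \<open>y \<bullet> u\<close> stay positive.\<close>
  define \<eta> where "\<eta> = l / 2"
  have \<eta>: "0 < \<eta>" "\<eta> < 1" "l - (1 - l) * \<eta> > 0" "l + (1 - l) * \<eta> \<le> 1" "\<eta> \<le> l + (1 - l) * \<eta>"
    "l - (1 - l) * \<eta> \<le> 1"
  proof -
    show "0 < \<eta>" "\<eta> < 1" using l by (auto simp: \<eta>_def)
    have "(1 - l) * \<eta> < 1 * \<eta>" using l by (intro mult_strict_right_mono) (auto simp: \<eta>_def)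
    then show "l - (1 - l) * \<eta> > 0" using l by (simp add: \<eta>_def)
    have "(1 - l) * \<eta> \<le> (1 - l) * 1" using l by (intro mult_left_mono) (auto simp: \<eta>_def)
    then show "l + (1 - l) * \<eta> \<le> 1" by simp
    have "0 \<le> (1 - l) * \<eta>" using l by (intro mult_nonneg_nonneg) (auto simp: \<eta>_def)
    then show "l - (1 - l) * \<eta> \<le> 1" using l(2) by linarith
    from \<open>0 \<le> (1 - l) * \<eta>\<close> show "\<eta> \<le> l + (1 - l) * \<eta>" using l by (simp add: \<eta>_def)
  qed
  have f_val: "f (\<eta> *\<^sub>R p + q) + f ((- \<eta>) *\<^sub>R p + q) - 2 * f q = (\<alpha> - a) * \<eta> - (\<alpha> - a1) * \<eta>"
  proof -
    have xs: "x \<bullet> (c *\<^sub>R p + q) = c" "y \<bullet> (c *\<^sub>R p + q) = 1" "D \<bullet> (c *\<^sub>R p + q) = l + (1 - l) * c"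
      "x \<bullet> q = 0" "y \<bullet> q = 1" "D \<bullet> q = l" for c
      using pq by (simp_all add: D inner_add_left inner_add_right)
    have f1: "f (\<eta> *\<^sub>R p + q) = a + \<alpha> / 2 * (l + (1 - l) * \<eta>) - a1 * (l + (1 - l) * \<eta>) - a2"
      unfolding f_def xs using \<eta> by (simp add: pmax_def max_def)
    have f2: "f ((- \<eta>) *\<^sub>R p + q) = a + (\<alpha> - a) * \<eta> + \<alpha> / 2 * (l - (1 - l) * \<eta>)
        - (a1 * (l - (1 - l) * \<eta>) + (\<alpha> - a1) * \<eta>) - a2"
      unfolding f_def xs using \<eta> by (simp add: pmax_def max_def)
    have f3: "f q = a + \<alpha> / 2 * l - a1 * l - a2"
      unfolding f_def xs using l by (simp add: pmax_def max_def)
    show ?thesis unfolding f1 f2 f3 by (simp add: field_simps)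
  qed
  have "f (\<eta> *\<^sub>R p + q) + f ((- \<eta>) *\<^sub>R p + q) - 2 * f q = 0"
    unfolding f by (simp add: inner_add_right inner_diff_right)
  then have "(\<alpha> - a) * \<eta> = (\<alpha> - a1) * \<eta>" using f_val by linarith
  then show "a = a1" using \<eta>(1) by simp
qed

text \<open>Both values equal the coefficient of the same half of the triangle.\<close>

lemma coef_unique:
  assumes xy: "indep x y" and a: "coef x y a" "coef x y a'"
  shows "a = a'"
proof -
  define D where "D = (1 - 1 / 2) *\<^sub>R x + (1 / 2) *\<^sub>R y"
  have "indep x D" unfolding D_def by (rule indep_comb[OF xy]) simp
  moreover have "indep D y"
    using indep_comb[of y x "1 / 2" "1 / 2"] xy by (simp add: D_def indep_commute[of _ y] add.commute)
  ultimately obtain a1 a2 where "coef x D a1" "coef D y a2" using exists_coef by blast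
  then show ?thesis
    using coef_cut_eq[OF xy _ _ D_def a(1)] coef_cut_eq[OF xy _ _ D_def a(2)] by simp
qed

lemma coef_cut:
  assumes xy: "indep x y" and l: "0 < l" "l < 1"
  shows "coef x ((1 - l) *\<^sub>R x + l *\<^sub>R y) a \<longleftrightarrow> coef x y a"
proof -
  define D where "D = (1 - l) *\<^sub>R x + l *\<^sub>R y"
  have xD: "indep x D" unfolding D_def by (rule indep_comb[OF xy]) (use l in simp)
  have Dy: "indep D y"
    using indep_comb[of y x "1 - l" l] xy l by (simp add: D_def indep_commute[of _ y] add.commute)
  obtain a0 a1 a2 where c: "coef x y a0" "coef x D a1" "coef D y a2"
    using exists_coef[OF xy] exists_coef[OF xD] exists_coef[OF Dy] by blast
  have "a0 = a1" by (rule coef_cut_eq[OF xy l D_def c])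
  then show ?thesis
    unfolding D_def[symmetric] using coef_unique[OF xy] coef_unique[OF xD] c by blast
qed

text \<open>The same triangle with its vertex \<open>x\<close> moved to the origin.\<close>

lemma coef_translate:
  assumes "coef x y a"
  shows "coef (- x) (y - x) a"
proof -
  obtain \<tau> where \<tau>: "\<And>u. H (tri x y) u
      = a * pmax (x \<bullet> u) (y \<bullet> u) + (\<alpha> - a) * pmax (- (x \<bullet> u)) (- (y \<bullet> u)) + \<tau> \<bullet> u"
    using assms unfolding coef_def by blast
  have shift: "pmax (- s) (t - s) = pmax s t - s" "pmax s (s - t) = pmax (- s) (- t) + s" for s t
    by (auto simp: pmax_def max_def)
  have "tri (- x) (y - x) = (\<lambda>v. v + - x) ` tri x y"
  proof (rule hs_inject)
    fix u
    show "hs (tri (- x) (y - x)) u = hs ((\<lambda>v. v + - x) ` tri x y) u"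
      unfolding hs_translation[OF tri_body] hs_tri by (simp add: inner_diff_left shift inner_commute[of _ x])
  qed (rule tri_body, rule translation_convex_bodies[OF tri_body])
  then have "H (tri (- x) (y - x)) u = H (tri x y) u" for u
    using Phi_translation[OF tri_body, of "- x" x y] by simp
  then have "H (tri (- x) (y - x)) u = a * pmax ((- x) \<bullet> u) ((y - x) \<bullet> u)
      + (\<alpha> - a) * pmax (- ((- x) \<bullet> u)) (- ((y - x) \<bullet> u)) + (\<tau> + (2 * a - \<alpha>) *\<^sub>R x) \<bullet> u" for u
    by (simp add: \<tau> inner_diff_left shift inner_add_left algebra_simps)
  then show ?thesis unfolding coef_def by blast
qed

lemma coef_scale:
  assumes "coef x y a" "0 < c"
  shows "coef (c *\<^sub>R x) (c *\<^sub>R y) a"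
proof -
  obtain \<tau> where \<tau>: "\<And>u. H (tri x y) u
      = a * pmax (x \<bullet> u) (y \<bullet> u) + (\<alpha> - a) * pmax (- (x \<bullet> u)) (- (y \<bullet> u)) + \<tau> \<bullet> u"
    using assms unfolding coef_def by blast
  have sc: "pmax (c * s) (c * t) = c * pmax s t" "pmax (- (c * s)) (- (c * t)) = c * pmax (- s) (- t)" for s t
    using assms(2) by (auto simp: pmax_def max_def mult_le_0_iff zero_le_mult_iff)
  have "tri (c *\<^sub>R x) (c *\<^sub>R y) = (*\<^sub>R) c ` tri x y"
    by (rule hs_inject) (use assms(2) in \<open>auto simp: hs_scaleR hs_tri sc\<close>)
  then have "H (tri (c *\<^sub>R x) (c *\<^sub>R y)) u = c * H (tri x y) u" for u
    using H_scale[OF tri_body, of c x y u] assms(2) by simp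
  then have "H (tri (c *\<^sub>R x) (c *\<^sub>R y)) u = a * pmax ((c *\<^sub>R x) \<bullet> u) ((c *\<^sub>R y) \<bullet> u)
      + (\<alpha> - a) * pmax (- ((c *\<^sub>R x) \<bullet> u)) (- ((c *\<^sub>R y) \<bullet> u)) + (c *\<^sub>R \<tau>) \<bullet> u" for u
    by (simp add: \<tau> sc algebra_simps)
  then show ?thesis unfolding coef_def by blast
qed

lemma coef_rotation:
  assumes "coef x y a" and g: "rotation_matrix g"
  shows "coef (g *v x) (g *v y) a"
proof -
  obtain \<tau> where \<tau>: "\<And>u. H (tri x y) u
      = a * pmax (x \<bullet> u) (y \<bullet> u) + (\<alpha> - a) * pmax (- (x \<bullet> u)) (- (y \<bullet> u)) + \<tau> \<bullet> u"
    using assms unfolding coef_def by blast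
  have t: "z \<bullet> (transpose g *v u) = (g *v z) \<bullet> u" for z u
    by (rule inner_transpose)
  have "tri (g *v x) (g *v y) = (*v) g ` tri x y"
    by (rule hs_inject) (auto simp: hs_matrix hs_tri t)
  then have "H (tri (g *v x) (g *v y)) u = H (tri x y) (transpose g *v u)" for u
    using H_rotation[OF tri_body g, of x y u] by simp
  then have "H (tri (g *v x) (g *v y)) u = a * pmax ((g *v x) \<bullet> u) ((g *v y) \<bullet> u)
      + (\<alpha> - a) * pmax (- ((g *v x) \<bullet> u)) (- ((g *v y) \<bullet> u)) + (g *v \<tau>) \<bullet> u" for u
    by (simp add: \<tau> t)
  then show ?thesis unfolding coef_def by blast
qed

text \<open>Seen from the vertex \<open>x\<close>, shortening \<open>y\<close> is a cut; a factor
  above one undoes such a cut.\<close>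

lemma coef_ray:
  assumes xy: "indep x y" and c: "0 < c" and a: "coef x y a"
  shows "coef x (c *\<^sub>R y) a"
proof -
  have small: "coef x (c *\<^sub>R y) a \<longleftrightarrow> coef x y a" if xy: "indep x y" and c: "0 < c" "c < 1" for c y
  proof -
    have i: "indep (- x) (y - x)"
      using indep_comb[OF xy, of 1 "- 1"] by (simp add: indep_def inner_diff_left inner_diff_right algebra_simps)
    have D: "(1 - c) *\<^sub>R (- x) + c *\<^sub>R (y - x) = c *\<^sub>R y - x" by (simp add: algebra_simps)
    have "coef x y a \<longleftrightarrow> coef (- x) (y - x) a"
      using coef_translate[of x y a] coef_translate[of "- x" "y - x" a] by auto
    also have "\<dots> \<longleftrightarrow> coef (- x) (c *\<^sub>R y - x) a" using coef_cut[OF i c, of a] D by simp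
    also have "\<dots> \<longleftrightarrow> coef x (c *\<^sub>R y) a"
      using coef_translate[of x "c *\<^sub>R y" a] coef_translate[of "- x" "c *\<^sub>R y - x" a] by auto
    finally show ?thesis by simp
  qed
  consider "c < 1" | "c = 1" | "c > 1" by linarith
  then show ?thesis
  proof cases
    case 3
    have "indep x (c *\<^sub>R y)" using indep_comb[OF xy, of c 0] c by simp
    from small[OF this, of "1 / c"] show ?thesis using 3 a by simp
  qed (use small[OF xy c] a in auto)
qed

text \<open>Moves \<open>y\<close> along the line through \<open>x\<close> and \<open>y\<close>: a
  cut for \<open>c < 1\<close>, the reverse of a cut for \<open>c > 1\<close>.\<close>

lemma coef_line:
  assumes xy: "indep x y" and c: "0 < c" and a: "coef x y a"
  shows "coef x ((1 - c) *\<^sub>R x + c *\<^sub>R y) a"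
proof -
  consider "c < 1" | "c = 1" | "c > 1" by linarith
  then show ?thesis
  proof cases
    case 3
    define z where "z = (1 - c) *\<^sub>R x + c *\<^sub>R y"
    have i: "indep x z" unfolding z_def using indep_comb[OF xy, of c] c by simp
    have "(1 - 1 / c) *\<^sub>R x + (1 / c) *\<^sub>R z = y"
      using c by (simp add: z_def scaleR_add_right algebra_simps)
    then show ?thesis using coef_cut[OF i, of "1 / c" a] 3 a by (simp add: z_def)
  qed (use coef_cut[OF xy c] a in auto)
qed

text \<open>The point is reached by rescaling \<open>y\<close>, moving along a line through
  \<open>x\<close> and rescaling again. \<open>N\<close> is chosen so that the last factor
  \<open>l = p + q * N\<close> is positive.\<close>

lemma coef_half_plane:
  assumes xy: "indep x y" and q: "0 < q" and a: "coef x y a"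
  shows "coef x (p *\<^sub>R x + q *\<^sub>R y) a"
proof -
  define N where "N = (1 + \<bar>p\<bar>) / q"
  have N: "N > 0" "q * N = 1 + \<bar>p\<bar>" using q by (auto simp: N_def add_pos_nonneg)
  define y1 where "y1 = (1 / N) *\<^sub>R y"
  have i1: "indep x y1" using indep_comb[OF xy, of "1 / N" 0] N(1) by (simp add: y1_def)
  have c1: "coef x y1 a" unfolding y1_def using coef_ray[OF xy _ a] N(1) by simp
  define l where "l = p + q * N"
  have l: "l > 0" using N(2) by (simp add: l_def)
  define c where "c = q * N / l"
  have c: "c > 0" using N(1) q l by (simp add: c_def)
  define z where "z = (1 - c) *\<^sub>R x + c *\<^sub>R y1"
  have iz: "indep x z" unfolding z_def using indep_comb[OF i1, of c] c by simp
  have cz: "coef x z a" unfolding z_def by (rule coef_line[OF i1 c c1])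
  have "l *\<^sub>R z = (l * (1 - c)) *\<^sub>R x + (l * c) *\<^sub>R y1" by (simp add: z_def scaleR_add_right)
  also have "l * (1 - c) = p" using l by (simp add: c_def right_diff_distrib l_def)
  also have "l * c = q * N" using l by (simp add: c_def)
  also have "(q * N) *\<^sub>R y1 = q *\<^sub>R y" using N(1) by (simp add: y1_def)
  finally show ?thesis using coef_ray[OF iz l cz] by simp
qed

text \<open>Every independent pair arises from one orthonormal pair by a rotation, a move inside a
  half-plane and a dilation, all of which preserve the coefficient.\<close>

lemma uniform_coef: "\<exists>a. 0 \<le> a \<and> a \<le> \<alpha> \<and> (\<forall>x y. indep x y \<longrightarrow> coef x y a)"
proof -
  define e :: "real^'n" where "e = (SOME b. b \<in> Basis)"
  have e: "norm e = 1" unfolding e_def by (rule norm_Basis[OF SOME_Basis])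
  obtain e' where e': "orthonormal e e'" using exists_orthonormal[OF e dim2] by metis
  have "indep e e'" using orthonormalD[OF e'] by (simp add: indep_def)
  then obtain a where a: "0 \<le> a" "a \<le> \<alpha>" "coef e e' a" using exists_coef by blast
  have "coef x y a" if xy: "indep x y" for x y
  proof -
    have x0: "x \<noteq> 0" using xy by (auto simp: indep_def)
    define r where "r = norm x"
    define v where "v = sgn x"
    have v: "r > 0" "norm v = 1" "x = r *\<^sub>R v" using x0 by (auto simp: r_def v_def norm_sgn sgn_div_norm)
    obtain b q where b: "orthonormal v b" "y = (v \<bullet> y) *\<^sub>R v + q *\<^sub>R b" "0 \<le> q"
      using exists_orthonormal_decomp[OF v(2) dim2] by metis
    have "q \<noteq> 0"
    proof
      assume "q = 0"
      then have "y = (v \<bullet> y) *\<^sub>R v" using b(2) by simp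
      then obtain c where "y = c *\<^sub>R v" by blast
      then show False using xy unfolding v(3) indep_def by (simp add: algebra_simps)
    qed
    then have q: "q / r > 0" using b(3) v(1) by simp
    obtain g where g: "rotation_matrix g" "g *v e = v" "g *v e' = b"
      using rotation_pair[OF n3 e' b(1)] by blast
    have "coef v b a" using coef_rotation[OF a(3) g(1)] g(2,3) by simp
    moreover have "indep v b" using orthonormalD[OF b(1)] by (simp add: indep_def)
    ultimately have "coef v (((v \<bullet> y) / r) *\<^sub>R v + (q / r) *\<^sub>R b) a"
      using coef_half_plane q by blast
    from coef_scale[OF this v(1)] have "coef x ((v \<bullet> y) *\<^sub>R v + q *\<^sub>R b) a"
      using v(1,3) by (simp add: scaleR_add_right)
    then show ?thesis using b(2) by simp
  qed
  then show ?thesis using a(1,2) by blast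
qed

end

section \<open>The Steiner point\<close>

abbreviation ballvol :: "'a::euclidean_space itself \<Rightarrow> real" where
  "ballvol _ \<equiv> measure lebesgue (cball (0::'a) 1)"

lemma ballvol_pos: "0 < ballvol TYPE('a::euclidean_space)"
proof -
  have "emeasure lebesgue (cball (0::'a) 1) = emeasure lborel (cball (0::'a) 1)" by simp
  then show ?thesis
    using emeasure_lborel_cball_pos_finite[where 'a = 'a]
    by (simp add: measure_def enn2real_positive_iff less_top zero_less_iff_neq_zero)
qed

lemma inner_steiner_point:
  fixes K :: "'a::euclidean_space set"
  assumes K: "K \<in> convex_bodies"
  shows "steiner_point K \<bullet> y = SI (\<lambda>u. hs K u * (u \<bullet> y)) / ballvol TYPE('a)"
proof -
  have "integrable SM (\<lambda>u. hs K u *\<^sub>R u)"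
    by (intro SM_integrable continuous_intros continuous_on_hs K)
  then have "(\<integral>u. hs K u *\<^sub>R u \<partial>SM) \<bullet> y = SI (\<lambda>u. (hs K u *\<^sub>R u) \<bullet> y)"
    by (rule integral_inner_left[symmetric]) 
  then show ?thesis by (simp add: steiner_point_def)
qed

lemma SI_hs_inner_integrable:
  "K \<in> convex_bodies \<Longrightarrow> integrable SM (\<lambda>u. hs K u * (u \<bullet> y))"
  by (intro SM_integrable continuous_intros continuous_on_hs)

lemma inner_cancel_left: "(\<And>y. a \<bullet> y = b \<bullet> y) \<Longrightarrow> a = (b::'a::real_inner)"
  by (metis inner_eq_zero_iff inner_diff_left right_minus_eq)

lemma steiner_point_plus:
  assumes "K \<in> convex_bodies" "L \<in> convex_bodies"
  shows "steiner_point (K + L) = steiner_point K + steiner_point L"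
proof (rule inner_cancel_left)
  fix y
  show "steiner_point (K + L) \<bullet> y = (steiner_point K + steiner_point L) \<bullet> y"
    using assms
    by (simp add: inner_add_left inner_steiner_point set_plus_convex_bodies hs_plus distrib_right
        SI_hs_inner_integrable add_divide_distrib)
qed

lemma steiner_point_singleton:
  fixes p :: "'a::euclidean_space"
  assumes dim: "DIM('a) \<ge> 2"
  shows "steiner_point {p} = p"
proof (rule inner_cancel_left)
  fix y :: 'a
  have "steiner_point {p} \<bullet> y = SI (\<lambda>u. (u \<bullet> p) * (u \<bullet> y)) / ballvol TYPE('a)"
    by (simp add: inner_steiner_point)
  then show "steiner_point {p} \<bullet> y = p \<bullet> y"
    using ballvol_pos[where 'a = 'a] by (simp add: SI_inner_inner[OF dim])
qed

lemma translation_eq_plus: "(\<lambda>x. x + t) ` K = K + {t}"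
  by (auto simp: set_plus_def)

lemma steiner_point_translation:
  fixes K :: "'a::euclidean_space set"
  assumes "DIM('a) \<ge> 2" "K \<in> convex_bodies"
  shows "steiner_point ((\<lambda>x. x + t) ` K) = steiner_point K + t"
  unfolding translation_eq_plus using assms by (simp add: steiner_point_plus steiner_point_singleton)

lemma steiner_point_scaleR:
  assumes "K \<in> convex_bodies" "0 \<le> c"
  shows "steiner_point ((*\<^sub>R) c ` K) = c *\<^sub>R steiner_point K"
proof (rule inner_cancel_left)
  fix y
  show "steiner_point ((*\<^sub>R) c ` K) \<bullet> y = (c *\<^sub>R steiner_point K) \<bullet> y"
    using assms by (simp add: inner_steiner_point scaleR_convex_bodies hs_scaleR mult.assoc)
qed

lemma orthogonal_transformation_rotation:
  "rotation_matrix g \<Longrightarrow> orthogonal_transformation ((*v) (g :: real^'n^'n))"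
  "rotation_matrix g \<Longrightarrow> orthogonal_transformation ((*v) (transpose g))"
  by (simp_all add: rotation_matrix_def orthogonal_transformation_matrix orthogonal_matrix_transpose)

lemma steiner_point_rotation:
  fixes K :: "(real^'n) set"
  assumes K: "K \<in> convex_bodies" and g: "rotation_matrix g"
  shows "steiner_point ((*v) g ` K) = g *v steiner_point K"
proof (rule inner_cancel_left)
  fix y
  have c: "continuous_on (sphere 0 1) (\<lambda>u. hs K u * ((g *v u) \<bullet> y))"
    by (intro continuous_intros continuous_on_hs K)
  have "SI (\<lambda>u. hs ((*v) g ` K) u * (u \<bullet> y)) = SI (\<lambda>u. hs K (transpose g *v u) * ((g *v (transpose g *v u)) \<bullet> y))"
    by (simp add: hs_matrix K rotation_matrix_inverse[OF g])
  also have "\<dots> = SI (\<lambda>u. hs K u * ((g *v u) \<bullet> y))"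
    by (rule SI_orthogonal[OF orthogonal_transformation_rotation(2)[OF g] c])
  finally have "steiner_point ((*v) g ` K) \<bullet> y = steiner_point K \<bullet> (transpose g *v y)"
    using K by (simp add: inner_steiner_point matrix_convex_bodies flip: inner_transpose)
  then show "steiner_point ((*v) g ` K) \<bullet> y = (g *v steiner_point K) \<bullet> y" by (simp add: inner_transpose)
qed

lemma hausdorff_dist_nonneg:
  assumes "K \<in> convex_bodies" "L \<in> convex_bodies"
  shows "0 \<le> hausdorff_dist K (L :: 'a::euclidean_space set)"
proof -
  have "norm (SOME b :: 'a. b \<in> Basis) = 1" by (rule norm_Basis[OF SOME_Basis])
  then show ?thesis
    using hs_diff_le_hausdorff_dist[OF assms, of "SOME b. b \<in> Basis"]
    by (metis abs_ge_zero mult.right_neutral order_trans)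
qed

text \<open>The difference is tested against itself; the constant is the total mass
  \<open>n V(B)\<close> of the sphere divided by the normalising factor \<open>V(B)\<close>.\<close>

lemma steiner_point_lipschitz:
  fixes K L :: "'a::euclidean_space set"
  assumes K: "K \<in> convex_bodies" and L: "L \<in> convex_bodies"
  shows "norm (steiner_point K - steiner_point L) \<le> real DIM('a) * hausdorff_dist K L"
proof -
  define y where "y = steiner_point K - steiner_point L"
  define d where "d = hausdorff_dist K L"
  have "y \<bullet> y = (SI (\<lambda>u. hs K u * (u \<bullet> y)) - SI (\<lambda>u. hs L u * (u \<bullet> y))) / ballvol TYPE('a)"
    using K L by (subst (1) y_def) (simp add: inner_diff_left inner_steiner_point diff_divide_distrib)
  also have "SI (\<lambda>u. hs K u * (u \<bullet> y)) - SI (\<lambda>u. hs L u * (u \<bullet> y)) = SI (\<lambda>u. (hs K u - hs L u) * (u \<bullet> y))"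
    using SI_hs_inner_integrable[OF K, of y] SI_hs_inner_integrable[OF L, of y] by (simp add: left_diff_distrib)
  also have "\<dots> \<le> SI (\<lambda>u::'a. d * norm y)"
  proof (rule SI_mono)
    show "continuous_on (sphere 0 1) (\<lambda>u. (hs K u - hs L u) * (u \<bullet> y))"
      by (intro continuous_intros continuous_on_hs K L)
    fix u :: 'a assume u: "norm u = 1"
    have "\<bar>hs K u - hs L u\<bar> \<le> d" using hs_diff_le_hausdorff_dist[OF K L, of u] u by (simp add: d_def)
    moreover have "\<bar>u \<bullet> y\<bar> \<le> norm y" using Cauchy_Schwarz_ineq2[of u y] u by simp
    ultimately have "\<bar>hs K u - hs L u\<bar> * \<bar>u \<bullet> y\<bar> \<le> d * norm y" by (intro mult_mono) auto
    then show "(hs K u - hs L u) * (u \<bullet> y) \<le> d * norm y" by (simp flip: abs_mult)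
  qed simp
  also have "SI (\<lambda>u::'a. d * norm y) = real DIM('a) * ballvol TYPE('a) * (d * norm y)"
    by (simp add: space_SM measure_SM_space)
  finally have "y \<bullet> y \<le> real DIM('a) * d * norm y"
    using ballvol_pos[where 'a = 'a] by (simp add: divide_right_mono mult_ac)
  then have "norm y * norm y \<le> (real DIM('a) * d) * norm y" by (simp add: dot_square_norm power2_eq_square)
  then show ?thesis
    using hausdorff_dist_nonneg[OF K L] by (cases "y = 0") (auto simp: y_def d_def)
qed

text \<open>The Steiner point is viewed as the operator that sends \<open>K\<close> to a one-point
  body, which is Hausdorff continuous.\<close>

lemma steiner_point_LIMSEQ:
  fixes M :: "'a::euclidean_space set"
  assumes K: "\<And>j. K j \<in> convex_bodies" and M: "M \<in> convex_bodies"
    and lim: "\<And>u. (\<lambda>j. hs (K j) u) \<longlonglongrightarrow> hs M u"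
  shows "(\<lambda>j. steiner_point (K j) \<bullet> u) \<longlonglongrightarrow> steiner_point M \<bullet> u"
proof -
  have cont: "hausdorff_continuous (\<lambda>K. {steiner_point K :: 'a})"
    unfolding hausdorff_continuous_def
  proof (intro ballI allI impI)
    fix K :: "'a set" and e :: real assume K: "K \<in> convex_bodies" and e: "0 < e"
    show "\<exists>d>0. \<forall>L\<in>convex_bodies. hausdorff_dist L K < d \<longrightarrow> hausdorff_dist {steiner_point L} {steiner_point K} < e"
    proof (intro exI[of _ "e / real DIM('a)"] conjI ballI impI)
      show "0 < e / real DIM('a)" using e by simp
      fix L :: "'a set" assume L: "L \<in> convex_bodies" "hausdorff_dist L K < e / real DIM('a)"
      have "hausdorff_dist {steiner_point L} {steiner_point K} = norm (steiner_point L - steiner_point K)"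
        by (simp add: hausdorff_dist_def dist_norm norm_minus_commute)
      also have "\<dots> \<le> real DIM('a) * hausdorff_dist L K" by (rule steiner_point_lipschitz[OF L(1) K])
      also have "\<dots> < e" using L(2) by (simp add: pos_less_divide_eq mult.commute)
      finally show "hausdorff_dist {steiner_point L} {steiner_point K} < e" .
    qed
  qed
  have "(\<lambda>j. hs {steiner_point (K j)} u) \<longlonglongrightarrow> hs {steiner_point M} u"
    by (rule hausdorff_continuous_hs_LIMSEQ[OF cont _ K M lim]) auto
  then show ?thesis by (simp add: inner_commute)
qed

section \<open>Determination of the endomorphism\<close>

lemma pointwise_limit_of_linear:
  fixes d :: "'a::euclidean_space \<Rightarrow> real"
  assumes "\<And>u. (\<lambda>j. \<tau> j \<bullet> u) \<longlonglongrightarrow> d u"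
  shows "\<exists>\<tau>. \<forall>u. d u = \<tau> \<bullet> u"
proof (intro exI allI)
  fix u
  have "(\<lambda>j. \<Sum>b\<in>Basis. (\<tau> j \<bullet> b) * (u \<bullet> b)) \<longlonglongrightarrow> (\<Sum>b\<in>Basis. d b * (u \<bullet> b))"
    by (intro tendsto_sum tendsto_mult_right assms)
  then have "(\<lambda>j. \<tau> j \<bullet> u) \<longlonglongrightarrow> (\<Sum>b\<in>Basis. d b * (u \<bullet> b))" by (simp add: euclidean_inner[symmetric])
  from LIMSEQ_unique[OF assms this] show "d u = (\<Sum>b\<in>Basis. d b *\<^sub>R b) \<bullet> u"
    by (simp add: inner_sum_left inner_sum_right inner_commute[of _ u])
qed

context vc_endomorphism
begin

text \<open>The ball, up to a factor, is a limit of sums of segments, whose images are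
  known.\<close>

lemma H_cball: "H (cball 0 1) u = \<alpha> * norm u"
proof (rule SI_abs_inner[OF dim2])
  fix C assume C: "0 < C" "\<And>v::real^'n. SI (\<lambda>x. \<bar>x \<bullet> v\<bar>) = C * norm v"
  show ?thesis
  proof (rule SM_discrete_approximation)
    fix F :: "nat \<Rightarrow> (real^'n) set" and c :: "nat \<Rightarrow> real^'n \<Rightarrow> real"
    assume F: "\<And>j. finite (F j)" "\<And>j. F j \<subseteq> sphere 0 1" "\<And>j p. 0 \<le> c j p"
      "\<And>g. continuous_on (sphere 0 1) g \<Longrightarrow> (\<lambda>j. \<Sum>p\<in>F j. c j p * g p) \<longlonglongrightarrow> SI g"
    define K where "K j = (\<Sum>p\<in>F j. seg (c j p *\<^sub>R p))" for j
    have K: "K j \<in> convex_bodies" for j unfolding K_def by (intro sum_convex_bodies F(1)) auto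
    have lim: "(\<lambda>j. \<Sum>p\<in>F j. c j p * \<bar>p \<bullet> v\<bar>) \<longlonglongrightarrow> C * norm v" for v
      unfolding C(2)[symmetric] by (intro F(4) continuous_intros)
    have "(\<lambda>j. H (K j) u) \<longlonglongrightarrow> H ((*\<^sub>R) C ` cball 0 1) u"
    proof (rule H_LIMSEQ[OF K])
      show "(\<lambda>j. hs (K j) v) \<longlonglongrightarrow> hs ((*\<^sub>R) C ` cball 0 1) v" for v
        using lim[of v] C(1) F(1,3) by (simp add: K_def hs_sum hs_seg hs_scaleR abs_mult)
    qed auto
    moreover have "(\<lambda>j. H (K j) u) \<longlonglongrightarrow> \<alpha> * (C * norm u)"
      using tendsto_mult_left[OF lim[of u], of \<alpha>] F(1,3)
      by (simp add: K_def H_sum \<alpha>(2) abs_mult sum_distrib_left)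
    ultimately have "H ((*\<^sub>R) C ` cball 0 1) u = \<alpha> * (C * norm u)" by (rule LIMSEQ_unique)
    then show ?thesis using C(1) by (simp add: H_scale)
  qed
qed

text \<open>Additive, homogeneous and continuous in \<open>K\<close>, and zero on the unit ball.
  \<open>good_lin\<close> asks for linearity in \<open>u\<close>; \<open>good_full\<close> also
  prescribes the linear function, by means of the Steiner point.\<close>

definition defect :: "real \<Rightarrow> (real^'n) set \<Rightarrow> real^'n \<Rightarrow> real" where
  "defect a K u = H K u - a * hs K u - (\<alpha> - a) * hs K (- u)"

lemma defect_add: "K \<in> convex_bodies \<Longrightarrow> L \<in> convex_bodies \<Longrightarrow> defect a (K + L) u = defect a K u + defect a L u"
  by (simp add: defect_def H_add hs_plus algebra_simps)

lemma defect_scale: "K \<in> convex_bodies \<Longrightarrow> 0 \<le> c \<Longrightarrow> defect a ((*\<^sub>R) c ` K) u = c * defect a K u"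
  by (simp add: defect_def H_scale hs_scaleR algebra_simps)

lemma defect_cball: "defect a (cball 0 1) u = 0"
  by (simp add: defect_def H_cball algebra_simps)

lemma defect_point: "defect a {p} u = (\<alpha> - 2 * a) * (p \<bullet> u)"
  by (simp add: defect_def inner_commute algebra_simps)

lemma defect_LIMSEQ:
  assumes "\<And>j. K j \<in> convex_bodies" "M \<in> convex_bodies" "\<And>u. (\<lambda>j. hs (K j) u) \<longlonglongrightarrow> hs M u"
  shows "(\<lambda>j. defect a (K j) u) \<longlonglongrightarrow> defect a M u"
  unfolding defect_def by (intro tendsto_diff tendsto_mult_left H_LIMSEQ assms)

definition good_lin :: "real \<Rightarrow> (real^'n) set \<Rightarrow> bool" where
  "good_lin a K \<longleftrightarrow> K \<in> convex_bodies \<and> (\<exists>\<tau>. \<forall>u. defect a K u = \<tau> \<bullet> u)"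

lemma good_linI: "K \<in> convex_bodies \<Longrightarrow> (\<And>u. defect a K u = \<tau> \<bullet> u) \<Longrightarrow> good_lin a K"
  unfolding good_lin_def by blast

lemma good_lin_good_bodies: "good_bodies (good_lin a)"
proof
  show "DIM(real^'n) \<ge> 2" by (rule dim2)
  show "K \<in> convex_bodies" if "good_lin a K" for K using that by (simp add: good_lin_def)
  show "good_lin a (K + L)" if K: "good_lin a K" and L: "good_lin a L" for K L
  proof -
    obtain \<tau> \<tau>' where "\<And>u. defect a K u = \<tau> \<bullet> u" "\<And>u. defect a L u = \<tau>' \<bullet> u"
      using K L unfolding good_lin_def by blast
    then show ?thesis using K L
      by (intro good_linI[of _ _ "\<tau> + \<tau>'"]) (auto simp: good_lin_def defect_add inner_add_left)
  qed
  show "good_lin a K" if K: "K \<in> convex_bodies" and L: "good_lin a L" and KL: "good_lin a (K + L)" for K L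
  proof -
    obtain \<tau> \<tau>' where *: "\<And>u. defect a (K + L) u = \<tau> \<bullet> u" "\<And>u. defect a L u = \<tau>' \<bullet> u"
      using KL L unfolding good_lin_def by blast
    have "L \<in> convex_bodies" using L by (simp add: good_lin_def)
    then have "defect a K u = (\<tau> - \<tau>') \<bullet> u" for u
      using defect_add[OF K, of L a u] * by (simp add: inner_diff_left)
    then show ?thesis by (rule good_linI[OF K])
  qed
  show "good_lin a M" if K: "\<And>j::nat. good_lin a (Ks j)" and M: "M \<in> convex_bodies"
    and lim: "\<And>u. (\<lambda>j. hs (Ks j) u) \<longlonglongrightarrow> hs M u" for Ks M
  proof -
    have b: "Ks j \<in> convex_bodies" for j using K by (simp add: good_lin_def)
    have "\<forall>j. \<exists>\<tau>. \<forall>u. defect a (Ks j) u = \<tau> \<bullet> u" using K by (simp add: good_lin_def)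
    then obtain \<tau> where \<tau>: "\<forall>j u. defect a (Ks j) u = \<tau> j \<bullet> u" by metis
    have "(\<lambda>j. \<tau> j \<bullet> u) \<longlonglongrightarrow> defect a M u" for u
      using defect_LIMSEQ[OF b M lim, of a u] \<tau> by simp
    then show ?thesis using M pointwise_limit_of_linear[of \<tau> "defect a M"] by (simp add: good_lin_def)
  qed
  show "good_lin a ((*\<^sub>R) c ` K)" if K: "good_lin a K" and c: "0 \<le> c" for K c
  proof -
    obtain \<tau> where "\<And>u. defect a K u = \<tau> \<bullet> u" using K unfolding good_lin_def by blast
    then show ?thesis using K c
      by (intro good_linI[of _ _ "c *\<^sub>R \<tau>"]) (auto simp: good_lin_def defect_scale)
  qed
  show "good_lin a (cball 0 1)" by (rule good_linI[of _ _ 0]) (auto simp: defect_cball)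
  show "good_lin a {p}" for p by (rule good_linI[of _ _ "(\<alpha> - 2 * a) *\<^sub>R p"]) (auto simp: defect_point)
qed

lemma good_lin_segment: "good_lin a (tri 0 y)"
proof (rule good_linI[of _ _ "(\<alpha> / 2 - a) *\<^sub>R y"])
  fix u
  have "tri 0 y = (\<lambda>z. z + (1/2) *\<^sub>R y) ` seg ((1/2) *\<^sub>R y)"
    by (rule hs_inject) (auto simp: hs_tri hs_translation hs_seg pmax_def inner_commute max_def abs_mult)
  then have "H (tri 0 y) u = \<alpha> / 2 * \<bar>y \<bullet> u\<bar>" by (simp add: Phi_translation \<alpha>(2) abs_mult)
  then show "defect a (tri 0 y) u = ((\<alpha> / 2 - a) *\<^sub>R y) \<bullet> u"
    by (simp add: defect_def hs_tri pmax_def max_def abs_if algebra_simps)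
qed simp

lemma good_lin_tri:
  assumes a: "\<And>x y. indep x y \<Longrightarrow> coef x y a"
  shows "good_lin a (tri x y)"
proof -
  have ind: "good_lin a (tri x y)" if xy: "indep x y" for x y
  proof -
    obtain \<tau> where "\<And>u. H (tri x y) u
      = a * pmax (x \<bullet> u) (y \<bullet> u) + (\<alpha> - a) * pmax (- (x \<bullet> u)) (- (y \<bullet> u)) + \<tau> \<bullet> u"
      using a[OF xy] unfolding coef_def by blast
    then show ?thesis by (intro good_linI[of _ _ \<tau>]) (auto simp: defect_def hs_tri)
  qed
  show ?thesis
  proof (cases "x = 0")
    case True
    then show ?thesis by (simp add: good_lin_segment)
  next
    case False
    then have "norm (sgn x) = 1" by (simp add: norm_sgn)
    from exists_orthonormal[OF this dim2] obtain z' where z': "orthonormal (sgn x) z'" by metis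
    \<comment> \<open>The sign is chosen so that moving \<open>y\<close> along \<open>z\<close>
      makes the Gram determinant strictly positive; a degenerate triangle is thus a limit of proper
      ones.\<close>
    define z where "z = (if 0 \<le> y \<bullet> z' then z' else - z')"
    have z: "0 \<le> y \<bullet> z" "z \<bullet> z = 1" "x \<bullet> z = 0"
      using orthonormalD[OF z'] False by (auto simp: z_def sgn_div_norm)
    define ys where "ys j = y + inverse (real (Suc j)) *\<^sub>R z" for j
    have "indep x (ys j)" for j
    proof -
      define e where "e = inverse (real (Suc j))"
      have e: "e > 0" by (simp add: e_def)
      have "(x \<bullet> x) * (ys j \<bullet> ys j) - (x \<bullet> ys j) * (x \<bullet> ys j)
          = ((x \<bullet> x) * (y \<bullet> y) - (x \<bullet> y) * (x \<bullet> y)) + (x \<bullet> x) * (2 * e * (y \<bullet> z) + e * e)"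
        using z(2,3) unfolding ys_def e_def[symmetric]
        by (simp add: inner_add_left inner_add_right inner_commute[of z y] algebra_simps)
      moreover have "0 \<le> (x \<bullet> x) * (y \<bullet> y) - (x \<bullet> y) * (x \<bullet> y)"
        using Cauchy_Schwarz_ineq[of x y] by (simp add: power2_eq_square)
      moreover have "0 < (x \<bullet> x) * (2 * e * (y \<bullet> z) + e * e)"
        using False e z(1) by (intro mult_pos_pos add_nonneg_pos) auto
      ultimately show ?thesis by (simp add: indep_def)
    qed
    then have g: "good_lin a (tri x (ys j))" for j by (rule ind)
    show ?thesis
    proof (rule good_bodies.good_LIMSEQ[OF good_lin_good_bodies, where Ks = "\<lambda>j. tri x (ys j)", OF g])
      show "tri x y \<in> convex_bodies" by simp
      fix u
      have "(\<lambda>j. pmax (x \<bullet> u) (y \<bullet> u + inverse (real (Suc j)) * (z \<bullet> u))) \<longlonglongrightarrow> pmax (x \<bullet> u) (y \<bullet> u + 0 * (z \<bullet> u))"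
        unfolding pmax_def by (intro tendsto_intros LIMSEQ_inverse_real_of_nat)
      then show "(\<lambda>j. hs (tri x (ys j)) u) \<longlonglongrightarrow> hs (tri x y) u"
        by (simp add: hs_tri ys_def inner_add_left)
    qed
  qed
qed

text \<open>The vertex \<open>- y\<close> is translated to the origin.\<close>

lemma good_lin_triangle:
  assumes a: "\<And>x y. indep x y \<Longrightarrow> coef x y a"
  shows "good_lin a (convex hull {x, y, - y})"
proof -
  have "convex hull {x, y, - y} = tri (x + y) (2 *\<^sub>R y) + {- y}"
    by (rule hs_inject) (auto simp: convex_hull3_convex_bodies hs_triangle hs_plus hs_tri pmax_def
        inner_add_left inner_commute[of _ y] max_def abs_if)
  then show ?thesis
    using good_bodies.good_add[OF good_lin_good_bodies good_lin_tri[OF a]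
        good_bodies.good_point[OF good_lin_good_bodies]] by simp
qed

text \<open>The factor \<open>\<alpha> - 2 * a\<close> is forced by the value of
  \<open>defect\<close> on points, which the Steiner point reproduces.\<close>

definition defect' :: "real \<Rightarrow> (real^'n) set \<Rightarrow> real^'n \<Rightarrow> real" where
  "defect' a K u = defect a K u - (\<alpha> - 2 * a) * (steiner_point K \<bullet> u)"

definition good_full :: "real \<Rightarrow> (real^'n) set \<Rightarrow> bool" where
  "good_full a K \<longleftrightarrow> K \<in> convex_bodies \<and> (\<forall>u. defect' a K u = 0)"

lemma defect'_add: "K \<in> convex_bodies \<Longrightarrow> L \<in> convex_bodies \<Longrightarrow> defect' a (K + L) u = defect' a K u + defect' a L u"
  by (simp add: defect'_def defect_add steiner_point_plus inner_add_left algebra_simps)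

lemma defect'_scale: "K \<in> convex_bodies \<Longrightarrow> 0 \<le> c \<Longrightarrow> defect' a ((*\<^sub>R) c ` K) u = c * defect' a K u"
  by (simp add: defect'_def defect_scale steiner_point_scaleR algebra_simps)

lemma SI_inner: "SI (\<lambda>x::real^'n. x \<bullet> u) = 0"
proof -
  have "SI (\<lambda>x::real^'n. (- x) \<bullet> u) = SI (\<lambda>x. x \<bullet> u)"
    by (rule SI_orthogonal[where f = uminus])
      (auto simp: orthogonal_transformation_neg intro!: continuous_intros)
  then show ?thesis by simp
qed

lemma defect'_cball: "defect' a (cball 0 1) u = 0"
proof -
  have "steiner_point (cball (0::real^'n) 1) \<bullet> u = SI (\<lambda>x::real^'n. x \<bullet> u) / ballvol TYPE(real^'n)"
    unfolding inner_steiner_point[OF cball_convex_bodies[OF zero_le_one]]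
    by (rule arg_cong[where f = "\<lambda>x. x / _"], rule SI_cong) simp
  then show ?thesis by (simp add: defect'_def defect_cball SI_inner)
qed

lemma defect'_point: "defect' a {p} u = 0"
  by (simp add: defect'_def defect_point steiner_point_singleton[OF dim2])

lemma defect'_LIMSEQ:
  assumes "\<And>j. K j \<in> convex_bodies" "M \<in> convex_bodies" "\<And>u. (\<lambda>j. hs (K j) u) \<longlonglongrightarrow> hs M u"
  shows "(\<lambda>j. defect' a (K j) u) \<longlonglongrightarrow> defect' a M u"
  unfolding defect'_def by (intro tendsto_diff tendsto_mult_left defect_LIMSEQ steiner_point_LIMSEQ assms)

lemma defect'_rotation:
  assumes K: "K \<in> convex_bodies" and g: "rotation_matrix g"
  shows "defect' a ((*v) g ` K) (g *v u) = defect' a K u"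
proof -
  have "steiner_point ((*v) g ` K) \<bullet> (g *v u) = steiner_point K \<bullet> u"
    unfolding steiner_point_rotation[OF K g]
    using orthogonal_transformation_rotation(1)[OF g] by (simp add: orthogonal_transformation_def)
  moreover have "transpose g *v (- (g *v u)) = - u"
    using rotation_matrix_inverse(1)[OF g, of u] by (simp add: vec.neg)
  ultimately show ?thesis
    using K g by (simp add: defect'_def defect_def H_rotation hs_matrix rotation_matrix_inverse)
qed

lemma defect'_sum:
  "finite I \<Longrightarrow> (\<And>i. i \<in> I \<Longrightarrow> K i \<in> convex_bodies) \<Longrightarrow> defect' a (sum K I) u = (\<Sum>i\<in>I. defect' a (K i) u)"
proof (induction I rule: finite_induct)
  case empty
  then show ?case by (simp add: set_zero defect'_point)
next
  case (insert i I)
  then show ?case by (simp add: defect'_add sum_convex_bodies)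
qed

lemma good_full_good_bodies: "good_bodies (good_full a)"
proof
  show "DIM(real^'n) \<ge> 2" by (rule dim2)
  show "K \<in> convex_bodies" if "good_full a K" for K using that by (simp add: good_full_def)
  show "good_full a (K + L)" if "good_full a K" "good_full a L" for K L
    using that by (auto simp: good_full_def defect'_add)
  show "good_full a K" if "K \<in> convex_bodies" "good_full a L" "good_full a (K + L)" for K L
    using that by (simp add: good_full_def defect'_add)
  show "good_full a M" if K: "\<And>j::nat. good_full a (Ks j)" and M: "M \<in> convex_bodies"
    and lim: "\<And>u. (\<lambda>j. hs (Ks j) u) \<longlonglongrightarrow> hs M u" for Ks M
  proof -
    have b: "Ks j \<in> convex_bodies" for j using K by (simp add: good_full_def)
    have "defect' a M u = 0" for u
      using defect'_LIMSEQ[OF b M lim, of a u] K by (simp add: good_full_def LIMSEQ_const_iff)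
    then show ?thesis using M by (simp add: good_full_def)
  qed
  show "good_full a ((*\<^sub>R) c ` K)" if "good_full a K" "0 \<le> c" for K c
    using that by (auto simp: good_full_def defect'_scale)
  show "good_full a (cball 0 1)" by (simp add: good_full_def defect'_cball)
  show "good_full a {p}" for p by (simp add: good_full_def defect'_point)
qed

text \<open>A zonal body \<open>K w\<close> with axis \<open>w\<close> has \<open>defect'\<close> \<open>\<lambda> (w \<bullet> u)\<close>. The average of the bodies \<open>K w\<close> with weight
  \<open>1 + e \<bullet> w\<close> is a ball, up to translation, whence \<open>\<lambda> = 0\<close>.\<close>

lemma good_full_zonal:
  assumes a: "\<And>x y. indep x y \<Longrightarrow> coef x y a"
    and K: "\<And>w. norm w = 1 \<Longrightarrow> K w \<in> convex_bodies"
    and hsK: "\<And>w u. norm w = 1 \<Longrightarrow> hs (K w) u = norm u * (w \<bullet> sgn u) ^ m + (1 + 2 * (real m)\<^sup>2) * norm u"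
    and w: "norm w = 1"
  shows "good_full a (K w)"
proof -
  interpret good_bodies "good_lin a" by (rule good_lin_good_bodies)
  have lin: "\<exists>\<tau>. \<forall>u. defect' a (K w) u = \<tau> \<bullet> u" if w: "norm w = 1" for w
  proof -
    have "gf (\<lambda>u. norm u * (w \<bullet> sgn u) ^ m + (1 + 2 * (real m)\<^sup>2) * norm u)"
      by (intro gf_add gf_cmult gf_norm gf_zonal good_lin_triangle a w)
    then have "gf (hs (K w))" using hsK[OF w] by (simp add: gf_def)
    then have "good_lin a (K w)" by (rule good_of_gf[OF K[OF w]])
    then obtain \<tau> where "\<And>u. defect a (K w) u = \<tau> \<bullet> u" unfolding good_lin_def by blast
    then have "defect' a (K w) u = (\<tau> - (\<alpha> - 2 * a) *\<^sub>R steiner_point (K w)) \<bullet> u" for u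
      by (simp add: defect'_def inner_diff_left)
    then show ?thesis by blast
  qed
  have rot: "defect' a (K (g *v w)) (g *v u) = defect' a (K w) u"
    if w: "norm w = 1" and g: "rotation_matrix g" for g w u
  proof -
    note og = orthogonal_transformation_rotation[OF g]
    have gw: "norm (g *v w) = 1" using w orthogonal_transformation_norm[OF og(1)] by simp
    have "(*v) g ` K w = K (g *v w)"
    proof (rule hs_inject)
      fix u
      have n: "norm (transpose g *v u) = norm u" using orthogonal_transformation_norm[OF og(2)] by simp
      have "w \<bullet> sgn (transpose g *v u) = (g *v w) \<bullet> sgn u"
        by (simp add: sgn_div_norm n inner_transpose)
      then show "hs ((*v) g ` K w) u = hs (K (g *v w)) u"
        by (simp add: hs_matrix K w gw hsK n)
    qed (auto intro: K w gw)
    then show ?thesis using defect'_rotation[OF K[OF w] g] by metis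
  qed
  define e :: "real^'n" where "e = (SOME b. b \<in> Basis)"
  have e: "norm e = 1" unfolding e_def by (rule norm_Basis[OF SOME_Basis])
  obtain e' where e': "orthonormal e e'" using exists_orthonormal[OF e dim2] by metis
  define l where "l = defect' a (K e) e"
  \<comment> \<open>The linear function is invariant under rotations fixing \<open>w\<close>, hence
    a multiple of \<open>w \<bullet> u\<close>, and rotations carry the same factor \<open>l\<close>
    to every axis.\<close>
  have def_eq: "defect' a (K w) u = l * (w \<bullet> u)" if w: "norm w = 1" for w u
  proof -
    obtain \<tau> where \<tau>: "\<And>u. defect' a (K w) u = \<tau> \<bullet> u" using lin[OF w] by blast
    obtain b q where b: "orthonormal w b" "u = (w \<bullet> u) *\<^sub>R w + q *\<^sub>R b"
      using exists_orthonormal_decomp[OF w dim2, of u] by metis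
    obtain g where g: "rotation_matrix g" "g *v w = w" "g *v b = - b"
      using rotation_pair[OF n3 b(1) orthonormal_minus[OF b(1)]] by blast
    have "\<tau> \<bullet> b = 0" using rot[OF w g(1), of b] g(2,3) by (simp add: \<tau>)
    moreover obtain h where h: "rotation_matrix h" "h *v e = w" "h *v e' = b"
      using rotation_pair[OF n3 e' b(1)] by blast
    have "\<tau> \<bullet> w = l" using rot[OF e h(1), of e] h(2) by (simp add: \<tau>[symmetric] l_def)
    moreover have "\<tau> \<bullet> u = (w \<bullet> u) * (\<tau> \<bullet> w) + q * (\<tau> \<bullet> b)"
      by (subst b(2)) (simp add: inner_add_right)
    ultimately show ?thesis by (simp add: \<tau>)
  qed
  have "l = 0"
  proof (rule SM_discrete_approximation)
    fix F :: "nat \<Rightarrow> (real^'n) set" and c :: "nat \<Rightarrow> real^'n \<Rightarrow> real"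
    assume F: "\<And>j. finite (F j)" "\<And>j. F j \<subseteq> sphere 0 1" "\<And>j p. 0 \<le> c j p"
      "\<And>g. continuous_on (sphere 0 1) g \<Longrightarrow> (\<lambda>j. \<Sum>p\<in>F j. c j p * g p) \<longlonglongrightarrow> SI g"
    have unit: "norm p = 1" if "p \<in> F j" for p j using F(2)[of j] that by auto
    have pos: "0 \<le> 1 + e \<bullet> p" if "norm p = 1" for p
      using Cauchy_Schwarz_ineq2[of e p] e that by simp
    \<comment> \<open>The term \<open>1\<close> keeps the weights nonnegative; the term
      \<open>e \<bullet> p\<close> prevents the defects of opposite axes from cancelling.\<close>
    define S where "S j = (\<Sum>p\<in>F j. (*\<^sub>R) (c j p * (1 + e \<bullet> p)) ` K p)" for j
    have nn: "0 \<le> c j p * (1 + e \<bullet> p)" if "p \<in> F j" for j p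
      using F(3) pos[OF unit[OF that]] by simp
    have S: "S j \<in> convex_bodies" for j
      unfolding S_def by (intro sum_convex_bodies F(1) scaleR_convex_bodies K unit)
    define k where "k = 1 + 2 * (real m)\<^sup>2"
    define N where "N i = SI (\<lambda>x. (x \<bullet> e) ^ i)" for i
    define m0 where "m0 = SI (\<lambda>x::real^'n. 1)"
    define \<kappa> where "\<kappa> = k * m0 + N m"
    \<comment> \<open>\<open>e\<close> is split into its parts along \<open>u\<close> and orthogonal
      to it; the orthogonal part enters linearly and integrates to zero. What remains is the support
      function of a ball plus a point.\<close>
    have moment: "SI (\<lambda>p. (1 + e \<bullet> p) * hs (K p) u) = \<kappa> * norm u + N (Suc m) * (e \<bullet> u)" for u
    proof (cases "u = 0")
      case True
      then have "SI (\<lambda>p. (1 + e \<bullet> p) * hs (K p) u) = SI (\<lambda>p::real^'n. 0)"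
        by (intro SI_cong) (simp add: hsK)
      then show ?thesis using True by simp
    next
      case False
      define v where "v = sgn u"
      have v: "norm v = 1" "u = norm u *\<^sub>R v" using False by (auto simp: v_def norm_sgn sgn_div_norm)
      obtain z d where z: "orthonormal v z" "e = (v \<bullet> e) *\<^sub>R v + d *\<^sub>R z"
        using exists_orthonormal_decomp[OF v(1) dim2, of e] by metis
      have c1: "continuous_on UNIV (\<lambda>(s::real, t::real). s ^ i)" for i
        unfolding case_prod_unfold by (auto intro!: continuous_intros)
      have c2: "continuous_on UNIV (\<lambda>(s::real, t::real). t * s ^ i)" for i
        unfolding case_prod_unfold by (auto intro!: continuous_intros)
      have Ni: "SI (\<lambda>x. (x \<bullet> v) ^ i) = N i" for i
        unfolding N_def by (rule SI_orthonormal_pair[OF z(1) e' c1])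
      have Z: "SI (\<lambda>x. (x \<bullet> z) * (x \<bullet> v) ^ i) = 0" for i
        using SI_orthonormal_pair[OF z(1) orthonormal_minus[OF z(1)] c2[of i]] by simp
      have int: "integrable SM (\<lambda>x. (x \<bullet> v) ^ i)" "integrable SM (\<lambda>x. (x \<bullet> z) * (x \<bullet> v) ^ i)"
        "integrable SM (\<lambda>x. x \<bullet> e)" "integrable SM (\<lambda>x::real^'n. 1::real)" for i
        by (intro SM_integrable continuous_intros)+
      have "SI (\<lambda>p. (1 + e \<bullet> p) * hs (K p) u)
          = SI (\<lambda>p. norm u * (k + k * (p \<bullet> e) + (p \<bullet> v) ^ m + (v \<bullet> e) * (p \<bullet> v) ^ Suc m + d * ((p \<bullet> z) * (p \<bullet> v) ^ m)))"
      proof (rule SI_cong)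
        fix p :: "real^'n" assume p: "norm p = 1"
        have ep: "e \<bullet> p = (v \<bullet> e) * (p \<bullet> v) + d * (p \<bullet> z)"
          by (subst z(2)) (simp add: inner_add_left inner_commute[of v p] inner_commute[of z p])
        have pe: "p \<bullet> e = (v \<bullet> e) * (p \<bullet> v) + d * (p \<bullet> z)" using ep by (simp add: inner_commute)
        show "(1 + e \<bullet> p) * hs (K p) u
          = norm u * (k + k * (p \<bullet> e) + (p \<bullet> v) ^ m + (v \<bullet> e) * (p \<bullet> v) ^ Suc m + d * ((p \<bullet> z) * (p \<bullet> v) ^ m))"
          unfolding hsK[OF p] k_def[symmetric] v_def[symmetric] ep pe by (simp add: algebra_simps)
      qed
      also have "\<dots> = norm u * (k * m0 + k * SI (\<lambda>p. p \<bullet> e) + N m + (v \<bullet> e) * N (Suc m) + d * 0)"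
        unfolding Ni[symmetric] Z[of m, symmetric] m0_def by (simp add: int del: power_Suc)
      also have "\<dots> = \<kappa> * norm u + N (Suc m) * (e \<bullet> u)"
      proof -
        have eu: "e \<bullet> u = norm u * (v \<bullet> e)"
          using arg_cong[OF v(2), of "inner e"] by (simp add: inner_commute[of e v])
        show ?thesis unfolding SI_inner \<kappa>_def eu by (simp add: algebra_simps)
      qed
      finally show ?thesis .
    qed
    have "0 \<le> \<kappa>"
    proof -
      have "0 \<le> SI (\<lambda>x. k + (x \<bullet> e) ^ m)"
      proof (rule SI_nonneg)
        fix x :: "real^'n" assume "norm x = 1"
        then have "\<bar>x \<bullet> e\<bar> ^ m \<le> 1" using Cauchy_Schwarz_ineq2[of x e] e by (intro power_le_one) auto
        then have "\<bar>(x \<bullet> e) ^ m\<bar> \<le> 1" by (simp add: power_abs)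
        moreover have "1 \<le> k" by (simp add: k_def)
        ultimately show "0 \<le> k + (x \<bullet> e) ^ m" by linarith
      qed
      also have "\<dots> = \<kappa>"
        unfolding \<kappa>_def N_def m0_def
        by (subst Bochner_Integration.integral_add) (auto intro!: SM_integrable continuous_intros)
      finally show ?thesis .
    qed
    define M where "M = (*\<^sub>R) \<kappa> ` cball 0 1 + {N (Suc m) *\<^sub>R e}"
    have M: "M \<in> convex_bodies" unfolding M_def by (intro set_plus_convex_bodies scaleR_convex_bodies) auto
    have "(\<lambda>j. defect' a (S j) e) \<longlonglongrightarrow> defect' a M e"
    proof (rule defect'_LIMSEQ[OF S M])
      fix u
      have cK: "continuous_on (sphere 0 1) (\<lambda>p. (1 + e \<bullet> p) * hs (K p) u)"
      proof -
        have "continuous_on (sphere 0 1) (\<lambda>p. (1 + e \<bullet> p) * (norm u * (p \<bullet> sgn u) ^ m + (1 + 2 * (real m)\<^sup>2) * norm u))"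
          by (intro continuous_intros)
        then show ?thesis by (rule continuous_on_eq) (simp add: hsK)
      qed
      have "hs (S j) u = (\<Sum>p\<in>F j. c j p * ((1 + e \<bullet> p) * hs (K p) u))" for j
      proof -
        have "hs (S j) u = (\<Sum>p\<in>F j. hs ((*\<^sub>R) (c j p * (1 + e \<bullet> p)) ` K p) u)"
          unfolding S_def by (intro hs_sum F(1) scaleR_convex_bodies K unit)
        also have "\<dots> = (\<Sum>p\<in>F j. c j p * ((1 + e \<bullet> p) * hs (K p) u))"
          by (intro sum.cong refl) (simp add: hs_scaleR K unit nn mult.assoc)
        finally show ?thesis .
      qed
      moreover have "hs M u = \<kappa> * norm u + N (Suc m) * (e \<bullet> u)"
        unfolding M_def using \<open>0 \<le> \<kappa>\<close> by (simp add: hs_plus scaleR_convex_bodies hs_scaleR inner_commute)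
      ultimately show "(\<lambda>j. hs (S j) u) \<longlonglongrightarrow> hs M u"
        using F(4)[OF cK] unfolding moment by (simp only:)
    qed
    moreover have "defect' a M e = 0"
      unfolding M_def using \<open>0 \<le> \<kappa>\<close>
      by (simp add: defect'_add scaleR_convex_bodies defect'_scale defect'_cball defect'_point)
    \<comment> \<open>Evaluated term by term, the same limit is \<open>l\<close> times the second
      moment of \<open>p \<bullet> e\<close>, which is positive.\<close>
    moreover have "(\<lambda>j. defect' a (S j) e) \<longlonglongrightarrow> l * ballvol TYPE(real^'n)"
    proof -
      have "defect' a (S j) e = (\<Sum>p\<in>F j. c j p * ((1 + e \<bullet> p) * (l * (p \<bullet> e))))" for j
      proof -
        have "defect' a (S j) e = (\<Sum>p\<in>F j. defect' a ((*\<^sub>R) (c j p * (1 + e \<bullet> p)) ` K p) e)"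
          unfolding S_def by (intro defect'_sum F(1) scaleR_convex_bodies K unit)
        also have "\<dots> = (\<Sum>p\<in>F j. c j p * ((1 + e \<bullet> p) * (l * (p \<bullet> e))))"
          by (intro sum.cong refl) (simp add: defect'_scale K unit nn def_eq mult.assoc)
        finally show ?thesis .
      qed
      moreover have "(\<lambda>j. \<Sum>p\<in>F j. c j p * ((1 + e \<bullet> p) * (l * (p \<bullet> e)))) \<longlonglongrightarrow> SI (\<lambda>p. (1 + e \<bullet> p) * (l * (p \<bullet> e)))"
        by (intro F(4) continuous_intros)
      moreover have "SI (\<lambda>p. (1 + e \<bullet> p) * (l * (p \<bullet> e))) = l * ballvol TYPE(real^'n)"
      proof -
        have "SI (\<lambda>p. (1 + e \<bullet> p) * (l * (p \<bullet> e))) = SI (\<lambda>p. l * (p \<bullet> e) + l * ((p \<bullet> e) * (p \<bullet> e)))"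
          by (rule SI_cong) (simp add: inner_commute[of e] algebra_simps)
        also have "\<dots> = l * SI (\<lambda>p. p \<bullet> e) + l * SI (\<lambda>p. (p \<bullet> e) * (p \<bullet> e))"
          by (subst Bochner_Integration.integral_add) (auto intro!: SM_integrable continuous_intros)
        finally show ?thesis using e by (simp add: SI_inner SI_inner_inner[OF dim2] dot_square_norm)
      qed
      ultimately show ?thesis by simp
    qed
    ultimately have "l * ballvol TYPE(real^'n) = 0" using LIMSEQ_unique by metis
    then show "l = 0" using ballvol_pos[where 'a = "real^'n"] by simp
  qed
  then show ?thesis using K[OF w] def_eq[OF w] by (simp add: good_full_def)
qed

theorem H_formula:
  "\<exists>a b. 0 \<le> a \<and> 0 \<le> b \<and> a + b > 0 \<and>
    (\<forall>K\<in>convex_bodies. \<forall>u. H K u = a * hs K u + b * hs K (- u) + (b - a) * (steiner_point K \<bullet> u))"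
proof -
  obtain a where a: "0 \<le> a" "a \<le> \<alpha>" "\<And>x y. indep x y \<Longrightarrow> coef x y a" using uniform_coef by blast
  interpret good_bodies "good_full a" by (rule good_full_good_bodies)
  have "gf (\<lambda>u. norm u * (w \<bullet> sgn u) ^ m)" if w: "norm w = 1" for w m
  proof -
    \<comment> \<open>\<open>1 + 2 * (real m)\<^sup>2\<close> is the value of \<open>A + C\<close>
      in \<open>circ_C2_inner_power\<close>; this multiple of the norm makes the zonal function
      sublinear.\<close>
    define P where "P w K \<longleftrightarrow> K \<in> convex_bodies \<and>
      hs K = (\<lambda>u. norm u * (w \<bullet> sgn u) ^ m + (1 + 2 * (real m)\<^sup>2) * norm u)" for w :: "real^'n" and K
    have "\<exists>K. P w K" if "norm w = 1" for w
      unfolding P_def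
      by (rule ex_hs_eq, rule circ_C2_sublinear[OF circ_C2_inner_power[OF that] dim2]) simp
    then have P: "P w (SOME K. P w K)" if "norm w = 1" for w using someI_ex[of "P w"] that by blast
    define K where "K w = (SOME K. P w K)" for w
    have P_K: "P w (K w)" if "norm w = 1" for w unfolding K_def by (rule P[OF that])
    have K: "K w \<in> convex_bodies" "hs (K w) u = norm u * (w \<bullet> sgn u) ^ m + (1 + 2 * (real m)\<^sup>2) * norm u"
      if "norm w = 1" for w u
      using P_K[OF that] unfolding P_def by simp_all
    have "good_full a (K w)" by (rule good_full_zonal[OF a(3) K w])
    from gf_diff[OF gf_hs[OF this] gf_cmult[OF gf_norm]]
    have "gf (\<lambda>u. hs (K w) u - (1 + 2 * (real m)\<^sup>2) * norm u)" .
    then show ?thesis by (simp add: K(2)[OF w])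
  qed
  then have full: "good_full a K" if "K \<in> convex_bodies" for K by (rule good_all[OF _ that])
  have "H K u = a * hs K u + (\<alpha> - a) * hs K (- u) + ((\<alpha> - a) - a) * (steiner_point K \<bullet> u)"
    if "K \<in> convex_bodies" for K u
    using full[OF that] by (simp add: good_full_def defect'_def defect_def algebra_simps)
  then show ?thesis using a(1,2) \<alpha>(1) by (intro exI[of _ a] exI[of _ "\<alpha> - a"]) auto
qed

end

section \<open>The volume of the difference body\<close>

lemma emeasure_lborel_convex_body:
  assumes "K \<in> convex_bodies"
  shows "emeasure lborel K = ennreal (measure lebesgue K)"
proof -
  have "emeasure lebesgue K = ennreal (measure lebesgue K)"
    by (rule emeasure_eq_measure2[OF lmeasurable_compact[OF convex_bodiesD(2)[OF assms]]])
  moreover have "K \<in> sets lborel" using convex_bodiesD(4)[OF assms] by simp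
  ultimately show ?thesis by simp
qed

lemma affine_image_convex_bodies:
  assumes "K \<in> convex_bodies"
  shows "(\<lambda>x. c *\<^sub>R x + t) ` K \<in> convex_bodies"
proof -
  have "(\<lambda>x. c *\<^sub>R x + t) ` K = (\<lambda>x. x + t) ` ((*\<^sub>R) c ` K)" by (simp add: image_image)
  then show ?thesis
    using linear_image_convex_bodies[OF assms linear_scale_self] by (simp add: translation_convex_bodies)
qed

lemma difference_body_convex_bodies [intro]: "K \<in> convex_bodies \<Longrightarrow> difference_body K \<in> convex_bodies"
  unfolding difference_body_def by (intro set_plus_convex_bodies uminus_convex_bodies)

lemma hs_difference_body: "K \<in> convex_bodies \<Longrightarrow> hs (difference_body K) u = hs K u + hs K (- u)"
  by (simp add: difference_body_def hs_plus uminus_convex_bodies hs_uminus)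

lemma measure_mono_convex_bodies:
  "K \<in> convex_bodies \<Longrightarrow> L \<in> convex_bodies \<Longrightarrow> K \<subseteq> L \<Longrightarrow> measure lebesgue K \<le> measure lebesgue L"
  by (rule measure_mono_fmeasurable) (auto simp: convex_bodiesD lmeasurable_compact fmeasurableD)

text \<open>Integrate the volume of \<open>K \<inter> (K + z)\<close>: the integral over all \<open>z\<close> is the square of the
  volume of \<open>K\<close>, and for \<open>z\<close> in half the difference body the intersection contains a
  translate of half of \<open>K\<close>.\<close>

lemma measure_difference_body_le:
  fixes K :: "'a::euclidean_space set"
  assumes K: "K \<in> convex_bodies"
  shows "measure lebesgue (difference_body K) \<le> 4 ^ DIM('a) * measure lebesgue K"
proof -
  \<comment> \<open>Halving enters twice, for the difference body and for the copies of
    \<open>K\<close> inside the intersections; the two factors \<open>c\<close> account for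
    \<open>4 ^ DIM('a)\<close>.\<close>
  define c :: real where "c = (1/2) ^ DIM('a)"
  define D where "D = difference_body K"
  have D: "D \<in> convex_bodies" unfolding D_def by (rule difference_body_convex_bodies[OF K])
  define S where "S = (\<lambda>x. (1/2) *\<^sub>R x + 0) ` D"
  have S: "S \<in> convex_bodies" unfolding S_def by (rule affine_image_convex_bodies[OF D])
  have [measurable]: "K \<in> sets borel" "S \<in> sets borel"
    using convex_bodiesD(4)[OF K] convex_bodiesD(4)[OF S] by simp_all
  have mS: "measure lebesgue S = c * measure lebesgue D"
    unfolding S_def c_def using measure_lebesgue_affine[of "1/2" 0 D] by simp
  have inner: "ennreal (c * measure lebesgue K) \<le> (\<integral>\<^sup>+x. indicator K x * indicator K (x - z) \<partial>lborel)"
    if z: "z \<in> S" for z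
  proof -
    obtain x y where xy: "x \<in> K" "y \<in> K" "z = (1/2) *\<^sub>R (x - y)"
      using z by (auto simp: S_def D_def difference_body_def set_plus_def)
    \<comment> \<open>Midpoints of \<open>K\<close> with \<open>x\<close> lie in \<open>K\<close>,
      and subtracting \<open>z\<close> turns them into midpoints with \<open>y\<close>.\<close>
    define T where "T = (\<lambda>k. (1/2) *\<^sub>R k + (1/2) *\<^sub>R x) ` K"
    have T: "T \<in> convex_bodies" unfolding T_def by (rule affine_image_convex_bodies[OF K])
    have [measurable]: "T \<in> sets borel" using convex_bodiesD(4)[OF T] by simp
    have in_T: "w \<in> K \<and> w - z \<in> K" if w: "w \<in> T" for w
    proof -
      obtain k where k: "k \<in> K" "w = (1/2) *\<^sub>R k + (1/2) *\<^sub>R x" using w unfolding T_def by blast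
      have wz: "w - z = (1/2) *\<^sub>R k + (1/2) *\<^sub>R y" by (simp add: k xy scaleR_diff_right)
      show ?thesis
        unfolding wz using convexD[OF convex_bodiesD(3)[OF K] k(1) xy(1), of "1/2" "1/2"]
          convexD[OF convex_bodiesD(3)[OF K] k(1) xy(2), of "1/2" "1/2"] k(2) by simp
    qed
    have "measure lebesgue T = c * measure lebesgue K"
      unfolding T_def c_def using measure_lebesgue_affine[of "1/2" "(1/2) *\<^sub>R x" K] by simp
    then have "ennreal (c * measure lebesgue K) = (\<integral>\<^sup>+x. indicator T x \<partial>lborel)"
      using emeasure_lborel_convex_body[OF T] by simp
    also have "\<dots> \<le> (\<integral>\<^sup>+x. indicator K x * indicator K (x - z) \<partial>lborel)"
      by (rule nn_integral_mono) (use in_T in \<open>auto simp: indicator_def\<close>)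
    finally show ?thesis .
  qed
  have refl: "(\<integral>\<^sup>+z. indicator K (x - z) \<partial>lborel) = ennreal (measure lebesgue K)" for x
  proof -
    define R where "R = (\<lambda>k. (- 1) *\<^sub>R k + x) ` K"
    have R: "R \<in> convex_bodies" unfolding R_def by (rule affine_image_convex_bodies[OF K])
    have [measurable]: "R \<in> sets borel" using convex_bodiesD(4)[OF R] by simp
    have "x - z \<in> K \<longleftrightarrow> z \<in> R" for z
    proof
      assume "x - z \<in> K"
      moreover have "z = (- 1) *\<^sub>R (x - z) + x" by simp
      ultimately show "z \<in> R" unfolding R_def by (rule rev_image_eqI)
    qed (auto simp: R_def)
    then have "(\<integral>\<^sup>+z. indicator K (x - z) \<partial>lborel) = (\<integral>\<^sup>+z. indicator R z \<partial>lborel)"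
      by (intro nn_integral_cong) (simp add: indicator_def)
    also have "\<dots> = ennreal (measure lebesgue R)" using emeasure_lborel_convex_body[OF R] by simp
    also have "measure lebesgue R = measure lebesgue K"
      unfolding R_def using measure_lebesgue_affine[of "- 1" x K] by simp
    finally show ?thesis .
  qed
  have "ennreal (c * measure lebesgue K) * ennreal (c * measure lebesgue D)
      = (\<integral>\<^sup>+z. ennreal (c * measure lebesgue K) * indicator S z \<partial>lborel)"
    using emeasure_lborel_convex_body[OF S] by (simp add: nn_integral_cmult mS)
  also have "\<dots> \<le> (\<integral>\<^sup>+z. \<integral>\<^sup>+x. indicator K x * indicator K (x - z) \<partial>lborel \<partial>lborel)"
    by (rule nn_integral_mono) (use inner in \<open>auto simp: indicator_def\<close>)
  also have "\<dots> = (\<integral>\<^sup>+x. \<integral>\<^sup>+z. indicator K x * indicator K (x - z) \<partial>lborel \<partial>lborel)"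
    by (rule lborel_pair.Fubini') measurable
  also have "\<dots> = (\<integral>\<^sup>+x. indicator K x * ennreal (measure lebesgue K) \<partial>lborel)"
    by (simp add: nn_integral_cmult refl)
  also have "\<dots> = ennreal (measure lebesgue K) * ennreal (measure lebesgue K)"
    using emeasure_lborel_convex_body[OF K] by (simp add: nn_integral_multc)
  finally have "ennreal ((c * measure lebesgue K) * (c * measure lebesgue D))
      \<le> ennreal (measure lebesgue K * measure lebesgue K)"
    by (simp add: ennreal_mult c_def)
  then have le: "(c * measure lebesgue K) * (c * measure lebesgue D) \<le> measure lebesgue K * measure lebesgue K"
    by (simp add: ennreal_le_iff)
  have cc: "c * c * 4 ^ DIM('a) = 1" by (simp add: c_def power_mult_distrib[symmetric])
  show ?thesis
  proof (cases "measure lebesgue K = 0")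
    \<comment> \<open>The volume of \<open>K\<close> cannot be divided out here; instead the
      difference body is flat in the same direction as \<open>K\<close>.\<close>
    case True
    then obtain u where u: "u \<noteq> 0" "wd K u = 0" using measure_eq_0_iff_wd[OF K] by blast
    then have "wd D u = 0" by (simp add: wd_def D_def hs_difference_body K)
    then have "measure lebesgue D = 0" using measure_eq_0_iff_wd[OF D] u(1) by blast
    then show ?thesis by (simp add: D_def)
  next
    case False
    then have pos: "0 < measure lebesgue K" using measure_nonneg[of lebesgue K] by linarith
    have "measure lebesgue K * (c * c * measure lebesgue D) \<le> measure lebesgue K * measure lebesgue K"
      using le by (simp add: mult_ac)
    then have "c * c * measure lebesgue D \<le> measure lebesgue K" using pos by simp
    then have le': "4 ^ DIM('a) * (c * c * measure lebesgue D) \<le> 4 ^ DIM('a) * measure lebesgue K" by simp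
    have "measure lebesgue D = (c * c * 4 ^ DIM('a)) * measure lebesgue D" by (simp only: cc mult_1_left)
    also have "\<dots> = 4 ^ DIM('a) * (c * c * measure lebesgue D)" by (simp only: mult_ac)
    also note le'
    finally show ?thesis by (simp only: D_def)
  qed
qed

section \<open>The operators of the theorem\<close>

definition steiner_comb :: "real \<Rightarrow> real \<Rightarrow> 'a::euclidean_space set \<Rightarrow> 'a set" where
  "steiner_comb a b K = (\<lambda>x. a *\<^sub>R (x - steiner_point K)) ` K + (\<lambda>x. b *\<^sub>R (- x + steiner_point K)) ` K"

lemma steiner_comb_eq:
  "steiner_comb a b K = (\<lambda>x. a *\<^sub>R x + (- (a *\<^sub>R steiner_point K))) ` K
    + (\<lambda>x. (- b) *\<^sub>R x + b *\<^sub>R steiner_point K) ` K"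
  by (simp add: steiner_comb_def algebra_simps)

lemma steiner_comb_convex_bodies [intro]: "K \<in> convex_bodies \<Longrightarrow> steiner_comb a b K \<in> convex_bodies"
  unfolding steiner_comb_eq by (intro set_plus_convex_bodies affine_image_convex_bodies)

lemma hs_affine_image:
  assumes K: "K \<in> convex_bodies"
  shows "hs ((\<lambda>x. c *\<^sub>R x + t) ` K) u = hs K (c *\<^sub>R u) + u \<bullet> t"
proof -
  have "(\<lambda>x. c *\<^sub>R x + t) ` K = (\<lambda>x. x + t) ` ((*\<^sub>R) c ` K)" by (simp add: image_image)
  moreover have "hs ((*\<^sub>R) c ` K) u = hs K (c *\<^sub>R u)"
    by (rule hs_linear_image[OF K linear_scale_self]) simp
  ultimately show ?thesis
    using hs_translation[OF linear_image_convex_bodies[OF K linear_scale_self[of c]], of t u] by simp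
qed

lemma hs_steiner_comb:
  assumes K: "K \<in> convex_bodies" and ab: "0 \<le> a" "0 \<le> b"
  shows "hs (steiner_comb a b K) u = a * hs K u + b * hs K (- u) + (b - a) * (steiner_point K \<bullet> u)"
proof -
  have "hs K (a *\<^sub>R u) = a * hs K u" "hs K ((- b) *\<^sub>R u) = b * hs K (- u)"
    using sublinearD(2)[OF sublinear_hs[OF K] ab(1), of u]
      sublinearD(2)[OF sublinear_hs[OF K] ab(2), of "- u"] by simp_all
  then show ?thesis
    unfolding steiner_comb_eq hs_plus[OF affine_image_convex_bodies[OF K] affine_image_convex_bodies[OF K]]
      hs_affine_image[OF K]
    by (simp add: inner_commute[of u] algebra_simps)
qed

lemma hausdorff_continuous_steiner_comb:
  assumes ab: "0 \<le> a" "0 \<le> b"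
  shows "hausdorff_continuous (steiner_comb a b :: 'a::euclidean_space set \<Rightarrow> _)"
  unfolding hausdorff_continuous_def
proof (intro ballI allI impI)
  fix K :: "'a set" and e :: real assume K: "K \<in> convex_bodies" and e: "0 < e"
  define C where "C = a + b + \<bar>b - a\<bar> * real DIM('a)"
  have C: "0 \<le> C" using ab by (simp add: C_def)
  have lip: "hausdorff_dist (steiner_comb a b L) (steiner_comb a b K) \<le> C * hausdorff_dist L K"
    if L: "L \<in> convex_bodies" for L
  proof (rule hausdorff_dist_le[OF steiner_comb_convex_bodies[OF L] steiner_comb_convex_bodies[OF K]])
    define d where "d = hausdorff_dist L K"
    have d: "0 \<le> d" unfolding d_def by (rule hausdorff_dist_nonneg[OF L K])
    show "0 \<le> C * hausdorff_dist L K" using C d by (simp add: d_def)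
    fix u :: 'a assume u: "norm u = 1"
    have 1: "\<bar>hs L u - hs K u\<bar> \<le> d" "\<bar>hs L (- u) - hs K (- u)\<bar> \<le> d"
      using hs_diff_le_hausdorff_dist[OF L K, of u] hs_diff_le_hausdorff_dist[OF L K, of "- u"] u
      by (simp_all add: d_def)
    have "\<bar>(steiner_point L - steiner_point K) \<bullet> u\<bar> \<le> norm (steiner_point L - steiner_point K)"
      using Cauchy_Schwarz_ineq2[of "steiner_point L - steiner_point K" u] u by simp
    also have "\<dots> \<le> real DIM('a) * d" unfolding d_def by (rule steiner_point_lipschitz[OF L K])
    finally have 2: "\<bar>(steiner_point L - steiner_point K) \<bullet> u\<bar> \<le> real DIM('a) * d" .
    have "hs (steiner_comb a b L) u - hs (steiner_comb a b K) u
        = a * (hs L u - hs K u) + b * (hs L (- u) - hs K (- u))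
          + (b - a) * ((steiner_point L - steiner_point K) \<bullet> u)"
      by (simp add: hs_steiner_comb K L ab inner_diff_left algebra_simps)
    also have "\<bar>\<dots>\<bar> \<le> \<bar>a * (hs L u - hs K u)\<bar> + \<bar>b * (hs L (- u) - hs K (- u))\<bar>
        + \<bar>(b - a) * ((steiner_point L - steiner_point K) \<bullet> u)\<bar>" by linarith
    also have "\<dots> \<le> a * d + b * d + \<bar>b - a\<bar> * (real DIM('a) * d)"
      unfolding abs_mult using 1 2 ab by (intro add_mono mult_mono) auto
    also have "\<dots> = C * d" by (simp add: C_def algebra_simps)
    finally show "\<bar>hs (steiner_comb a b L) u - hs (steiner_comb a b K) u\<bar> \<le> C * hausdorff_dist L K"
      by (simp add: d_def)
  qed
  \<comment> \<open>The divisor \<open>C + 1\<close> is positive even when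
    \<open>a = b = 0\<close>.\<close>
  show "\<exists>\<delta>>0. \<forall>L\<in>convex_bodies. hausdorff_dist L K < \<delta> \<longrightarrow>
      hausdorff_dist (steiner_comb a b L) (steiner_comb a b K) < e"
  proof (intro exI[of _ "e / (C + 1)"] conjI ballI impI)
    show "0 < e / (C + 1)" using e C by simp
    fix L :: "'a set" assume L: "L \<in> convex_bodies" "hausdorff_dist L K < e / (C + 1)"
    have "C * hausdorff_dist L K \<le> (C + 1) * hausdorff_dist L K"
      using hausdorff_dist_nonneg[OF L(1) K] by (simp add: algebra_simps)
    also have "\<dots> < e" using L(2) C by (simp add: pos_less_divide_eq mult.commute)
    finally show "hausdorff_dist (steiner_comb a b L) (steiner_comb a b K) < e" using lip[OF L(1)] by linarith
  qed
qed

lemma minkowski_endomorphism_steiner_comb: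
  assumes n: "CARD('n::finite) \<ge> 2" and ab: "0 \<le> a" "0 \<le> b"
  shows "minkowski_endomorphism (steiner_comb a b :: (real^'n) set \<Rightarrow> _)"
  unfolding minkowski_endomorphism_def
proof (intro conjI ballI allI impI)
  show "steiner_comb a b \<in> convex_bodies \<rightarrow> (convex_bodies :: (real^'n) set set)" by auto
  show "hausdorff_continuous (steiner_comb a b :: (real^'n) set \<Rightarrow> _)"
    by (rule hausdorff_continuous_steiner_comb[OF ab])
  have dim: "DIM(real^'n) \<ge> 2" using n by simp
  fix K :: "(real^'n) set" assume K: "K \<in> convex_bodies"
  show "steiner_comb a b ((\<lambda>x. x + t) ` K) = steiner_comb a b K" for t
  proof (rule hs_inject)
    fix u
    show "hs (steiner_comb a b ((\<lambda>x. x + t) ` K)) u = hs (steiner_comb a b K) u"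
      unfolding hs_steiner_comb[OF translation_convex_bodies[OF K] ab] hs_steiner_comb[OF K ab]
        steiner_point_translation[OF dim K] hs_translation[OF K]
      by (simp add: inner_add_left inner_commute[of t] algebra_simps)
  qed (intro steiner_comb_convex_bodies translation_convex_bodies K)+
  show "steiner_comb a b (K + L) = steiner_comb a b K + steiner_comb a b L" if L: "L \<in> convex_bodies" for L
  proof (rule hs_inject)
    fix u
    show "hs (steiner_comb a b (K + L)) u = hs (steiner_comb a b K + steiner_comb a b L) u"
      unfolding hs_steiner_comb[OF set_plus_convex_bodies[OF K L] ab]
        hs_plus[OF steiner_comb_convex_bodies[OF K] steiner_comb_convex_bodies[OF L]]
        hs_steiner_comb[OF K ab] hs_steiner_comb[OF L ab] hs_plus[OF K L] steiner_point_plus[OF K L]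
      by (simp add: inner_add_left algebra_simps)
  qed (intro steiner_comb_convex_bodies set_plus_convex_bodies K L)+
  show "steiner_comb a b ((*v) g ` K) = (*v) g ` steiner_comb a b K" if g: "rotation_matrix g" for g
  proof (rule hs_inject)
    fix u
    have "transpose g *v (- u) = - (transpose g *v u)" by (simp add: vec.neg)
    then show "hs (steiner_comb a b ((*v) g ` K)) u = hs ((*v) g ` steiner_comb a b K) u"
      unfolding hs_steiner_comb[OF matrix_convex_bodies[OF K] ab] hs_matrix[OF steiner_comb_convex_bodies[OF K]]
        hs_steiner_comb[OF K ab] hs_matrix[OF K] steiner_point_rotation[OF K g] inner_transpose
      by simp
  qed (intro steiner_comb_convex_bodies matrix_convex_bodies K)+
qed

lemma volume_constraint_steiner_comb:
  assumes ab: "0 \<le> a" "0 \<le> b" "0 < a + b"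
  shows "volume_constraint (steiner_comb a b :: 'a::euclidean_space set \<Rightarrow> _)"
proof -
  have bounds: "max a b ^ DIM('a) * measure lebesgue K \<le> measure lebesgue (steiner_comb a b K)"
    "measure lebesgue (steiner_comb a b K) \<le> ((a + b) ^ DIM('a) * 4 ^ DIM('a)) * measure lebesgue K"
    if K: "K \<in> convex_bodies" for K :: "'a set"
  proof -
    define s where "s = steiner_point K"
    obtain x0 where x0: "x0 \<in> K" using convex_bodiesD(1)[OF K] by auto
    have aff: "\<bar>c\<bar> ^ DIM('a) * measure lebesgue K \<le> measure lebesgue (steiner_comb a b K)"
      if "(\<lambda>x. c *\<^sub>R x + t) ` K \<subseteq> steiner_comb a b K" for c t
      using measure_mono_convex_bodies[OF affine_image_convex_bodies[OF K] steiner_comb_convex_bodies[OF K] that]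
        measure_lebesgue_affine[of c t K] by simp
    have "(\<lambda>x. a *\<^sub>R x + (- (a *\<^sub>R s) + ((- b) *\<^sub>R x0 + b *\<^sub>R s))) ` K \<subseteq> steiner_comb a b K"
      unfolding steiner_comb_eq s_def[symmetric] using x0 by (force simp: set_plus_def add.assoc)
    then have "\<bar>a\<bar> ^ DIM('a) * measure lebesgue K \<le> measure lebesgue (steiner_comb a b K)" by (rule aff)
    moreover have "(\<lambda>x. (- b) *\<^sub>R x + (b *\<^sub>R s + (a *\<^sub>R x0 + - (a *\<^sub>R s)))) ` K \<subseteq> steiner_comb a b K"
    proof (rule image_subsetI)
      fix x assume "x \<in> K"
      then have "(a *\<^sub>R x0 + - (a *\<^sub>R s)) + ((- b) *\<^sub>R x + b *\<^sub>R s) \<in> steiner_comb a b K"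
        unfolding steiner_comb_eq s_def[symmetric] using x0 by (intro set_plus_intro imageI)
      then show "(- b) *\<^sub>R x + (b *\<^sub>R s + (a *\<^sub>R x0 + - (a *\<^sub>R s))) \<in> steiner_comb a b K"
        by (simp add: algebra_simps)
    qed
    then have "\<bar>- b\<bar> ^ DIM('a) * measure lebesgue K \<le> measure lebesgue (steiner_comb a b K)" by (rule aff)
    ultimately show "max a b ^ DIM('a) * measure lebesgue K \<le> measure lebesgue (steiner_comb a b K)"
      using ab by (simp add: max_def)
    define t where "t = (a - b) *\<^sub>R (x0 - s)"
    have "steiner_comb a b K \<subseteq> (\<lambda>z. (a + b) *\<^sub>R z + t) ` difference_body K"
    proof
      fix w assume "w \<in> steiner_comb a b K"
      then obtain x y where xy: "x \<in> K" "y \<in> K" "w = a *\<^sub>R (x - s) + b *\<^sub>R (- y + s)"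
        by (auto simp: steiner_comb_def s_def set_plus_def)
      \<comment> \<open>The weights make \<open>(a + b) *\<^sub>R (p - q)\<close> equal to
        \<open>a *\<^sub>R x - b *\<^sub>R y\<close> up to a multiple of \<open>x0\<close>, which
        the fixed translation \<open>t\<close> absorbs.\<close>
      define p where "p = (b / (a + b)) *\<^sub>R x0 + (a / (a + b)) *\<^sub>R x"
      define q where "q = (a / (a + b)) *\<^sub>R x0 + (b / (a + b)) *\<^sub>R y"
      have sum1: "a / (a + b) + b / (a + b) = 1" using ab by (simp add: add_divide_distrib[symmetric])
      have pq: "p \<in> K" "q \<in> K"
        unfolding p_def q_def using ab sum1
        by (auto intro!: convexD[OF convex_bodiesD(3)[OF K]] x0 xy simp: add.commute)
      have "(a + b) *\<^sub>R p = b *\<^sub>R x0 + a *\<^sub>R x" "(a + b) *\<^sub>R q = a *\<^sub>R x0 + b *\<^sub>R y"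
        using ab by (simp_all add: p_def q_def scaleR_add_right)
      then have "w = (a + b) *\<^sub>R (p + - q) + t"
        unfolding t_def xy(3) by (simp add: scaleR_diff_right algebra_simps)
      moreover have "p + - q \<in> difference_body K"
        unfolding difference_body_def using pq by (intro set_plus_intro imageI)
      ultimately show "w \<in> (\<lambda>z. (a + b) *\<^sub>R z + t) ` difference_body K" by (rule image_eqI)
    qed
    from measure_mono_convex_bodies[OF steiner_comb_convex_bodies[OF K]
        affine_image_convex_bodies[OF difference_body_convex_bodies[OF K]] this]
    have "measure lebesgue (steiner_comb a b K) \<le> (a + b) ^ DIM('a) * measure lebesgue (difference_body K)"
      using measure_lebesgue_affine[of "a + b" t "difference_body K"] ab by simp
    also have "\<dots> \<le> (a + b) ^ DIM('a) * (4 ^ DIM('a) * measure lebesgue K)"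
      using ab by (intro mult_left_mono measure_difference_body_le[OF K]) simp
    finally show "measure lebesgue (steiner_comb a b K) \<le> ((a + b) ^ DIM('a) * 4 ^ DIM('a)) * measure lebesgue K"
      by (simp add: mult.assoc)
  qed
  have "0 < max a b" using ab by linarith
  then have pos: "0 < max a b ^ DIM('a)" by (rule zero_less_power)
  have pos': "0 < (a + b) ^ DIM('a) * 4 ^ DIM('a)" using ab(3) by simp
  show ?thesis
    unfolding volume_constraint_def
    by (rule exI[of _ "max a b ^ DIM('a)"], rule conjI[OF pos],
        rule exI[of _ "(a + b) ^ DIM('a) * 4 ^ DIM('a)"], rule conjI[OF pos'], intro ballI conjI bounds)
qed

text \<open>A formula for the operator is given on convex bodies only, so \<open>\<Phi>\<close> and
  \<open>\<Psi>\<close> may differ elsewhere; both properties look at convex bodies alone.\<close>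

lemma endomorphism_vc_cong:
  assumes eq: "\<And>K. K \<in> convex_bodies \<Longrightarrow> \<Phi> K = \<Psi> K"
    and \<Psi>: "minkowski_endomorphism \<Psi>" "volume_constraint \<Psi>"
  shows "minkowski_endomorphism \<Phi> \<and> volume_constraint \<Phi>"
proof
  show "minkowski_endomorphism \<Phi>"
    unfolding minkowski_endomorphism_def
  proof (intro conjI ballI allI impI)
    show "\<Phi> \<in> convex_bodies \<rightarrow> convex_bodies"
      using \<Psi>(1) eq by (auto simp: minkowski_endomorphism_def)
    have "hausdorff_continuous \<Psi>" using \<Psi>(1) by (simp only: minkowski_endomorphism_def)
    then show "hausdorff_continuous \<Phi>"
      unfolding hausdorff_continuous_def by (simp add: eq cong: ball_cong)
    fix K :: "(real^'a) set" assume K: "K \<in> convex_bodies"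
    show "\<Phi> ((\<lambda>x. x + t) ` K) = \<Phi> K" for t
      unfolding eq[OF K] eq[OF translation_convex_bodies[OF K]]
      using \<Psi>(1) K by (simp add: minkowski_endomorphism_def)
    show "\<Phi> (K + L) = \<Phi> K + \<Phi> L" if L: "L \<in> convex_bodies" for L
      unfolding eq[OF K] eq[OF L] eq[OF set_plus_convex_bodies[OF K L]]
      using \<Psi>(1) K L by (simp add: minkowski_endomorphism_def)
    show "\<Phi> ((*v) g ` K) = (*v) g ` \<Phi> K" if g: "rotation_matrix g" for g
      unfolding eq[OF K] eq[OF matrix_convex_bodies[OF K]]
      using \<Psi>(1) K g by (simp add: minkowski_endomorphism_def)
  qed
  show "volume_constraint \<Phi>"
    using \<Psi>(2) unfolding volume_constraint_def by (simp add: eq cong: ball_cong)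
qed

lemma (in vc_endomorphism) exists_steiner_comb:
  "\<exists>a b. 0 \<le> a \<and> 0 \<le> b \<and> a + b > 0 \<and> (\<forall>K\<in>convex_bodies. \<Phi> K = steiner_comb a b K)"
proof -
  obtain a b where ab: "0 \<le> a" "0 \<le> b" "a + b > 0"
    and H: "\<forall>K\<in>convex_bodies. \<forall>u. H K u = a * hs K u + b * hs K (- u) + (b - a) * (steiner_point K \<bullet> u)"
    using H_formula by blast
  have "\<Phi> K = steiner_comb a b K" if K: "K \<in> convex_bodies" for K
  proof (rule hs_inject[OF body[OF K] steiner_comb_convex_bodies[OF K]])
    show "hs (\<Phi> K) u = hs (steiner_comb a b K) u" for u
      unfolding hs_steiner_comb[OF K ab(1,2)] using bspec[OF H K] by (rule spec)
  qed
  then show ?thesis using ab by (intro exI[of _ a] exI[of _ b]) simp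
qed

text \<open>With equal coefficients the two translations by the Steiner point cancel.\<close>

lemma steiner_comb_same:
  assumes K: "K \<in> convex_bodies" and c: "0 \<le> c"
  shows "steiner_comb c c K = (*\<^sub>R) c ` difference_body K"
  by (rule hs_inject)
    (simp_all add: K c steiner_comb_convex_bodies scaleR_convex_bodies difference_body_convex_bodies
      hs_steiner_comb hs_scaleR hs_difference_body distrib_left)

text \<open>A triangle has no center of symmetry.\<close>

lemma steiner_comb_symmetric_imp_eq:
  fixes a b :: real
  assumes n: "CARD('n::finite) \<ge> 2" and ab: "0 \<le> a" "0 \<le> b"
    and sym: "\<And>K :: (real^'n) set. K \<in> convex_bodies \<Longrightarrow> steiner_comb a b K = uminus ` steiner_comb a b K"
  shows "a = b"
proof (rule ccontr)
  assume ne: "a \<noteq> b"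
  have odd: "hs K u - hs K (- u) = 2 * (steiner_point K \<bullet> u)" if K: "K \<in> convex_bodies" for K :: "(real^'n) set" and u
  proof -
    have "hs (steiner_comb a b K) u = hs (steiner_comb a b K) (- u)"
      using arg_cong[OF sym[OF K], of "\<lambda>K. hs K u"] hs_uminus[OF steiner_comb_convex_bodies[OF K], of a b u] by simp
    then have "(a - b) * (hs K u - hs K (- u) - 2 * (steiner_point K \<bullet> u)) = 0"
      by (simp add: hs_steiner_comb K ab algebra_simps)
    then show ?thesis using ne by simp
  qed
  define e :: "real^'n" where "e = (SOME b. b \<in> Basis)"
  have e: "norm e = 1" unfolding e_def by (rule norm_Basis[OF SOME_Basis])
  have dim: "DIM(real^'n) \<ge> 2" using n by simp
  obtain e' where e': "orthonormal e e'" using exists_orthonormal[OF e dim] by metis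
  define T where "T = tri e e'"
  have T: "T \<in> convex_bodies" by (simp add: T_def)
  \<comment> \<open>The three values contradict additivity: the products with \<open>e\<close>,
    \<open>e'\<close> and \<open>e + e'\<close> would all be \<open>1 / 2\<close>.\<close>
  have "2 * (steiner_point T \<bullet> e) = 1" "2 * (steiner_point T \<bullet> e') = 1" "2 * (steiner_point T \<bullet> (e + e')) = 1"
    unfolding odd[OF T, symmetric] using orthonormalD[OF e']
    by (simp_all add: T_def hs_tri pmax_def inner_add_right inner_diff_right inner_commute[of e' e])
  then show False by (simp add: inner_add_right)
qed

theorem theorem1p2:
  assumes "CARD('n::finite) \<ge> 3"
  shows "(\<forall>\<Phi> :: (real ^ 'n) set \<Rightarrow> (real ^ 'n) set.
            \<Phi> \<in> convex_bodies \<rightarrow> convex_bodies \<longrightarrow>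
            (minkowski_endomorphism \<Phi> \<and> volume_constraint \<Phi> \<longleftrightarrow>
             (\<exists>a b :: real. a \<ge> 0 \<and> b \<ge> 0 \<and> a + b > 0 \<and>
                (\<forall>K\<in>convex_bodies.
                   \<Phi> K = (\<lambda>x. a *\<^sub>R (x - steiner_point K)) ` K
                       + (\<lambda>x. b *\<^sub>R (- x + steiner_point K)) ` K))))
       \<and> (\<forall>\<Phi> :: (real ^ 'n) set \<Rightarrow> (real ^ 'n) set.
            \<Phi> \<in> convex_bodies \<rightarrow> symmetric_convex_bodies \<longrightarrow>
            (minkowski_endomorphism \<Phi> \<and> volume_constraint \<Phi> \<longleftrightarrow>
             (\<exists>c>0. \<forall>K\<in>convex_bodies. \<Phi> K = (\<lambda>x. c *\<^sub>R x) ` difference_body K)))"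
proof -
  have n2: "CARD('n) \<ge> 2" using assms by simp
  have conv: "minkowski_endomorphism \<Phi> \<and> volume_constraint \<Phi>"
    if "0 \<le> a" "0 \<le> b" "0 < a + b" "\<And>K. K \<in> convex_bodies \<Longrightarrow> \<Phi> K = steiner_comb a b K"
    for \<Phi> :: "(real^'n) set \<Rightarrow> (real^'n) set" and a b
    by (rule endomorphism_vc_cong[OF that(4) minkowski_endomorphism_steiner_comb[OF n2 that(1,2)]
          volume_constraint_steiner_comb[OF that(1-3)]])
  have ex: "\<exists>a b. 0 \<le> a \<and> 0 \<le> b \<and> a + b > 0 \<and> (\<forall>K\<in>convex_bodies. \<Phi> K = steiner_comb a b K)"
    if "minkowski_endomorphism \<Phi> \<and> volume_constraint \<Phi>" for \<Phi> :: "(real^'n) set \<Rightarrow> (real^'n) set"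
  proof -
    interpret vc_endomorphism \<Phi>
      by unfold_locales (use that assms in auto)
    show ?thesis by (rule exists_steiner_comb)
  qed
  show ?thesis
  proof (intro conjI allI impI)
    fix \<Phi> :: "(real^'n) set \<Rightarrow> (real^'n) set"
    show "minkowski_endomorphism \<Phi> \<and> volume_constraint \<Phi> \<longleftrightarrow>
        (\<exists>a b :: real. a \<ge> 0 \<and> b \<ge> 0 \<and> a + b > 0 \<and>
           (\<forall>K\<in>convex_bodies. \<Phi> K = (\<lambda>x. a *\<^sub>R (x - steiner_point K)) ` K
              + (\<lambda>x. b *\<^sub>R (- x + steiner_point K)) ` K))"
      unfolding steiner_comb_def[symmetric]
    proof
      assume "\<exists>a b. 0 \<le> a \<and> 0 \<le> b \<and> 0 < a + b \<and> (\<forall>K\<in>convex_bodies. \<Phi> K = steiner_comb a b K)"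
      then obtain a b where ab: "0 \<le> a" "0 \<le> b" "0 < a + b" and eq: "\<forall>K\<in>convex_bodies. \<Phi> K = steiner_comb a b K"
        by blast
      show "minkowski_endomorphism \<Phi> \<and> volume_constraint \<Phi>" by (rule conv[OF ab bspec[OF eq]])
    qed (rule ex)
  next
    fix \<Phi> :: "(real^'n) set \<Rightarrow> (real^'n) set"
    assume sym: "\<Phi> \<in> convex_bodies \<rightarrow> symmetric_convex_bodies"
    show "minkowski_endomorphism \<Phi> \<and> volume_constraint \<Phi> \<longleftrightarrow>
        (\<exists>c>0. \<forall>K\<in>convex_bodies. \<Phi> K = (\<lambda>x. c *\<^sub>R x) ` difference_body K)"
    proof
      assume "minkowski_endomorphism \<Phi> \<and> volume_constraint \<Phi>"
      then obtain a b where ab: "0 \<le> a" "0 \<le> b" "0 < a + b" and eq: "\<forall>K\<in>convex_bodies. \<Phi> K = steiner_comb a b K"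
        using ex by blast
      have "steiner_comb a b K = uminus ` steiner_comb a b K" if K: "K \<in> convex_bodies" for K :: "(real^'n) set"
      proof -
        have "\<Phi> K \<in> symmetric_convex_bodies" by (rule funcset_mem[OF sym K])
        then have "\<Phi> K = uminus ` \<Phi> K" unfolding symmetric_convex_bodies_def mem_Collect_eq by (rule conjunct2)
        then show ?thesis unfolding bspec[OF eq K] .
      qed
      then have "a = b" by (rule steiner_comb_symmetric_imp_eq[OF n2 ab(1,2)])
      then have "\<Phi> K = (*\<^sub>R) a ` difference_body K" if K: "K \<in> convex_bodies" for K
        using bspec[OF eq K] steiner_comb_same[OF K ab(1)] by simp
      moreover have "0 < a" using \<open>a = b\<close> ab(3) by simp
      ultimately show "\<exists>c>0. \<forall>K\<in>convex_bodies. \<Phi> K = (*\<^sub>R) c ` difference_body K"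
        by (intro exI[of _ a] conjI ballI)
    next
      assume "\<exists>c>0. \<forall>K\<in>convex_bodies. \<Phi> K = (*\<^sub>R) c ` difference_body K"
      then obtain c where c: "0 < c" and eq: "\<forall>K\<in>convex_bodies. \<Phi> K = (*\<^sub>R) c ` difference_body K" by blast
      show "minkowski_endomorphism \<Phi> \<and> volume_constraint \<Phi>"
      proof (rule conv[of c c])
        show "\<Phi> K = steiner_comb c c K" if K: "K \<in> convex_bodies" for K
          unfolding bspec[OF eq K] using steiner_comb_same[OF K] c by simp
      qed (use c in auto)
    qed
  qed
qed

end
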